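(* The integral sequences $\chi_n$, $\lambda_n$ and $\delta_n$ can be expressed as follows. (i) For every integer $n\ge1$, $$\chi_{2n} = -\frac{4G}{\pi} + \frac{2^{4n+1}}{(2n-1)!} \sum_{k=1}^{n} \frac{1}{4^k} \left(n^2 P_{2k-2}\left(2n-1, n\right) + P_{2k}\left(2n+1, n+1\right)\right)\left(\zeta'\left(-2n+2k, \frac{n}{2}\right) - \zeta'\left(-2n+2k, \frac{n+1}{2}\right)\right)$$ $$\qquad +\frac{2^{4n+1}n^{2n}\ln\frac{n}{2}}{4^n(2n-1)!} \sum_{k=1}^{n}\frac{1}{n^{2k}} P_{2k}\left(2n+1, n+1\right) - \frac{2^{4n+1}}{(2n-1)!}\left(\zeta'\left(-2n, \frac{n+1}{2}\right) - \zeta'\left(-2n, \frac{n+2}{2}\right)\right).$$ (ii) For every integer $n\ge0$, $$\chi_{2n+1} = -\frac{4G}{\pi} + \frac{2^{4n-1}(2n + 1)^2}{(2n)!}\sum_{k=0}^n \frac{1}{4^k} P_{2k}\left(2n, \frac{2n+1}{2}\right)\left(\zeta'\left(-2n+2k+1, \frac{2n+1}{4}\right) - \zeta'\left(-2n+2k+1, \frac{2n+3}{4}\right)\right)$$ $$\qquad - \frac{2^{4n+3}}{(2n)!} \sum_{k=0}^{n+1} \frac{1}{4^k} P_{2k}\left(2n+2, \frac{2n+3}{2}\right)\left(\zeta'\left(-2n+2k-1, \frac{2n+3}{4}\right) - \zeta'\left(-2n+2k-1, \frac{2n+5}{4}\right)\right).$$ (iii) For every integer $n\ge1$, $$\lambda_{2n}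 = \frac{2^{4n}}{n(2n-1)!} \sum_{k=1}^{n} \frac{1}{4^k} \left(n^2 P_{2k-2}\left(2n-1, n\right) + P_{2k}\left(2n+1, n+1\right)\right)\left(\zeta'\left(-2n+2k, \frac{n}{2}\right) - \zeta'\left(-2n+2k, \frac{n+1}{2}\right)\right)$$ $$\qquad +\frac{2^{2n}n^{2n-1}\ln\frac{n}{2}}{(2n-1)!} \sum_{k=1}^{n}\frac{1}{n^{2k}} P_{2k}\left(2n+1, n+1\right) - \frac{2^{4n}}{n(2n-1)!}\left(\zeta'\left(-2n, \frac{n+1}{2}\right) - \zeta'\left(-2n, \frac{n+2}{2}\right)\right).$$ (iv) For every integer $n\ge0$, $$\lambda_{2n+1} = \frac{2^{4n-1}(2n + 1)}{(2n)!}\sum_{k=0}^n \frac{1}{4^k} P_{2k}\left(2n, \frac{2n+1}{2}\right)\left(\zeta'\left(-2n+2k+1, \frac{2n+1}{4}\right) - \zeta'\left(-2n+2k+1, \frac{2n+3}{4}\right)\right)$$ $$\qquad - \frac{2^{4n+3}}{(2n+1)!} \sum_{k=0}^{n+1} \frac{1}{4^k} P_{2k}\left(2n+2, \frac{2n+3}{2}\right)\left(\zeta'\left(-2n+2k-1, \frac{2n+3}{4}\right) - \zeta'\left(-2n+2k-1, \frac{2n+5}{4}\right)\right).$$ (v) For every integer $n\ge1$, $$\delta_n = \frac{2^{2n-1}(n+1)^2}{n!} \sum_{k=0}^{n} \left(-\frac{1}{2}\right)^k P_k\left(n, \frac{n+1}{2}\right)\left(\zeta'\left(k-n+1, \frac{n+1}{4}\right)-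 \zeta'\left(k-n+1, \frac{n+3}{4}\right)\right)$$ $$\qquad -\frac{2^{2n+3}}{n!} \sum_{k=0}^{n+2} \left(-\frac{1}{2}\right)^k P_k\left(n+2, \frac{n+3}{2}\right)\left(\zeta'\left(k-n-1, \frac{n+3}{4}\right) - \zeta'\left(k-n-1, \frac{n+5}{4}\right)\right)$$ $$\qquad - \frac{2^{2n-3}n^2}{(n-1)!} \sum_{k=0}^{n-1} \left(-\frac{1}{2}\right)^k P_k\left(n-1, \frac{n}{2}\right)\left(\zeta'\left(k-n+2, \frac{n}{4}\right)- \zeta'\left(k-n+2, \frac{n+2}{4}\right)\right)$$ $$\qquad + \frac{2^{2n+1}}{(n-1)!} \sum_{k=0}^{n+1} \left(-\frac{1}{2}\right)^k P_k\left(n+1, \frac{n+2}{2}\right) \left(\zeta'\left(k-n, \frac{n+2}{4}\right) - \zeta'\left(k-n, \frac{n+4}{4}\right)\right).$$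
   Context: For integers $n\ge1$ define $$\lambda_n := \int_0^{\infty}\frac{\tanh x\,\operatorname{sech}^n x}{x}\,dx,\qquad \delta_n := \int_0^{\infty} \frac{1 - \operatorname{sech} x}{x^2}\operatorname{sech}^n x\, dx,\qquad \chi_{n} := \int_0^{\infty}\frac{\operatorname{sech} x - \operatorname{sech}^n x}{x^2}\,dx.$$ $G=\sum_{k\ge0}(-1)^k/(2k+1)^2$ is Catalan's constant. $(a)_n := a(a+1)\cdots(a+n-1)$ is the rising factorial, with $(a)_0=1$. Signed generalized Stirling polynomials of the first kind: for $m\in\mathbb{N}_0$ and $x\in\mathbb{C}$, $P_k(m,x)$, $0\le k\le m$, are defined by the polynomial identity in $j$ $$(j+1)_m = \sum_{k=0}^m (-1)^k P_k(m, x)\,(j + x)^{m-k}.$$ $\zeta(s,z)$ is the Hurwitz zeta function, $\zeta(s,z)=\sum_{n\ge0}(n+z)^{-s}$ for $\operatorname{Re}s>1$, continued analytically to $s\in\mathbb{C}\setminus\{1\}$, and $\zeta'(s,z)=\frac{\partial}{\partial s}\zeta(s,z)$. At $s=1$ the differences are understood as limits: $\zeta'(1,x)-\zeta'\left(1,x+\tfrac12\right):=\lim_{s\to1}\left[\zeta'(s,x)-\zeta'\left(s,x+\tfrac12\right)\right]$. *)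

theory Defs
  imports "HOL-Complex_Analysis.Complex_Analysis"
begin

definition sech :: "real \<Rightarrow> real" where
  "sech x = 1 / cosh x"

text \<open>For $n \ge 1$ the integrands below are absolutely integrable on the open half line, so the Lebesgue
  integral is the improper integral over $[0,\infty)$.\<close>

definition lambda_int :: "nat \<Rightarrow> real" where
  "lambda_int n = (LBINT x:{0<..}. tanh x * sech x ^ n / x)"

definition delta_int :: "nat \<Rightarrow> real" where
  "delta_int n = (LBINT x:{0<..}. (1 - sech x) / x\<^sup>2 * sech x ^ n)"

definition chi_int :: "nat \<Rightarrow> real" where
  "chi_int n = (LBINT x:{0<..}. (sech x - sech x ^ n) / x\<^sup>2)"

definition catalan_const :: real where
  "catalan_const = (\<Sum>k. (-1) ^ k / (2 * real k + 1)\<^sup>2)"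

text \<open>The condition \<open>\<forall>i>m. p i = 0\<close> only makes the family \<open>p\<close> unique as a function on
  all naturals; only the values with \<open>i \<le> m\<close> matter.\<close>

definition is_stirling_family :: "nat \<Rightarrow> complex \<Rightarrow> (nat \<Rightarrow> complex) \<Rightarrow> bool" where
  "is_stirling_family m x p \<longleftrightarrow>
     (\<forall>i>m. p i = 0) \<and>
     (\<forall>j. pochhammer (j + 1) m = (\<Sum>i\<le>m. (-1) ^ i * p i * (j + x) ^ (m - i)))"

definition stirlingP :: "nat \<Rightarrow> nat \<Rightarrow> complex \<Rightarrow> complex" where
  "stirlingP k m x = (THE p. is_stirling_family m x p) k"

lemma poly_pochhammer: "poly (pochhammer p m) y = pochhammer (poly p y) m"
  for p :: "complex poly"
  by (induction m) (simp_all add: pochhammer_Suc)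

lemma degree_pochhammer_le: "degree (pochhammer [:c, 1:] m) \<le> m" for c :: complex
proof (induction m)
  case (Suc m)
  have "degree ([:c, 1:] + of_nat m) \<le> 1"
    by (simp add: of_nat_poly)
  moreover have "degree (pochhammer [:c, 1:] (Suc m))
      \<le> degree (pochhammer [:c, 1:] m) + degree ([:c, 1:] + of_nat m)"
    unfolding pochhammer_Suc by (rule degree_mult_le)
  ultimately show ?case
    using Suc by linarith
qed auto

lemma ex1_stirling_family: "\<exists>!p. is_stirling_family m x p"
proof (rule ex_ex1I)
  define q where "q = pochhammer [:1 - x, 1:] m"
  define p where "p i = (if i \<le> m then (-1) ^ i * coeff q (m - i) else 0)" for i
  have "pochhammer (j + 1) m = (\<Sum>i\<le>m. (-1) ^ i * p i * (j + x) ^ (m - i))" for j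
  proof -
    have "pochhammer (j + 1) m = poly q (j + x)"
      by (simp add: q_def poly_pochhammer add.commute)
    also have "\<dots> = (\<Sum>i\<le>m. coeff q i * (j + x) ^ i)"
      unfolding poly_altdef
      by (rule sum.mono_neutral_left)
         (use degree_pochhammer_le[of "1 - x" m] in \<open>auto simp: q_def coeff_eq_0\<close>)
    also have "\<dots> = (\<Sum>i\<le>m. coeff q (m - i) * (j + x) ^ (m - i))"
      by (rule sum.reindex_bij_witness[of _ "\<lambda>i. m - i" "\<lambda>i. m - i"]) auto
    also have "\<dots> = (\<Sum>i\<le>m. (-1) ^ i * p i * (j + x) ^ (m - i))"
      by (rule sum.cong) (simp_all add: p_def flip: power_mult_distrib mult.assoc)
    finally show ?thesis .
  qed
  then have "is_stirling_family m x p"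
    by (auto simp: is_stirling_family_def p_def)
  then show "\<exists>p. is_stirling_family m x p" by (rule exI[of _ p])
next
  fix p p' assume *: "is_stirling_family m x p" "is_stirling_family m x p'"
  define Q where "Q r = (\<Sum>i\<le>m. monom ((-1) ^ i * r i) (m - i))" for r :: "nat \<Rightarrow> complex"
  have "poly (Q p) y = poly (Q p') y" for y
  proof -
    have "poly (Q r) y = pochhammer (y - x + 1) m" if "is_stirling_family m x r" for r
      using that by (simp add: Q_def is_stirling_family_def poly_sum poly_monom)
    with * show ?thesis by simp
  qed
  then have Q: "Q p = Q p'"
    by (simp flip: poly_eq_poly_eq_iff add: fun_eq_iff)
  have coeff_Q: "coeff (Q r) (m - k) = (-1) ^ k * r k" if "k \<le> m" for r k
  proof -
    have "coeff (Q r) (m - k) = (\<Sum>i\<le>m. if i = k then (-1) ^ i * r i else 0)"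
      unfolding Q_def coeff_sum
    proof (rule sum.cong)
      fix i assume "i \<in> {..m}"
      with that have "m - i = m - k \<longleftrightarrow> i = k"
        by (auto simp: eq_diff_iff)
      then show "coeff (monom ((-1) ^ i * r i) (m - i)) (m - k) = (if i = k then (-1) ^ i * r i else 0)"
        by simp
    qed simp
    with that show ?thesis by simp
  qed
  show "p = p'"
  proof
    fix k show "p k = p' k"
    proof (cases "k \<le> m")
      case True
      then have "(-1) ^ k * p k = (-1) ^ k * p' k"
        using coeff_Q[of k p] coeff_Q[of k p'] Q by simp
      then show ?thesis by simp
    next
      case False
      with * show ?thesis by (simp add: is_stirling_family_def)
    qed
  qed
qed

lemma stirlingP_identity:
  "pochhammer (j + 1) m = (\<Sum>k\<le>m. (-1) ^ k * stirlingP k m x * (j + x) ^ (m - k))"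
proof -
  have "is_stirling_family m x (\<lambda>k. stirlingP k m x)"
    unfolding stirlingP_def by (rule theI'[OF ex1_stirling_family])
  then show ?thesis
    unfolding is_stirling_family_def by blast
qed

text \<open>The Hurwitz zeta function is the analytic continuation of its Dirichlet series; the value
  at the pole is set to 0 so that the function is determined on the whole plane.\<close>

definition is_hurwitz_continuation :: "complex \<Rightarrow> (complex \<Rightarrow> complex) \<Rightarrow> bool" where
  "is_hurwitz_continuation z f \<longleftrightarrow>
     f holomorphic_on (- {1}) \<and> f 1 = 0 \<and>
     (\<forall>s. Re s > 1 \<longrightarrow> (\<lambda>n. (of_nat n + z) powr (- s)) sums f s)"

definition hurwitz_zeta :: "complex \<Rightarrow> complex \<Rightarrow> complex" where
  "hurwitz_zeta s z = (THE f. is_hurwitz_continuation z f) s"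

lemma is_hurwitz_continuation_unique:
  assumes f: "is_hurwitz_continuation z f" and g: "is_hurwitz_continuation z g"
  shows "f = g"
proof
  fix s
  show "f s = g s"
  proof (cases "s = 1")
    case True
    with f g show ?thesis by (simp add: is_hurwitz_continuation_def)
  next
    case False
    show ?thesis
    proof (rule analytic_continuation_open[of "{s. Re s > 1}" "- {1}" f g])
      show "{s. Re s > 1} \<noteq> {}"
        by (auto intro: exI[of _ 2])
      show "connected (- {1::complex})"
        by (rule connected_punctured_universe) simp
      show "f w = g w" if "w \<in> {s. Re s > 1}" for w
        using f g that by (auto simp: is_hurwitz_continuation_def intro: sums_unique2)
    qed (use f g False in \<open>auto simp: is_hurwitz_continuation_def open_halfspace_Re_gt\<close>)
  qed
qed

definition hurwitz_zeta' :: "complex \<Rightarrow> complex \<Rightarrow> complex" where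
  "hurwitz_zeta' s z = deriv (\<lambda>w. hurwitz_zeta w z) s"

text \<open>The difference $\zeta'(s,x) - \zeta'(s,y)$, read as a limit at the common pole $s = 1$.\<close>

definition hurwitz_zeta'_diff :: "complex \<Rightarrow> complex \<Rightarrow> complex \<Rightarrow> complex" where
  "hurwitz_zeta'_diff s x y =
     (if s = 1 then Lim (at 1) (\<lambda>w. hurwitz_zeta' w x - hurwitz_zeta' w y)
      else hurwitz_zeta' s x - hurwitz_zeta' s y)"

end

theory Submission
  imports Defs
begin

text \<open>All three integrals reduce to the moments
\<open>M\<^sub>n = \<integral>\<^sub>0\<^sup>\<infinity> (1 - sech\<^sup>n x) / x\<^sup>2 dx\<close>: integration by parts gives \<open>n \<lambda>\<^sub>n = M\<^sub>n\<close>, and splitting the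
integrands gives \<open>\<delta>\<^sub>n = M\<^sub>n\<^sub>+\<^sub>1 - M\<^sub>n\<close> and \<open>\<chi>\<^sub>n = M\<^sub>n - M\<^sub>1\<close>. The constant \<open>M\<^sub>1 = 4G/\<pi>\<close> comes from
the partial fraction expansion of \<open>sech\<close>, integrated term by term (\<open>sech_moment_1\<close>).

For the general moment, expand \<open>sech\<^sup>n x\<close> in powers of \<open>e\<^sup>-\<^sup>2\<^sup>x\<close>. The coefficient of
\<open>e\<^bsup>-(2j+n)x\<^esup>\<close> is a polynomial in \<open>j\<close>, namely a rising factorial up to scale and the sign \<open>(-1)\<^sup>j\<close>, and the
Stirling polynomials rewrite it in powers of \<open>j + n/2\<close>. Hence \<open>4\<^sup>s / \<Gamma>(s)\<close> times the Mellin
transform of \<open>sech\<^sup>n\<close> is a finite combination \<open>Z\<^sub>n(s)\<close> of alternating Dirichlet series, each of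
which is a difference of two Hurwitz zeta functions whose poles at 1 cancel (\<open>sech_zeta\<close>,
\<open>mellin_sech_power\<close>). The series converge absolutely only for \<open>Re s > n\<close>; since \<open>Z\<^sub>n\<close> is entire, the
identity extends to \<open>Re s > 0\<close>.

The number \<open>-M\<^sub>n\<close> is the Mellin transform \<open>J\<close> of \<open>sech\<^sup>n - 1\<close> at \<open>-1\<close>, outside that half plane.
Differentiating twice bridges the gap: \<open>(sech\<^sup>n)'' = n\<^sup>2 sech\<^sup>n - n(n+1) sech\<^sup>n\<^sup>+\<^sup>2\<close>, so two
integrations by parts turn \<open>(s-1)(s-2) J(s-2)\<close> into a combination of Mellin transforms of
\<open>sech\<^sup>n\<close> and \<open>sech\<^sup>n\<^sup>+\<^sup>2\<close> at \<open>s\<close>. Both sides vanish at \<open>s = 1\<close>, and comparing derivatives there yields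
\<open>4 M\<^sub>n = n\<^sup>2 Z\<^sub>n'(1) - n(n+1) Z\<^sub>n\<^sub>+\<^sub>2'(1)\<close> (\<open>sech_moment_eq_deriv_sech_zeta\<close>); the factors from
\<open>\<Gamma>\<close> and \<open>4\<^sup>s\<close> leave no trace because of the zero. This is where the derivatives of the zeta
function come from.

The five formulas are this identity after bookkeeping. Stirling polynomials of odd index vanish at
the symmetric centre, which leaves only even indices in the formulas for even and odd \<open>n\<close> separately,
and for even \<open>n\<close> the shift \<open>\<zeta>(s,a) - \<zeta>(s,a+1) = a\<^sup>-\<^sup>s\<close> merges two sums and produces the logarithm.\<close>

section \<open>Mellin transforms\<close>

definition mellin :: "(real \<Rightarrow> complex) \<Rightarrow> complex \<Rightarrow> complex" where
  "mellin f s = (LBINT x:{0<..}. of_real x powr (s - 1) * f x)"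

text \<open>Functions of size \<open>x\<^sup>-\<^sup>\<alpha>\<close> near 0 and \<open>x\<^sup>-\<^sup>\<beta>\<close> near infinity. Their Mellin transform lives on the
strip \<open>\<alpha> < Re s < \<beta>\<close>, and on the same strip the boundary terms of an integration by parts vanish,
so this one condition carries all analytic side conditions below.\<close>

definition mellin_class :: "real \<Rightarrow> real \<Rightarrow> (real \<Rightarrow> complex) \<Rightarrow> bool" where
  "mellin_class \<alpha> \<beta> f \<longleftrightarrow> continuous_on {0<..} f \<and>
     (\<exists>C. \<forall>x>0. (x \<le> 1 \<longrightarrow> norm (f x) \<le> C * x powr (- \<alpha>)) \<and> (1 \<le> x \<longrightarrow> norm (f x) \<le> C * x powr (- \<beta>)))"

lemma mellin_classI:
  assumes "continuous_on {0<..} f"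
    and "\<And>x. 0 < x \<Longrightarrow> x \<le> 1 \<Longrightarrow> norm (f x) \<le> A * x powr (- \<alpha>)"
    and "\<And>x. 1 \<le> x \<Longrightarrow> norm (f x) \<le> B * x powr (- \<beta>)"
  shows "mellin_class \<alpha> \<beta> f"
  unfolding mellin_class_def
proof (intro conjI exI[of _ "max A B"] allI impI)
  fix x :: real assume x: "0 < x"
  { assume "x \<le> 1"
    have "norm (f x) \<le> A * x powr (- \<alpha>)" using assms(2) x \<open>x \<le> 1\<close> by blast
    also have "\<dots> \<le> max A B * x powr (- \<alpha>)" by (intro mult_right_mono) auto
    finally show "norm (f x) \<le> max A B * x powr (- \<alpha>)" . }
  { assume "1 \<le> x"
    have "norm (f x) \<le> B * x powr (- \<beta>)" using assms(3) \<open>1 \<le> x\<close> by blast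
    also have "\<dots> \<le> max A B * x powr (- \<beta>)" by (intro mult_right_mono) auto
    finally show "norm (f x) \<le> max A B * x powr (- \<beta>)" . }
qed (use assms in auto)

lemma mellin_class_mono:
  assumes "mellin_class \<alpha> \<beta> f" "\<alpha> \<le> \<alpha>'" "\<beta>' \<le> \<beta>"
  shows "mellin_class \<alpha>' \<beta>' f"
proof -
  obtain C where C: "\<And>x. 0 < x \<Longrightarrow> x \<le> 1 \<Longrightarrow> norm (f x) \<le> C * x powr (- \<alpha>)"
      "\<And>x. 1 \<le> x \<Longrightarrow> norm (f x) \<le> C * x powr (- \<beta>)"
    using assms(1) unfolding mellin_class_def by (metis less_le_trans zero_less_one)
  have "0 \<le> C" using order.trans[OF norm_ge_zero C(2)[of 1]] by simp
  show ?thesis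
  proof (rule mellin_classI[of _ C _ C])
    fix x :: real assume x: "0 < x" "x \<le> 1"
    note C(1)[OF x]
    also have "C * x powr (- \<alpha>) \<le> C * x powr (- \<alpha>')"
      using x assms \<open>0 \<le> C\<close> by (intro mult_left_mono powr_mono') auto
    finally show "norm (f x) \<le> C * x powr (- \<alpha>')" .
  next
    fix x :: real assume x: "1 \<le> x"
    note C(2)[OF x]
    also have "C * x powr (- \<beta>) \<le> C * x powr (- \<beta>')"
      using x assms \<open>0 \<le> C\<close> by (intro mult_left_mono powr_mono) auto
    finally show "norm (f x) \<le> C * x powr (- \<beta>')" .
  qed (use assms in \<open>auto simp: mellin_class_def\<close>)
qed

text \<open>With \<open>N = \<lceil>\<sigma>\<rceil>\<close>, the single term \<open>y\<^sup>N / N!\<close> of the exponential series gives the bound for \<open>y \<ge> 1\<close>.\<close>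

lemma powr_le_fact_exp:
  fixes y \<sigma> :: real
  assumes "0 < y" "0 \<le> \<sigma>"
  shows "y powr \<sigma> \<le> fact (nat \<lceil>\<sigma>\<rceil>) * exp y"
proof (cases "y \<le> 1")
  case True
  have "y powr \<sigma> \<le> 1 powr \<sigma>" using assms True by (intro powr_mono2) auto
  also have "\<dots> \<le> 1 * exp y" using assms by simp
  also have "\<dots> \<le> fact (nat \<lceil>\<sigma>\<rceil>) * exp y"
    by (intro mult_right_mono) (auto simp: fact_ge_1)
  finally show ?thesis .
next
  case False
  define N where "N = nat \<lceil>\<sigma>\<rceil>"
  have "\<sigma> \<le> real N" unfolding N_def by linarith
  have "y powr \<sigma> \<le> y powr (real N)"
    using False \<open>\<sigma> \<le> real N\<close> by (intro powr_mono) auto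
  also have "\<dots> = fact N * (y ^ N /\<^sub>R fact N)" using assms by (simp add: powr_realpow)
  also have "y ^ N /\<^sub>R fact N \<le> exp y"
  proof -
    have "(\<Sum>k\<in>{N}. y ^ k /\<^sub>R fact k) \<le> (\<Sum>k. y ^ k /\<^sub>R fact k)"
      using assms by (intro sum_le_suminf summable_exp_generic) auto
    thus ?thesis by (simp add: exp_def)
  qed
  hence "fact N * (y ^ N /\<^sub>R fact N) \<le> fact N * exp y"
    by (intro mult_left_mono) auto
  finally show ?thesis by (simp add: N_def)
qed

text \<open>Continuous functions with exponential decay that are bounded near 0 have a Mellin transform on the
whole half plane \<open>Re s > 0\<close>, because \<open>\<beta>\<close> can be chosen as large as needed.\<close>

lemma mellin_class_exp_decay:
  assumes "continuous_on {0<..} f" and "0 < c" "0 \<le> \<beta>"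
    and bound: "\<And>x. 0 < x \<Longrightarrow> norm (f x) \<le> C * exp (- c * x)"
  shows "mellin_class 0 \<beta> f"
proof -
  have "0 \<le> C * exp (- c * 1)" using order.trans[OF norm_ge_zero bound[of 1]] by simp
  hence "0 \<le> C" by (simp add: zero_le_mult_iff)
  define K where "K = C * fact (nat \<lceil>\<beta>\<rceil>) * c powr (- \<beta>)"
  show ?thesis
  proof (rule mellin_classI[of _ C _ K])
    fix x :: real assume x: "0 < x" "x \<le> 1"
    note bound[OF x(1)]
    also have "C * exp (- c * x) \<le> C * 1"
      using \<open>0 \<le> C\<close> x \<open>0 < c\<close> by (intro mult_left_mono) auto
    finally show "norm (f x) \<le> C * x powr (- 0)" using x by simp
  next
    fix x :: real assume x: "1 \<le> x"
    have "norm (f x) \<le> C * exp (- c * x)" using bound x by simp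
    also have "exp (- c * x) \<le> fact (nat \<lceil>\<beta>\<rceil>) * (c powr (- \<beta>) * x powr (- \<beta>))"
      using powr_le_fact_exp[of "c * x" \<beta>] x assms
      by (simp add: powr_mult powr_minus exp_minus field_simps)
    hence "C * exp (- c * x) \<le> C * (fact (nat \<lceil>\<beta>\<rceil>) * (c powr (- \<beta>) * x powr (- \<beta>)))"
      using \<open>0 \<le> C\<close> by (intro mult_left_mono)
    finally show "norm (f x) \<le> K * x powr (- \<beta>)" by (simp add: K_def mult_ac)
  qed fact
qed

lemma powr_integrable_unit:
  assumes "p > -1"
  shows "set_integrable lborel {0<..1} (\<lambda>x::real. x powr p)"
proof -
  have "(\<lambda>x. x powr p) absolutely_integrable_on {0..1::real}"
    using integrable_on_powr_from_0[OF assms, of 1]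
    by (intro nonnegative_absolutely_integrable_1) auto
  hence "(\<lambda>x. x powr p) absolutely_integrable_on {0<..1::real}"
    by (rule set_integrable_subset) auto
  thus ?thesis
    by (auto simp: set_integrable_def integrable_completion)
qed

lemma powr_integrable_tail:
  assumes "p < -1"
  shows "set_integrable lborel {1..} (\<lambda>x::real. x powr p)"
proof -
  have "(\<lambda>x. x powr p) integrable_on {1::real..}"
    using has_integral_powr_to_inf[of p 1] assms by (auto simp: integrable_on_def)
  hence "(\<lambda>x. x powr p) absolutely_integrable_on {1::real..}"
    by (intro nonnegative_absolutely_integrable_1) auto
  thus ?thesis
    by (auto simp: set_integrable_def integrable_completion)
qed

lemma mellin_integrable:
  assumes f: "mellin_class \<alpha> \<beta> f" and s: "\<alpha> < Re s" "Re s < \<beta>"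
  shows "set_integrable lborel {0<..} (\<lambda>x. of_real x powr (s - 1) * f x)"
proof -
  obtain C where C: "\<And>x. 0 < x \<Longrightarrow> x \<le> 1 \<Longrightarrow> norm (f x) \<le> C * x powr (- \<alpha>)"
      "\<And>x. 1 \<le> x \<Longrightarrow> norm (f x) \<le> C * x powr (- \<beta>)"
    using f unfolding mellin_class_def by (metis less_le_trans zero_less_one)
  have cont: "continuous_on {0<..} (\<lambda>x. of_real x powr (s - 1) * f x)"
    using f by (auto simp: mellin_class_def intro!: continuous_intros)
  have meas: "set_borel_measurable lborel {0<..} (\<lambda>x. of_real x powr (s - 1) * f x)"
    using borel_measurable_continuous_on_indicator[OF _ cont]
    by (simp add: set_borel_measurable_def)
  have 1: "set_integrable lborel {0<..1} (\<lambda>x. of_real x powr (s - 1) * f x)"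
  proof (rule set_integrable_bound)
    show "set_integrable lborel {0<..1} (\<lambda>x. C * x powr (Re s - 1 - \<alpha>))"
      using s by (intro set_integrable_mult_right powr_integrable_unit) auto
    show "set_borel_measurable lborel {0<..1} (\<lambda>x. of_real x powr (s - 1) * f x)"
      by (rule set_borel_measurable_subset[OF meas]) auto
    show "AE x in lborel. x \<in> {0<..1} \<longrightarrow>
        norm (of_real x powr (s - 1) * f x) \<le> norm (C * x powr (Re s - 1 - \<alpha>))"
    proof (intro AE_I2 impI)
      fix x :: real assume x: "x \<in> {0<..1}"
      have "norm (of_real x powr (s - 1) * f x) \<le> x powr (Re s - 1) * (C * x powr (- \<alpha>))"
        using x C(1)[of x] by (auto simp: norm_mult norm_powr_real_powr intro!: mult_left_mono)
      also have "\<dots> = C * x powr (Re s - 1 - \<alpha>)"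
        using powr_add[of x "Re s - 1" "-\<alpha>"] by simp
      finally show "norm (of_real x powr (s - 1) * f x) \<le> norm (C * x powr (Re s - 1 - \<alpha>))"
        by simp
    qed
  qed
  have 2: "set_integrable lborel {1..} (\<lambda>x. of_real x powr (s - 1) * f x)"
  proof (rule set_integrable_bound)
    show "set_integrable lborel {1..} (\<lambda>x. C * x powr (Re s - 1 - \<beta>))"
      using s by (intro set_integrable_mult_right powr_integrable_tail) auto
    show "set_borel_measurable lborel {1..} (\<lambda>x. of_real x powr (s - 1) * f x)"
      by (rule set_borel_measurable_subset[OF meas]) auto
    show "AE x in lborel. x \<in> {1..} \<longrightarrow>
        norm (of_real x powr (s - 1) * f x) \<le> norm (C * x powr (Re s - 1 - \<beta>))"
    proof (intro AE_I2 impI)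
      fix x :: real assume x: "x \<in> {1..}"
      have "norm (of_real x powr (s - 1) * f x) \<le> x powr (Re s - 1) * (C * x powr (- \<beta>))"
        using x C(2)[of x] by (auto simp: norm_mult norm_powr_real_powr intro!: mult_left_mono)
      also have "\<dots> = C * x powr (Re s - 1 - \<beta>)"
        using powr_add[of x "Re s - 1" "-\<beta>"] by simp
      finally show "norm (of_real x powr (s - 1) * f x) \<le> norm (C * x powr (Re s - 1 - \<beta>))"
        by simp
    qed
  qed
  have "set_integrable lborel ({0<..1} \<union> {1..}) (\<lambda>x. of_real x powr (s - 1) * f x)"
    by (rule set_integrable_Un[OF 1 2]) auto
  also have "{0<..1} \<union> {1..} = {0::real<..}" by auto
  finally show ?thesis .
qed

lemma mellin_class_limits:
  assumes f: "mellin_class \<alpha> \<beta> f" and s: "\<alpha> < Re s" "Re s < \<beta>"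
  shows "((\<lambda>x. of_real x powr s * f x) \<longlongrightarrow> 0) (at_right 0)"
    and "((\<lambda>x. of_real x powr s * f x) \<longlongrightarrow> 0) at_top"
proof -
  obtain C where C: "\<And>x. 0 < x \<Longrightarrow> x \<le> 1 \<Longrightarrow> norm (f x) \<le> C * x powr (- \<alpha>)"
      "\<And>x. 1 \<le> x \<Longrightarrow> norm (f x) \<le> C * x powr (- \<beta>)"
    using f unfolding mellin_class_def by (metis less_le_trans zero_less_one)
  show "((\<lambda>x. of_real x powr s * f x) \<longlongrightarrow> 0) (at_right 0)"
  proof (rule Lim_null_comparison)
    show "\<forall>\<^sub>F x in at_right 0. norm (of_real x powr s * f x) \<le> C * x powr (Re s - \<alpha>)"
      using eventually_at_right_real[of 0 1, OF zero_less_one]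
    proof eventually_elim
      case (elim x)
      have "norm (of_real x powr s * f x) \<le> x powr (Re s) * (C * x powr (- \<alpha>))"
        using elim C(1)[of x] by (auto simp: norm_mult norm_powr_real_powr intro!: mult_left_mono)
      thus ?case by (simp add: powr_diff powr_minus field_simps)
    qed
    have "((\<lambda>x::real. x powr (Re s - \<alpha>)) \<longlongrightarrow> 0 powr (Re s - \<alpha>)) (at_right 0)"
      using s by (intro tendsto_powr') (auto simp: eventually_at_filter)
    hence "((\<lambda>x::real. x powr (Re s - \<alpha>)) \<longlongrightarrow> 0) (at_right 0)" by simp
    from tendsto_mult_left[OF this, of C]
    show "((\<lambda>x::real. C * x powr (Re s - \<alpha>)) \<longlongrightarrow> 0) (at_right 0)" by simp
  qed
  show "((\<lambda>x. of_real x powr s * f x) \<longlongrightarrow> 0) at_top"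
  proof (rule Lim_null_comparison)
    show "\<forall>\<^sub>F x in at_top. norm (of_real x powr s * f x) \<le> C * x powr (Re s - \<beta>)"
      using eventually_ge_at_top[of 1]
    proof eventually_elim
      case (elim x)
      have "norm (of_real x powr s * f x) \<le> x powr (Re s) * (C * x powr (- \<beta>))"
        using elim C(2)[of x] by (auto simp: norm_mult norm_powr_real_powr intro!: mult_left_mono)
      thus ?case by (simp add: powr_diff powr_minus field_simps)
    qed
    have "((\<lambda>x::real. x powr (Re s - \<beta>)) \<longlongrightarrow> 0) at_top"
      using s by (intro tendsto_neg_powr filterlim_ident) auto
    from tendsto_mult_left[OF this, of C]
    show "((\<lambda>x::real. C * x powr (Re s - \<beta>)) \<longlongrightarrow> 0) at_top" by simp
  qed
qed

lemma LBINT_FTC_half_line: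
  fixes F F' :: "real \<Rightarrow> complex"
  assumes "\<And>x. 0 < x \<Longrightarrow> (F has_vector_derivative F' x) (at x)"
    and "continuous_on {0<..} F'"
    and "set_integrable lborel {0<..} F'"
    and "(F \<longlongrightarrow> A) (at_right 0)" and "(F \<longlongrightarrow> B) at_top"
  shows "(LBINT x:{0<..}. F' x) = B - A"
proof -
  have "(LBINT x=0..\<infinity>. F' x) = B - A"
  proof (rule interval_integral_FTC_integrable)
    show "isCont F' x" if "0 < ereal x" "ereal x < \<infinity>" for x
      using assms(2) that by (auto simp: continuous_on_eq_continuous_at)
    show "((F \<circ> real_of_ereal) \<longlongrightarrow> A) (at_right 0)"
      using assms(4) by (auto simp: zero_ereal_def ereal_tendsto_simps)
    show "((F \<circ> real_of_ereal) \<longlongrightarrow> B) (at_left \<infinity>)"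
      using assms(5) by (auto simp: ereal_tendsto_simps)
    show "set_integrable lborel (einterval 0 \<infinity>) F'"
      using assms(3) by (simp add: zero_ereal_def)
  qed (use assms in auto)
  thus ?thesis
    by (simp add: interval_lebesgue_integral_def zero_ereal_def)
qed

text \<open>The function \<open>x\<^sup>s f(x)\<close> tends to 0 at both ends of the half line, so the integral of its derivative
\<open>s x\<^bsup>s-1\<^esup> f(x) + x\<^sup>s f'(x)\<close> is 0.\<close>

lemma mellin_by_parts:
  assumes f: "mellin_class \<alpha> \<beta> f" and f': "mellin_class (\<alpha> + 1) (\<beta> + 1) f'"
    and d: "\<And>x. 0 < x \<Longrightarrow> (f has_vector_derivative f' x) (at x)"
    and s: "\<alpha> < Re s" "Re s < \<beta>"
  shows "mellin f' (s + 1) = - s * mellin f s"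
proof -
  let ?F' = "\<lambda>x. s * (of_real x powr (s - 1) * f x) + of_real x powr s * f' x"
  have i1: "set_integrable lborel {0<..} (\<lambda>x. s * (of_real x powr (s - 1) * f x))"
    by (intro set_integrable_mult_right) (use mellin_integrable[OF f s] in auto)
  have i2: "set_integrable lborel {0<..} (\<lambda>x. of_real x powr s * f' x)"
    using mellin_integrable[OF f', of "s + 1"] s by simp
  have "(LBINT x:{0<..}. ?F' x) = 0 - 0"
  proof (rule LBINT_FTC_half_line)
    fix x :: real assume x: "0 < x"
    have "((\<lambda>z. z powr s) has_field_derivative s * of_real x powr (s - 1)) (at (of_real x))"
      using x by (intro has_field_derivative_powr) (auto simp: complex_nonpos_Reals_iff)
    hence "((\<lambda>x. of_real x powr s) has_vector_derivative s * of_real x powr (s - 1)) (at x)"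
      by (rule has_vector_derivative_real_field)
    thus "((\<lambda>x. of_real x powr s * f x) has_vector_derivative ?F' x) (at x)"
      using d[OF x] by (auto intro!: derivative_eq_intros)
  next
    show "continuous_on {0<..} ?F'"
      using f f' by (auto simp: mellin_class_def intro!: continuous_intros)
    show "set_integrable lborel {0<..} ?F'" by (rule set_integral_add(1)[OF i1 i2])
  qed (use mellin_class_limits[OF f s] in auto)
  moreover have "(LBINT x:{0<..}. ?F' x) = s * mellin f s + mellin f' (s + 1)"
    by (subst set_integral_add(2)[OF i1 i2]) (simp add: mellin_def)
  ultimately show ?thesis by (simp add: add_eq_0_iff2 add.commute)
qed

text \<open>Around a point \<open>s\<^sub>0\<close> of the strip, expand \<open>x\<^bsup>s-s\<^sub>0\<^esup> = e\<^bsup>(s-s\<^sub>0) ln x\<^esup>\<close> as an exponential series and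
integrate term by term. This exhibits the transform as a power series in \<open>s - s\<^sub>0\<close>, which is
holomorphic without any differentiation under the integral.\<close>

lemma mellin_holomorphic:
  assumes f: "mellin_class \<alpha> \<beta> f"
  shows "mellin f holomorphic_on {s. \<alpha> < Re s \<and> Re s < \<beta>}"
proof -
  have "\<exists>r>0. mellin f holomorphic_on ball s0 r" if s0: "\<alpha> < Re s0" "Re s0 < \<beta>" for s0
  proof -
    define r where "r = min (Re s0 - \<alpha>) (\<beta> - Re s0)"
    have r: "r > 0" using s0 by (simp add: r_def)
    define h where "h x = of_real x powr (s0 - 1) * f x" for x :: real
    define a where "a k = (LBINT x:{0<..}. h x * (of_real (ln x) ^ k / fact k))" for k
    have conth: "continuous_on {0<..} h"
      unfolding h_def using f by (auto simp: mellin_class_def intro!: continuous_intros)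
    have "(\<lambda>k. a k * (w - s0) ^ k) sums mellin f w" if w: "w \<in> ball s0 r" for w
    proof -
      define \<rho> where "\<rho> = norm (w - s0)"
      have \<rho>: "0 \<le> \<rho>" "\<rho> < r" using w by (auto simp: \<rho>_def dist_norm norm_minus_commute)
      define u where "u k x = indicator {0<..} x *\<^sub>R (h x * ((w - s0) * of_real (ln x)) ^ k /\<^sub>R fact k)"
        for k and x :: real
      define W where "W x = norm (indicator {0<..} x *\<^sub>R (of_real x powr ((s0 + of_real \<rho>) - 1) * f x))
          + norm (indicator {0<..} x *\<^sub>R (of_real x powr ((s0 - of_real \<rho>) - 1) * f x))" for x :: real
      have W: "integrable lborel W"
        unfolding W_def
        by (intro Bochner_Integration.integrable_add integrable_norm;
            rule mellin_integrable[OF f, unfolded set_integrable_def])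
           (use \<rho> in \<open>auto simp: r_def\<close>)
      have meas: "u k \<in> borel_measurable lborel" for k
      proof -
        have "continuous_on {0<..} (\<lambda>x. h x * ((w - s0) * of_real (ln x)) ^ k /\<^sub>R fact k)"
          using conth by (auto intro!: continuous_intros)
        from borel_measurable_continuous_on_indicator[OF _ this] show ?thesis
          unfolding u_def by (simp del: scaleR_scaleR)
      qed
      \<comment> \<open>\<open>e\<^bsup>\<rho> \<bar>ln x\<bar>\<^esup> \<le> x\<^bsup>\<rho>\<^esup> + x\<^bsup>-\<rho>\<^esup>\<close> dominates every partial sum of the exponential series.\<close>
      have dom: "norm (\<Sum>k\<in>K. u k x) \<le> W x" if "finite K" for K x
      proof (cases "0 < x")
        case True
        have "norm (\<Sum>k\<in>K. u k x) \<le> (\<Sum>k\<in>K. norm (h x) * ((\<rho> * \<bar>ln x\<bar>) ^ k /\<^sub>R fact k))"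
          by (rule sum_norm_le) (use True in \<open>simp add: u_def \<rho>_def norm_mult norm_power power_mult_distrib mult_ac\<close>)
        also have "\<dots> = norm (h x) * (\<Sum>k\<in>K. (\<rho> * \<bar>ln x\<bar>) ^ k /\<^sub>R fact k)"
          by (simp add: sum_distrib_left)
        also have "(\<Sum>k\<in>K. (\<rho> * \<bar>ln x\<bar>) ^ k /\<^sub>R fact k) \<le> exp (\<rho> * \<bar>ln x\<bar>)"
          unfolding exp_def using \<rho> that by (intro sum_le_suminf summable_exp_generic) auto
        also have "exp (\<rho> * \<bar>ln x\<bar>) \<le> x powr \<rho> + x powr (-\<rho>)"
          using True by (cases "ln x \<ge> 0") (auto simp: powr_def)
        finally have "norm (\<Sum>k\<in>K. u k x) \<le> norm (h x) * (x powr \<rho> + x powr (-\<rho>))"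
          by (simp add: mult_left_mono)
        also have "\<dots> = W x"
          using True powr_add[of x "Re s0 - 1" \<rho>] powr_add[of x "Re s0 - 1" "-\<rho>"]
          by (simp add: W_def h_def norm_mult norm_powr_real_powr algebra_simps)
        finally show ?thesis .
      qed (auto simp: u_def W_def)
      have int: "integrable lborel (u k)" for k
        by (rule Bochner_Integration.integrable_bound[OF W meas])
           (use dom[of "{k}"] in \<open>auto intro!: AE_I2 order.trans[OF _ abs_ge_self]\<close>)
      have "(\<lambda>n. integral\<^sup>L lborel (\<lambda>x. \<Sum>k<n. u k x)) \<longlonglongrightarrow>
          integral\<^sup>L lborel (\<lambda>x. indicator {0<..} x *\<^sub>R (of_real x powr (w - 1) * f x))"
      proof (rule integral_dominated_convergence)
        show "(\<lambda>x. indicator {0<..} x *\<^sub>R (of_real x powr (w - 1) * f x)) \<in> borel_measurable lborel"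
        proof -
          have "continuous_on {0<..} (\<lambda>x. of_real x powr (w - 1) * f x)"
            using f by (auto simp: mellin_class_def intro!: continuous_intros)
          from borel_measurable_continuous_on_indicator[OF _ this] show ?thesis by simp
        qed
        show "(\<lambda>x. \<Sum>k<n. u k x) \<in> borel_measurable lborel" for n
          using meas by (intro borel_measurable_sum)
        show "AE x in lborel. norm (\<Sum>k<n. u k x) \<le> W x" for n
          using dom by (intro AE_I2) auto
        show "AE x in lborel. (\<lambda>n. \<Sum>k<n. u k x) \<longlonglongrightarrow>
            indicator {0<..} x *\<^sub>R (of_real x powr (w - 1) * f x)"
        proof (rule AE_I2)
          fix x :: real
          show "(\<lambda>n. \<Sum>k<n. u k x) \<longlonglongrightarrow> indicator {0<..} x *\<^sub>R (of_real x powr (w - 1) * f x)"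
          proof (cases "0 < x")
            case True
            have "(\<lambda>k. h x * (((w - s0) * of_real (ln x)) ^ k /\<^sub>R fact k)) sums
                (h x * exp ((w - s0) * of_real (ln x)))"
              by (intro sums_mult exp_converges)
            also have "h x * exp ((w - s0) * of_real (ln x)) = of_real x powr (w - 1) * f x"
              using True
              by (auto simp: h_def powr_def Ln_of_real simp flip: exp_add intro!: arg_cong[of _ _ exp])
                 (simp add: algebra_simps)
            finally show ?thesis using True by (simp add: sums_def u_def)
          qed (auto simp: u_def)
        qed
      qed (fact W)
      moreover have "integral\<^sup>L lborel (\<lambda>x. \<Sum>k<n. u k x) = (\<Sum>k<n. a k * (w - s0) ^ k)" for n
      proof -
        have "integral\<^sup>L lborel (u k) = a k * (w - s0) ^ k" for k
        proof -
          have "integral\<^sup>L lborel (u k) = (LBINT x:{0<..}. h x * (of_real (ln x) ^ k / fact k) * (w - s0) ^ k)"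
            unfolding set_lebesgue_integral_def u_def
            by (intro Bochner_Integration.integral_cong)
               (simp_all add: power_mult_distrib scaleR_conv_of_real divide_inverse mult_ac)
          thus ?thesis by (simp add: a_def)
        qed
        thus ?thesis using int by (simp add: Bochner_Integration.integral_sum)
      qed
      ultimately show ?thesis
        by (simp add: sums_def mellin_def set_lebesgue_integral_def)
    qed
    from power_series_holomorphic[OF this] r show ?thesis by blast
  qed
  note local = this
  show ?thesis
    unfolding holomorphic_on_def
  proof
    fix s0 assume "s0 \<in> {s. \<alpha> < Re s \<and> Re s < \<beta>}"
    then obtain r where "0 < r" "mellin f holomorphic_on ball s0 r" using local[of s0] by auto
    hence "mellin f field_differentiable (at s0)"
      by (intro holomorphic_on_imp_differentiable_at[of _ "ball s0 r"]) auto
    thus "mellin f field_differentiable (at s0 within {s. \<alpha> < Re s \<and> Re s < \<beta>})"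
      by (rule field_differentiable_at_within)
  qed
qed

lemma mellin_holomorphic_halfplane:
  assumes "\<And>\<beta>. 0 \<le> \<beta> \<Longrightarrow> mellin_class \<alpha> \<beta> f"
  shows "mellin f holomorphic_on {s. \<alpha> < Re s}"
proof -
  have "mellin f holomorphic_on (\<Union>\<beta>\<in>{0..}. {s. \<alpha> < Re s \<and> Re s < \<beta>})"
  proof (rule holomorphic_on_UN_open)
    fix \<beta> :: real assume "\<beta> \<in> {0..}"
    thus "mellin f holomorphic_on {s. \<alpha> < Re s \<and> Re s < \<beta>}"
      using assms by (intro mellin_holomorphic) auto
    show "open {s. \<alpha> < Re s \<and> Re s < \<beta>}"
      by (intro open_Collect_conj open_halfspace_Re_gt open_halfspace_Re_lt)
  qed
  also have "(\<Union>\<beta>\<in>{0..}. {s. \<alpha> < Re s \<and> Re s < \<beta>}) = {s. \<alpha> < Re s}"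
  proof (intro equalityI subsetI)
    fix s assume "s \<in> {s. \<alpha> < Re s}"
    thus "s \<in> (\<Union>\<beta>\<in>{0..}. {s. \<alpha> < Re s \<and> Re s < \<beta>})"
      by (intro UN_I[of "max 0 (Re s) + 1"]) auto
  qed auto
  finally show ?thesis .
qed

lemma mellin_exp:
  assumes b: "0 < b" and s: "0 < Re s"
  shows "set_integrable lborel {0<..} (\<lambda>x. of_real x powr (s - 1) * of_real (exp (- b * x)))"
    and "(LBINT x:{0<..}. of_real x powr (s - 1) * of_real (exp (- b * x))) = Gamma s * of_real b powr (- s)"
proof -
  have I: "set_integrable lborel {0<..} (\<lambda>x. of_real x powr (s - 1) * of_real (exp (- b * x)))"
    if b: "0 < b" for b :: real
  proof -
    have "(\<lambda>t. complex_of_real t powr (s - 1) / of_real (exp (b * t))) absolutely_integrable_on {0<..}"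
      by (rule absolutely_integrable_Gamma_integral[OF s b])
    also have "(\<lambda>t. complex_of_real t powr (s - 1) / of_real (exp (b * t))) =
        (\<lambda>x. of_real x powr (s - 1) * of_real (exp (- b * x)))"
      by (auto simp: exp_minus field_simps)
    finally have *: "(\<lambda>x. of_real x powr (s - 1) * of_real (exp (- b * x))) absolutely_integrable_on {0<..}" .
    have "continuous_on {0<..} (\<lambda>x. of_real x powr (s - 1) * complex_of_real (exp (- b * x)))"
      by (auto intro!: continuous_intros)
    from borel_measurable_continuous_on_indicator[OF _ this] *
    show ?thesis by (simp add: set_integrable_def integrable_completion)
  qed
  show "set_integrable lborel {0<..} (\<lambda>x. of_real x powr (s - 1) * of_real (exp (- b * x)))"
    by (rule I[OF b])
  have "(LBINT x:{0<..}. of_real x powr (s - 1) * of_real (exp (- x))) = Gamma s"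
  proof -
    have "((\<lambda>x. of_real x powr (s - 1) * complex_of_real (exp (- x))) has_integral Gamma s) {0<..}"
      using Gamma_integral_complex'[OF s] by (simp add: exp_minus field_simps)
    thus ?thesis
      using set_borel_integral_eq_integral(2)[OF I[of 1]] by (simp add: integral_unique)
  qed
  also have "(LBINT x:{0<..}. of_real x powr (s - 1) * of_real (exp (- x))) =
      b *\<^sub>R (LBINT x:{0<..}. of_real (b * x) powr (s - 1) * of_real (exp (- b * x)))"
    unfolding set_lebesgue_integral_def
    by (subst lborel_integral_real_affine[where c = b and t = 0])
       (use b in \<open>auto simp: indicator_def zero_less_mult_iff intro!: Bochner_Integration.integral_cong\<close>)
  also have "\<dots> = b *\<^sub>R (LBINT x:{0<..}. of_real b powr (s - 1) * (of_real x powr (s - 1) * of_real (exp (- b * x))))"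
    using b by (intro arg_cong[of _ _ "\<lambda>x. b *\<^sub>R x"] set_lebesgue_integral_cong)
      (auto simp: powr_times_real mult.assoc)
  also have "\<dots> = of_real b powr s * (LBINT x:{0<..}. of_real x powr (s - 1) * of_real (exp (- b * x)))"
    using b by (subst set_integral_mult_right) (auto simp: powr_diff scaleR_conv_of_real)
  finally show "(LBINT x:{0<..}. of_real x powr (s - 1) * of_real (exp (- b * x))) = Gamma s * of_real b powr (- s)"
    using b by (auto simp: powr_minus field_simps)
qed

text \<open>Each exponential contributes \<open>\<Gamma>(s) b\<^sup>-\<^sup>s\<close>. Interchanging sum and integral is legitimate because the
absolute values integrate to \<open>\<Gamma>(Re s) |c| b\<^bsup>-Re s\<^esup>\<close>, whose sum is finite by assumption.\<close>

lemma mellin_exp_series: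
  fixes c :: "nat \<Rightarrow> complex" and b :: "nat \<Rightarrow> real"
  assumes b: "\<And>j. 0 < b j" and s: "0 < Re s"
    and summ: "summable (\<lambda>j. norm (c j) * b j powr (- Re s))"
    and f: "\<And>x. 0 < x \<Longrightarrow> (\<lambda>j. c j * of_real (exp (- b j * x))) sums f x"
  shows "(\<lambda>j. c j * of_real (b j) powr (- s)) sums (rGamma s * mellin f s)"
proof -
  define u where "u j x = indicator {0<..} x *\<^sub>R (c j * (of_real x powr (s - 1) * of_real (exp (- b j * x))))"
    for j and x :: real
  have int: "integrable lborel (u j)" for j
    using set_integrable_mult_right[of "c j", OF mellin_exp(1)[OF b[of j] s]]
    unfolding set_integrable_def u_def .
  have "integral\<^sup>L lborel (u j) = (LBINT x:{0<..}. c j * (of_real x powr (s - 1) * of_real (exp (- b j * x))))" for j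
    unfolding u_def set_lebesgue_integral_def ..
  hence intu: "integral\<^sup>L lborel (u j) = c j * (Gamma s * of_real (b j) powr (- s))" for j
    using mellin_exp(2)[OF b[of j] s] by simp
  have intn: "(\<integral>x. norm (u j x) \<partial>lborel) = norm (c j) * (Gamma (Re s) * b j powr (- Re s))" for j
  proof -
    have "of_real (\<integral>x. norm (u j x) \<partial>lborel) = (\<integral>x. complex_of_real (norm (u j x)) \<partial>lborel)"
      by simp
    also have "\<dots> = (LBINT x:{0<..}. of_real (norm (c j)) * (of_real x powr (of_real (Re s) - 1) * of_real (exp (- b j * x))))"
      unfolding set_lebesgue_integral_def
      by (intro Bochner_Integration.integral_cong)
         (auto simp: u_def norm_mult norm_powr_real_powr indicator_def powr_Reals_eq)
    also have "\<dots> = of_real (norm (c j)) * (Gamma (of_real (Re s)) * of_real (b j) powr (- of_real (Re s)))"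
      using mellin_exp(2)[OF b[of j], of "of_real (Re s)"] s by simp
    also have "\<dots> = of_real (norm (c j) * (Gamma (Re s) * b j powr (- Re s)))"
      using b[of j] by (simp add: Gamma_complex_of_real powr_Reals_eq)
    finally show ?thesis by (simp only: of_real_eq_iff)
  qed
  have "AE x in lborel. summable (\<lambda>j. norm (u j x))"
  proof (rule AE_I2)
    fix x :: real
    show "summable (\<lambda>j. norm (u j x))"
    proof (cases "0 < x")
      case True
      define K where "K = x powr (Re s - 1) * fact (nat \<lceil>Re s\<rceil>) * x powr (- Re s)"
      show ?thesis
      proof (rule summable_comparison_test'[OF summable_mult[OF summ, of K]])
        fix j :: nat
        have "(b j * x) powr Re s \<le> fact (nat \<lceil>Re s\<rceil>) * exp (b j * x)"
          using b[of j] True s by (intro powr_le_fact_exp) auto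
        hence "exp (- b j * x) \<le> fact (nat \<lceil>Re s\<rceil>) * x powr (- Re s) * b j powr (- Re s)"
          using b[of j] True by (simp add: powr_mult powr_minus exp_minus field_simps)
        hence "norm (c j) * x powr (Re s - 1) * exp (- b j * x) \<le>
            norm (c j) * x powr (Re s - 1) * (fact (nat \<lceil>Re s\<rceil>) * x powr (- Re s) * b j powr (- Re s))"
          by (intro mult_left_mono) auto
        thus "norm (norm (u j x)) \<le> K * (norm (c j) * b j powr (- Re s))"
          using True by (simp add: u_def K_def norm_mult norm_powr_real_powr mult_ac)
      qed
    qed (auto simp: u_def)
  qed
  moreover have "summable (\<lambda>j. \<integral>x. norm (u j x) \<partial>lborel)"
    using summable_mult[OF summ, of "Gamma (Re s)"] by (simp add: intn mult_ac)
  ultimately have "(\<lambda>j. integral\<^sup>L lborel (u j)) sums (\<integral>x. (\<Sum>j. u j x) \<partial>lborel)"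
    by (intro sums_integral int)
  also have "(\<lambda>x. \<Sum>j. u j x) = (\<lambda>x. indicator {0<..} x *\<^sub>R (of_real x powr (s - 1) * f x))"
  proof
    fix x :: real
    show "(\<Sum>j. u j x) = indicator {0<..} x *\<^sub>R (of_real x powr (s - 1) * f x)"
    proof (cases "0 < x")
      case True
      have "(\<lambda>j. u j x) sums (of_real x powr (s - 1) * f x)"
        using sums_mult[OF f[OF True], of "of_real x powr (s - 1)"] True by (simp add: u_def mult_ac)
      thus ?thesis using True by (simp add: sums_iff)
    qed (auto simp: u_def)
  qed
  finally have "(\<lambda>j. c j * (Gamma s * of_real (b j) powr (- s))) sums mellin f s"
    by (simp add: intu mellin_def set_lebesgue_integral_def)
  from sums_mult[OF this, of "rGamma s"] show ?thesis
  proof (rule back_subst[of "\<lambda>u. u sums _"])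
    have "s \<notin> \<int>\<^sub>\<le>\<^sub>0" using s by (auto elim!: nonpos_Ints_cases)
    hence "rGamma s * Gamma s = 1" by (simp add: rGamma_inverse_Gamma Gamma_eq_zero_iff)
    thus "(\<lambda>j. rGamma s * (c j * (Gamma s * of_real (b j) powr - s))) = (\<lambda>j. c j * of_real (b j) powr - s)"
      by (auto simp: algebra_simps)
  qed
qed

section \<open>Entire continuation of Mellin transforms and the Hurwitz zeta function\<close>

text \<open>Let \<open>M\<close> denote the Mellin transform. As \<open>1/\<Gamma>(s) = s/\<Gamma>(s+1)\<close>, integration by parts reads
\<open>M[g](s)/\<Gamma>(s) = - M[g'](s+1)/\<Gamma>(s+1)\<close>. Iterating \<open>N\<close> times continues the left-hand side to
\<open>Re s > -N\<close>, provided that all derivatives of \<open>g\<close> decay exponentially along the half line. Cauchy's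
inequality supplies this decay from a bound for \<open>g\<close> itself on a strip around the half line.\<close>

lemma mellin_entire_continuation:
  fixes g :: "complex \<Rightarrow> complex"
  assumes hol: "g holomorphic_on {z. -1 < Re z \<and> \<bar>Im z\<bar> < 1}" and "0 < c"
    and bound: "\<And>z. -1 < Re z \<Longrightarrow> \<bar>Im z\<bar> < 1 \<Longrightarrow> norm (g z) \<le> C * exp (- c * Re z)"
  obtains E where "E holomorphic_on UNIV"
    and "\<And>s. 0 < Re s \<Longrightarrow> E s = rGamma s * mellin (\<lambda>x. g (of_real x)) s"
    and "E 0 = g 0"
proof -
  define U where "U = {z. -1 < Re z \<and> \<bar>Im z\<bar> < 1}"
  have openU: "open U"
  proof -
    have "U = {z. -1 < Re z} \<inter> {z. -1 < Im z} \<inter> {z. Im z < 1}" by (auto simp: U_def)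
    thus ?thesis by (auto intro!: open_Int open_halfspace_Re_gt open_halfspace_Im_gt open_halfspace_Im_lt)
  qed
  have realU: "of_real x \<in> U" if "0 \<le> x" for x using that by (simp add: U_def)
  define G where "G N x = (deriv ^^ N) g (of_real x)" for N and x :: real
  have holG: "(deriv ^^ N) g holomorphic_on U" for N
    using holomorphic_higher_deriv[OF hol[folded U_def] openU] .
  have derG: "(G N has_vector_derivative G (Suc N) x) (at x)" if "0 \<le> x" for N x
  proof -
    have "((deriv ^^ N) g has_field_derivative deriv ((deriv ^^ N) g) (of_real x)) (at (of_real x))"
      by (rule holomorphic_derivI[OF holG openU realU[OF that]])
    from has_vector_derivative_real_field[OF this] show ?thesis by (simp add: G_def[abs_def])
  qed
  have contG: "continuous_on {0<..} (G N)" for N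
    using derG by (intro continuous_at_imp_continuous_on ballI)
      (auto dest!: less_imp_le intro: has_vector_derivative_continuous)
  have boundG: "norm (G N x) \<le> (fact N * C * exp (c / 2) * 2 ^ N) * exp (- c * x)" if "0 < x" for N x
  proof -
    have sub: "cball (of_real x) (1/2) \<subseteq> U"
    proof
      fix z assume "z \<in> cball (complex_of_real x) (1/2)"
      hence "norm (z - of_real x) \<le> 1/2" by (simp add: dist_norm norm_minus_commute)
      with abs_Re_le_cmod[of "z - of_real x"] abs_Im_le_cmod[of "z - of_real x"] that
      show "z \<in> U" by (simp add: U_def)
    qed
    have "norm ((deriv ^^ N) g (of_real x)) \<le> fact N * (C * exp (- c * (x - 1 / 2))) / (1/2) ^ N"
    proof (rule Cauchy_inequality)
      show "g holomorphic_on ball (of_real x) (1/2)"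
        using hol[folded U_def] sub ball_subset_cball by (blast intro: holomorphic_on_subset)
      show "continuous_on (cball (of_real x) (1/2)) g"
        using holomorphic_on_imp_continuous_on[OF hol] sub by (auto simp: U_def intro: continuous_on_subset)
      fix z :: complex assume z: "norm (of_real x - z) = 1/2"
      hence zU: "z \<in> U" using sub by (auto simp: dist_norm)
      have "0 \<le> C * exp (- c * 0)" using order.trans[OF norm_ge_zero bound[of 0]] by simp
      hence C: "0 \<le> C" by simp
      have "norm (g z) \<le> C * exp (- c * Re z)" using bound zU by (auto simp: U_def)
      also have "\<bar>x - Re z\<bar> \<le> 1 / 2" using abs_Re_le_cmod[of "of_real x - z"] z by simp
      hence "x - 1 / 2 \<le> Re z" by linarith
      hence "C * exp (- c * Re z) \<le> C * exp (- c * (x - 1 / 2))"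
        using C \<open>0 < c\<close> by (intro mult_left_mono) auto
      finally show "norm (g z) \<le> C * exp (- c * (x - 1 / 2))" .
    qed auto
    also have "\<dots> = (fact N * C * exp (c / 2) * 2 ^ N) * exp (- c * x)"
    proof -
      have "exp (- c * (x - 1 / 2)) = exp (c / 2) * exp (- c * x)"
        by (simp flip: exp_add add: algebra_simps)
      thus ?thesis by (simp add: power_one_over mult_ac)
    qed
    finally show ?thesis by (simp add: G_def)
  qed
  have classG: "mellin_class 0 \<beta> (G N)" if "0 \<le> \<beta>" for N \<beta>
    by (rule mellin_class_exp_decay[OF contG \<open>0 < c\<close> that boundG])
  have holM: "mellin (G N) holomorphic_on {s. 0 < Re s}" for N
    by (rule mellin_holomorphic_halfplane[OF classG])
  have parts: "mellin (G (Suc N)) (s + 1) = - s * mellin (G N) s" if "0 < Re s" for N s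
    by (rule mellin_by_parts[of 0 "Re s + 1" "G N" "G (Suc N)"])
       (use that in \<open>auto intro!: classG derG mellin_class_mono[OF classG[of "Re s + 1 + 1"]]\<close>)
  define R where "R N s = (-1) ^ N * (rGamma (s + of_nat N) * mellin (G N) (s + of_nat N))" for N s
  have R_Suc: "R (Suc N) s = R N s" if "- real N < Re s" for N s
  proof -
    have "mellin (G (Suc N)) (s + of_nat N + 1) = - (s + of_nat N) * mellin (G N) (s + of_nat N)"
      using that by (intro parts) auto
    moreover have "s + of_nat (Suc N) = s + of_nat N + 1" by simp
    ultimately have "R (Suc N) s = (-1) ^ N * ((s + of_nat N) * rGamma (s + of_nat N + 1) * mellin (G N) (s + of_nat N))"
      unfolding R_def by (simp only: power_Suc mult_minus1 mult_minus_left mult_minus_right minus_minus mult_1_left mult_ac)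
    thus ?thesis by (simp only: rGamma_plus1 R_def)
  qed
  have R_eq: "R M s = R N s" if "- real N < Re s" "N \<le> M" for M N s
    using that(2)
  proof (induction M rule: dec_induct)
    case (step M)
    thus ?case using R_Suc[of M s] that(1) by simp
  qed simp
  \<comment> \<open>The continuations to the half planes agree where they overlap, so any admissible number of
    steps defines the same value.\<close>
  define idx where "idx s = nat \<lceil>- Re s\<rceil> + 1" for s
  define E where "E s = R (idx s) s" for s
  have idx: "- real (idx s) < Re s" for s unfolding idx_def by linarith
  have E_eq: "E s = R N s" if "- real N < Re s" for N s
    using R_eq[of N s "max N (idx s)"] R_eq[of "idx s" s "max N (idx s)"] that idx[of s]
    by (simp add: E_def)
  have holR: "R N holomorphic_on {s. - real N < Re s}" for N
  proof -
    have "(mellin (G N) \<circ> (\<lambda>s. s + of_nat N)) holomorphic_on {s. - real N < Re s}"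
      by (rule holomorphic_on_compose_gen[OF _ holM]) (auto intro!: holomorphic_intros)
    thus ?thesis unfolding R_def o_def by (auto intro!: holomorphic_intros)
  qed
  have "E holomorphic_on (\<Union>N. {s. - real N < Re s})"
  proof (rule holomorphic_on_UN_open)
    show "E holomorphic_on {s. - real N < Re s}" for N
      using holR[of N] by (rule holomorphic_transform) (simp add: E_eq)
  qed (auto intro: open_halfspace_Re_gt)
  also have "(\<Union>N. {s. - real N < Re s}) = UNIV" using idx by blast
  finally have E1: "E holomorphic_on UNIV" .
  have E2: "E s = rGamma s * mellin (\<lambda>x. g (of_real x)) s" if "0 < Re s" for s
    using E_eq[of 0 s] that by (simp add: R_def G_def[abs_def])
  have E3: "E 0 = g 0"
  proof -
    have "mellin (G 1) 1 = (LBINT x:{0<..}. G 1 x)"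
      unfolding mellin_def by (intro set_lebesgue_integral_cong) auto
    also have "\<dots> = 0 - g 0"
    proof (rule LBINT_FTC_half_line)
      show "(G 0 has_vector_derivative G 1 x) (at x)" if "0 < x" for x
        using derG[of x 0] that by simp
      show "continuous_on {0<..} (G 1)" by (rule contG)
      have "set_integrable lborel {0<..} (\<lambda>x. of_real x powr (1 - 1) * G 1 x)"
        by (rule mellin_integrable[OF classG[of 2]]) auto
      thus "set_integrable lborel {0<..} (G 1)"
        unfolding set_integrable_def
        by (rule Bochner_Integration.integrable_cong[THEN iffD1, rotated -1]) (auto simp: indicator_def)
      have "isCont (G 0) 0" using derG[of 0 0] has_vector_derivative_continuous by blast
      hence "(G 0 \<longlongrightarrow> G 0 0) (at 0)" by (simp add: isCont_def)
      thus "(G 0 \<longlongrightarrow> g 0) (at_right 0)" by (simp add: G_def filterlim_at_split)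
      show "(G 0 \<longlongrightarrow> 0) at_top"
      proof (rule Lim_null_comparison)
        show "\<forall>\<^sub>F x in at_top. norm (G 0 x) \<le> C * exp (c / 2) * exp (- c * x)"
          using eventually_gt_at_top[of 0] by eventually_elim (use boundG[of _ 0] in auto)
        have "filterlim (\<lambda>x. - c * x) at_bot at_top"
          using \<open>0 < c\<close> filterlim_tendsto_neg_mult_at_bot[OF tendsto_const[of "-c"] _ filterlim_ident] by simp
        hence "((\<lambda>x. exp (- c * x)) \<longlongrightarrow> 0) at_top"
          by (rule filterlim_compose[OF exp_at_bot])
        from tendsto_mult_left[OF this, of "C * exp (c / 2)"]
        show "((\<lambda>x. C * exp (c / 2) * exp (- c * x)) \<longlongrightarrow> 0) at_top" by simp
      qed
    qed
    finally show ?thesis using E_eq[of 1 0] by (simp add: R_def)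
  qed
  show ?thesis by (rule that[OF E1 E2 E3])
qed

text \<open>The entire function \<open>(1 - e\<^sup>-\<^sup>z) / z\<close> with its removable singularity filled in; its reciprocal is the
regular factor \<open>z / (1 - e\<^sup>-\<^sup>z)\<close> of the kernel in the integral for the Hurwitz zeta function.\<close>

definition unit_quotient :: "complex \<Rightarrow> complex" where
  "unit_quotient z = (if z = 0 then 1 else (1 - exp (- z)) / z)"

lemma unit_quotient_holomorphic: "unit_quotient holomorphic_on UNIV"
proof -
  have "(\<lambda>z. if z = 0 then deriv (\<lambda>z. - exp (- z)) 0 else (- exp (- z) - (- exp (- 0))) / (z - 0)) holomorphic_on UNIV"
    by (rule pole_lemma) (auto intro!: holomorphic_intros)
  moreover have "deriv (\<lambda>z::complex. - exp (- z)) 0 = 1"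
    by (rule DERIV_imp_deriv) (auto intro!: derivative_eq_intros)
  ultimately show ?thesis
    by (simp add: unit_quotient_def[abs_def] cong: if_cong)
qed

text \<open>The zeros are the nonzero multiples of \<open>2\<pi>i\<close>, all far outside the strip.\<close>

lemma unit_quotient_nonzero:
  assumes "\<bar>Im z\<bar> \<le> 1"
  shows "unit_quotient z \<noteq> 0"
proof
  assume *: "unit_quotient z = 0"
  hence z: "z \<noteq> 0" "exp (- z) = 1" by (auto simp: unit_quotient_def split: if_splits)
  then obtain n :: int where n: "Re z = 0" "Im (- z) = of_int (2 * n) * pi"
    unfolding exp_eq_1 by auto
  have "n = 0"
  proof (rule ccontr)
    assume "n \<noteq> 0"
    hence "\<bar>of_int n :: real\<bar> \<ge> 1" by linarith
    hence "1 * pi \<le> \<bar>of_int n\<bar> * pi" by (intro mult_right_mono) auto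
    moreover have "Im z = - (2 * of_int n * pi)" using n(2) by simp
    ultimately have "\<bar>Im z\<bar> \<ge> 2 * pi" by (simp add: abs_mult)
    thus False using assms pi_gt3 by linarith
  qed
  with n have "z = 0" by (simp add: complex_eq_iff)
  with z show False by simp
qed

text \<open>The factor \<open>z / (1 - e\<^sup>-\<^sup>z)\<close> is bounded on a compact rectangle around 0 and grows linearly to the right
of it. Giving up half of the decay rate \<open>a\<close> absorbs this growth.\<close>

lemma hurwitz_kernel_bound:
  assumes "0 < a"
  obtains C where "\<And>z. -1 < Re z \<Longrightarrow> \<bar>Im z\<bar> < 1 \<Longrightarrow>
      norm (exp (- of_real a * z) / unit_quotient z) \<le> C * exp (- (a / 2) * Re z)"
proof -
  define K where "K = cbox (Complex (-1) (-1)) (Complex 1 1)"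
  have K: "z \<in> K \<longleftrightarrow> \<bar>Re z\<bar> \<le> 1 \<and> \<bar>Im z\<bar> \<le> 1" for z
    by (auto simp: K_def in_cbox_complex_iff)
  have "continuous_on K (\<lambda>z. 1 / unit_quotient z)"
    using holomorphic_on_imp_continuous_on[OF unit_quotient_holomorphic] unit_quotient_nonzero K
    by (intro continuous_intros) (auto intro: continuous_on_subset)
  hence "bounded ((\<lambda>z. 1 / unit_quotient z) ` K)"
    by (intro compact_imp_bounded compact_continuous_image) (auto simp: K_def)
  then obtain B1 where B1: "\<And>z. z \<in> K \<Longrightarrow> norm (1 / unit_quotient z) \<le> B1"
    unfolding bounded_iff by blast
  define B where "B = max B1 (1 / (1 - exp (-1)))"
  have "0 < B" unfolding B_def by (simp add: less_max_iff_disj)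
  have q: "norm (1 / unit_quotient z) \<le> B * (Re z + 2)" if z: "-1 < Re z" "\<bar>Im z\<bar> < 1" for z
  proof (cases "Re z \<le> 1")
    case True
    have "norm (1 / unit_quotient z) \<le> B1 * 1" using B1[of z] z True K by auto
    also have "\<dots> \<le> B * 1" by (simp add: B_def)
    also have "\<dots> \<le> B * (Re z + 2)" using z \<open>0 < B\<close> by (intro mult_left_mono) auto
    finally show ?thesis .
  next
    case False
    have "norm z \<le> \<bar>Re z\<bar> + \<bar>Im z\<bar>" by (rule cmod_le)
    hence 1: "norm z \<le> Re z + 2" using z False by simp
    have 2: "1 - exp (-1) \<le> norm (1 - exp (- z))"
    proof -
      have "norm (1::complex) - norm (exp (- z)) \<le> norm (1 - exp (- z))" by (rule norm_triangle_ineq2)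
      moreover have "norm (exp (- z)) \<le> exp (-1)" using False by (simp add: norm_exp_eq_Re)
      ultimately show ?thesis unfolding norm_one by linarith
    qed
    have "z \<noteq> 0" using False by auto
    hence "norm (1 / unit_quotient z) = norm z / norm (1 - exp (- z))"
      by (simp add: unit_quotient_def norm_divide)
    also have "\<dots> \<le> (Re z + 2) / (1 - exp (-1))"
      using 1 2 False by (intro frac_le) auto
    also have "\<dots> = 1 / (1 - exp (-1)) * (Re z + 2)" by simp
    also have "\<dots> \<le> B * (Re z + 2)" using False by (intro mult_right_mono) (auto simp: B_def)
    finally show ?thesis .
  qed
  show ?thesis
  proof (rule that[of "B * (2 / a) * exp a"])
    fix z :: complex assume z: "-1 < Re z" "\<bar>Im z\<bar> < 1"
    have "norm (exp (- of_real a * z) / unit_quotient z) = exp (- a * Re z) * norm (1 / unit_quotient z)"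
      by (simp add: norm_divide norm_exp_eq_Re)
    also have "\<dots> \<le> exp (- a * Re z) * (B * (Re z + 2))"
      by (intro mult_left_mono q z) auto
    also have "\<dots> \<le> exp (- a * Re z) * (B * (2 / a * exp (a / 2 * (Re z + 2))))"
    proof -
      have "a / 2 * (Re z + 2) \<le> exp (a / 2 * (Re z + 2))" using exp_ge_add_one_self[of "a / 2 * (Re z + 2)"] by linarith
      hence "Re z + 2 \<le> 2 / a * exp (a / 2 * (Re z + 2))" using assms by (simp add: field_simps)
      thus ?thesis using \<open>0 < B\<close> by (intro mult_left_mono) auto
    qed
    also have "\<dots> = B * (2 / a) * exp a * exp (- (a / 2) * Re z)"
    proof -
      have "exp (- a * Re z) * exp (a / 2 * (Re z + 2)) = exp a * exp (- (a / 2) * Re z)"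
        by (simp flip: exp_add add: algebra_simps)
      thus ?thesis by (simp add: mult_ac)
    qed
    finally show "norm (exp (- of_real a * z) / unit_quotient z) \<le> B * (2 / a) * exp a * exp (- (a / 2) * Re z)" .
  qed
qed

lemma summable_shifted_powr:
  assumes "0 < a" "1 < p"
  shows "summable (\<lambda>j. (real j + a) powr (- p))"
proof (rule summable_comparison_test_ev)
  show "summable (\<lambda>j. real j powr (- p))" using assms by (simp add: summable_real_powr_iff)
  show "\<forall>\<^sub>F j in sequentially. norm ((real j + a) powr (- p)) \<le> real j powr (- p)"
    using eventually_gt_at_top[of 0]
    by eventually_elim (use assms in \<open>auto intro!: powr_mono2'\<close>)
qed

text \<open>For \<open>Re s > 1\<close> the geometric series gives \<open>\<Gamma>(s) \<zeta>(s,a) = M[e\<^bsup>-ax\<^esup>/(1 - e\<^sup>-\<^sup>x)](s)\<close>. Multiplying the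
function by \<open>x\<close> makes it regular at 0 and shifts the argument, so that
\<open>(s-1) \<zeta>(s,a) = M[x e\<^bsup>-ax\<^esup>/(1 - e\<^sup>-\<^sup>x)](s-1) / \<Gamma>(s-1)\<close>, and the right-hand side continues to an entire
function \<open>E(s-1)\<close>. The value \<open>E(0) = 1\<close>, the residue of the zeta function, does not depend on \<open>a\<close>;
this is what makes differences of two Hurwitz zeta functions entire.\<close>

lemma hurwitz_continuation_exists:
  assumes a: "0 < a"
  obtains E where "E holomorphic_on UNIV" "E 0 = 1"
    "is_hurwitz_continuation (of_real a) (\<lambda>s. if s = 1 then 0 else E (s - 1) / (s - 1))"
proof -
  define g where "g z = exp (- of_real a * z) / unit_quotient z" for z
  obtain C where C: "\<And>z. -1 < Re z \<Longrightarrow> \<bar>Im z\<bar> < 1 \<Longrightarrow> norm (g z) \<le> C * exp (- (a / 2) * Re z)"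
    using hurwitz_kernel_bound[OF a] unfolding g_def by metis
  have hol: "g holomorphic_on {z. -1 < Re z \<and> \<bar>Im z\<bar> < 1}"
    unfolding g_def using unit_quotient_nonzero
    by (intro holomorphic_intros holomorphic_on_subset[OF unit_quotient_holomorphic]) auto
  obtain E where E: "E holomorphic_on UNIV" "E 0 = g 0"
    and E_eq: "\<And>s. 0 < Re s \<Longrightarrow> E s = rGamma s * mellin (\<lambda>x. g (of_real x)) s"
    using mellin_entire_continuation[OF hol _ C] a by (metis half_gt_zero)
  define f where "f x = complex_of_real (exp (- a * x) / (1 - exp (- x)))" for x :: real
  have "is_hurwitz_continuation (of_real a) (\<lambda>s. if s = 1 then 0 else E (s - 1) / (s - 1))"
    unfolding is_hurwitz_continuation_def
  proof (intro conjI allI impI)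
    have "(\<lambda>s. E (s - 1) / (s - 1)) holomorphic_on - {1}"
      by (intro holomorphic_intros holomorphic_on_compose_gen[OF _ E(1), unfolded o_def]) auto
    thus "(\<lambda>s. if s = 1 then 0 else E (s - 1) / (s - 1)) holomorphic_on - {1}"
      by (rule holomorphic_transform) auto
  next
    fix s :: complex assume s: "1 < Re s"
    have "(\<lambda>j. 1 * of_real (real j + a) powr (- s)) sums (rGamma s * mellin f s)"
    proof (rule mellin_exp_series)
      show "summable (\<lambda>j. norm (1::complex) * (real j + a) powr (- Re s))"
        using summable_shifted_powr[OF a s] by simp
      fix x :: real assume x: "0 < x"
      have "(\<lambda>j. exp (- a * x) * exp (- x) ^ j) sums (exp (- a * x) * (1 / (1 - exp (- x))))"
        by (intro sums_mult geometric_sums) (use x in auto)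
      also have "(\<lambda>j. exp (- a * x) * exp (- x) ^ j) = (\<lambda>j. exp (- (real j + a) * x))"
        by (simp flip: exp_add exp_of_nat_mult add: algebra_simps)
      finally show "(\<lambda>j. 1 * complex_of_real (exp (- (real j + a) * x))) sums f x"
        unfolding f_def by (simp only: mult_1 sums_of_real_iff) simp
    qed (use a s in auto)
    also have "rGamma s * mellin f s = E (s - 1) / (s - 1)"
    proof -
      have "mellin (\<lambda>x. g (of_real x)) (s - 1) = mellin f s"
        unfolding mellin_def
      proof (intro set_lebesgue_integral_cong allI impI)
        fix x :: real assume x: "x \<in> {0<..}"
        have "g (of_real x) = of_real x * f x"
          using x by (simp add: g_def f_def unit_quotient_def flip: exp_of_real)
        moreover have "of_real x powr (s - 1 - 1) = of_real x powr (s - 1) / of_real x"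
          using x by (simp add: powr_diff power2_eq_square)
        ultimately show "of_real x powr (s - 1 - 1) * g (of_real x) = of_real x powr (s - 1) * f x"
          using x by (simp add: power2_eq_square)
      qed auto
      hence "E (s - 1) = rGamma (s - 1) * mellin f s" using E_eq[of "s - 1"] s by simp
      moreover have "rGamma (s - 1) = (s - 1) * rGamma s" using rGamma_plus1[of "s - 1"] by simp
      ultimately show ?thesis using s by auto
    qed
    finally show "(\<lambda>n. (of_nat n + of_real a) powr (- s)) sums (if s = 1 then 0 else E (s - 1) / (s - 1))"
      using s by auto
  qed auto
  moreover have "E 0 = 1" using E(2) by (simp add: g_def unit_quotient_def)
  ultimately show ?thesis using that E(1) by blast
qed

lemma hurwitz_zeta_continuation:
  assumes "0 < a"
  shows "is_hurwitz_continuation (of_real a) (\<lambda>s. hurwitz_zeta s (of_real a))"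
proof -
  obtain f where f: "is_hurwitz_continuation (of_real a) f"
    using hurwitz_continuation_exists[OF assms] by metis
  hence "(THE f. is_hurwitz_continuation (of_real a) f) = f"
    using is_hurwitz_continuation_unique by blast
  with f show ?thesis by (simp add: hurwitz_zeta_def)
qed

text \<open>The entire extension of \<open>\<zeta>(s,a) - \<zeta>(s,b)\<close>. It is determined by its values away from 1, and
working with it avoids all case distinctions at the pole.\<close>

definition hurwitz_diff :: "real \<Rightarrow> real \<Rightarrow> complex \<Rightarrow> complex" where
  "hurwitz_diff a b = (SOME D. D holomorphic_on UNIV \<and>
     (\<forall>s. s \<noteq> 1 \<longrightarrow> D s = hurwitz_zeta s (of_real a) - hurwitz_zeta s (of_real b)))"

lemma
  assumes "0 < a" "0 < b"
  shows hurwitz_diff_holomorphic: "hurwitz_diff a b holomorphic_on UNIV"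
    and hurwitz_diff_eq: "s \<noteq> 1 \<Longrightarrow> hurwitz_diff a b s = hurwitz_zeta s (of_real a) - hurwitz_zeta s (of_real b)"
proof -
  obtain E where E: "E holomorphic_on UNIV" "E 0 = 1"
    "is_hurwitz_continuation (of_real a) (\<lambda>s. if s = 1 then 0 else E (s - 1) / (s - 1))"
    using hurwitz_continuation_exists[OF assms(1)] by metis
  obtain F where F: "F holomorphic_on UNIV" "F 0 = 1"
    "is_hurwitz_continuation (of_real b) (\<lambda>s. if s = 1 then 0 else F (s - 1) / (s - 1))"
    using hurwitz_continuation_exists[OF assms(2)] by metis
  have zE: "(\<lambda>s. hurwitz_zeta s (of_real a)) = (\<lambda>s. if s = 1 then 0 else E (s - 1) / (s - 1))"
    by (rule is_hurwitz_continuation_unique[OF hurwitz_zeta_continuation[OF assms(1)] E(3)])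
  have zF: "(\<lambda>s. hurwitz_zeta s (of_real b)) = (\<lambda>s. if s = 1 then 0 else F (s - 1) / (s - 1))"
    by (rule is_hurwitz_continuation_unique[OF hurwitz_zeta_continuation[OF assms(2)] F(3)])
  define h where "h s = E (s - 1) - F (s - 1)" for s
  have h: "h holomorphic_on UNIV"
    unfolding h_def
    by (intro holomorphic_intros holomorphic_on_compose_gen[OF _ E(1), unfolded o_def]
        holomorphic_on_compose_gen[OF _ F(1), unfolded o_def]) auto
  define D where "D s = (if s = 1 then deriv h 1 else (h s - h 1) / (s - 1))" for s
  have "D holomorphic_on UNIV"
    unfolding D_def using pole_lemma[OF h, of 1] by simp
  moreover have "D s = hurwitz_zeta s (of_real a) - hurwitz_zeta s (of_real b)" if "s \<noteq> 1" for s
    using fun_cong[OF zE, of s] fun_cong[OF zF, of s] that E(2) F(2)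
    by (simp add: D_def h_def diff_divide_distrib)
  ultimately have "\<exists>D. D holomorphic_on UNIV \<and>
     (\<forall>s. s \<noteq> 1 \<longrightarrow> D s = hurwitz_zeta s (of_real a) - hurwitz_zeta s (of_real b))"
    by blast
  from someI_ex[OF this, folded hurwitz_diff_def]
  show "hurwitz_diff a b holomorphic_on UNIV"
    "s \<noteq> 1 \<Longrightarrow> hurwitz_diff a b s = hurwitz_zeta s (of_real a) - hurwitz_zeta s (of_real b)"
    by blast+
qed

text \<open>The derivative of the entire extension is continuous at 1, so the limit that defines the difference
of the derivatives at the pole is just its value there.\<close>

lemma deriv_hurwitz_diff:
  assumes "0 < a" "0 < b"
  shows "deriv (hurwitz_diff a b) s = hurwitz_zeta'_diff s (of_real a) (of_real b)"
proof -
  have eq: "deriv (hurwitz_diff a b) w = hurwitz_zeta' w (of_real a) - hurwitz_zeta' w (of_real b)"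
    if w: "w \<noteq> 1" for w
  proof -
    have "(\<lambda>s. hurwitz_zeta s (of_real c)) field_differentiable (at w)" if "0 < c" for c
      using hurwitz_zeta_continuation[OF that] w
      by (auto simp: is_hurwitz_continuation_def intro!: holomorphic_on_imp_differentiable_at[of _ "- {1}"])
    note fd = this[OF assms(1)] this[OF assms(2)]
    have "\<forall>\<^sub>F v in nhds w. hurwitz_diff a b v = hurwitz_zeta v (of_real a) - hurwitz_zeta v (of_real b)"
      using t1_space_nhds[OF w] by eventually_elim (use hurwitz_diff_eq[OF assms] in auto)
    hence "deriv (hurwitz_diff a b) w = deriv (\<lambda>v. hurwitz_zeta v (of_real a) - hurwitz_zeta v (of_real b)) w"
      by (rule deriv_cong_ev) simp
    also have "\<dots> = hurwitz_zeta' w (of_real a) - hurwitz_zeta' w (of_real b)"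
      unfolding hurwitz_zeta'_def by (rule deriv_diff[OF fd])
    finally show ?thesis .
  qed
  show ?thesis
  proof (cases "s = 1")
    case True
    have "deriv (hurwitz_diff a b) holomorphic_on UNIV"
      by (intro holomorphic_deriv hurwitz_diff_holomorphic assms) auto
    hence "continuous_on UNIV (deriv (hurwitz_diff a b))" by (rule holomorphic_on_imp_continuous_on)
    hence "(deriv (hurwitz_diff a b) \<longlongrightarrow> deriv (hurwitz_diff a b) 1) (at 1)"
      by (simp add: continuous_on_eq_continuous_at isCont_def)
    moreover have "\<forall>\<^sub>F w in at 1. deriv (hurwitz_diff a b) w = hurwitz_zeta' w (of_real a) - hurwitz_zeta' w (of_real b)"
      using eq by (auto simp: eventually_at_filter)
    ultimately have "((\<lambda>w. hurwitz_zeta' w (of_real a) - hurwitz_zeta' w (of_real b)) \<longlongrightarrow> deriv (hurwitz_diff a b) 1) (at 1)"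
      by (rule Lim_transform_eventually)
    hence "Lim (at 1) (\<lambda>w. hurwitz_zeta' w (of_real a) - hurwitz_zeta' w (of_real b)) = deriv (hurwitz_diff a b) 1"
      by (intro tendsto_Lim) auto
    thus ?thesis using True by (simp add: hurwitz_zeta'_diff_def)
  qed (simp add: eq hurwitz_zeta'_diff_def)
qed

text \<open>For \<open>Re w > 1\<close> the two series differ by the first term only, and both sides are entire.\<close>

lemma hurwitz_diff_plus1:
  assumes a: "0 < a"
  shows "hurwitz_diff a (a + 1) w = of_real a powr (- w)"
proof (rule analytic_continuation_open[where s = "{w. 1 < Re w}" and s' = UNIV
      and f = "hurwitz_diff a (a + 1)" and g = "\<lambda>w. of_real a powr (- w)"])
  show "{w::complex. 1 < Re w} \<noteq> {}" by (auto intro!: exI[of _ 2])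
  show "hurwitz_diff a (a + 1) holomorphic_on UNIV"
    using a by (intro hurwitz_diff_holomorphic) auto
  show "(\<lambda>w. of_real a powr (- w)) holomorphic_on UNIV"
    using a by (intro holomorphic_intros) auto
  fix w :: complex assume "w \<in> {w. 1 < Re w}"
  hence w: "1 < Re w" by simp
  have z: "(\<lambda>n. (of_nat n + complex_of_real b) powr (- w)) sums hurwitz_zeta w (of_real b)" if "0 < b" for b
    using hurwitz_zeta_continuation[OF that] w by (simp add: is_hurwitz_continuation_def)
  have "(\<lambda>n. (of_nat (Suc n) + complex_of_real a) powr (- w)) sums hurwitz_zeta w (of_real (a + 1))"
    using z[of "a + 1"] a by (simp add: add_ac)
  hence "(\<lambda>n. (of_nat n + complex_of_real a) powr (- w)) sums
      (hurwitz_zeta w (of_real (a + 1)) + (of_nat 0 + complex_of_real a) powr (- w))"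
    by (rule sums_Suc)
  from sums_unique2[OF this z[OF a]]
  have "hurwitz_zeta w (of_real a) - hurwitz_zeta w (of_real (a + 1)) = of_real a powr (- w)"
    by (simp add: algebra_simps)
  thus "hurwitz_diff a (a + 1) w = of_real a powr (- w)"
    using a w by (subst hurwitz_diff_eq) auto
qed (auto intro: open_halfspace_Re_gt)

lemma hurwitz_zeta'_diff_plus1:
  assumes a: "0 < a"
  shows "hurwitz_zeta'_diff w (of_real a) (of_real (a + 1)) = - of_real (ln a) * of_real a powr (- w)"
proof -
  have "hurwitz_zeta'_diff w (of_real a) (of_real (a + 1)) = deriv (\<lambda>w. of_real a powr (- w)) w"
  proof -
    have "hurwitz_diff a (a + 1) = (\<lambda>w. of_real a powr (- w))"
      by (rule ext) (rule hurwitz_diff_plus1[OF a])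
    thus ?thesis using deriv_hurwitz_diff[OF a, of "a + 1" w] a by simp
  qed
  also have "\<dots> = - of_real (ln a) * of_real a powr (- w)"
  proof (rule DERIV_imp_deriv)
    have "((\<lambda>z. complex_of_real a powr z) has_field_derivative Ln (of_real a) * of_real a powr (- w)) (at (- w))"
      using a by (intro has_field_derivative_powr_right) auto
    from DERIV_chain2[OF this DERIV_minus[OF DERIV_ident]]
    show "((\<lambda>w. complex_of_real a powr (- w)) has_field_derivative - of_real (ln a) * of_real a powr (- w)) (at w)"
      using a by (simp add: Ln_of_real)
  qed
  finally show ?thesis .
qed

text \<open>Moving both parameters by one half step: \<open>\<zeta>'(w,a+1) = \<zeta>'(w,a) + a\<^sup>-\<^sup>w ln a\<close> for \<open>a = n/2\<close>, where
\<open>a\<^sup>-\<^sup>w\<close> is an ordinary natural power because \<open>w\<close> is an even nonpositive integer.\<close>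

lemma hurwitz_zeta'_diff_shift:
  assumes n: "1 \<le> n" and "k \<le> n"
  shows "hurwitz_zeta'_diff (- 2 * of_nat n + 2 * of_nat k) ((of_nat n + 1) / 2) ((of_nat n + 2) / 2) =
    - hurwitz_zeta'_diff (- 2 * of_nat n + 2 * of_nat k) (of_nat n / 2) ((of_nat n + 1) / 2)
    - of_real (ln (real n / 2)) * (of_nat n / 2) ^ (2 * (n - k))"
proof -
  define w :: complex where "w = - 2 * of_nat n + 2 * of_nat k"
  have w: "w = - of_nat (2 * (n - k))" using assms by (simp add: w_def of_nat_diff)
  have "Re w \<noteq> Re 1" unfolding w by simp
  hence w1: "w \<noteq> 1" by metis
  have "hurwitz_zeta'_diff w (of_nat n / 2) ((of_nat n + 2) / 2) =
      - of_real (ln (real n / 2)) * (of_nat n / 2) powr (- w)"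
    using hurwitz_zeta'_diff_plus1[of "real n / 2" w] n by (simp add: add_divide_distrib)
  also have "(of_nat n / 2) powr (- w) = (of_nat n / 2 :: complex) ^ (2 * (n - k))"
    unfolding w minus_minus using n by (subst powr_nat') auto
  finally have "hurwitz_zeta'_diff w (of_nat n / 2) ((of_nat n + 2) / 2) =
      - of_real (ln (real n / 2)) * (of_nat n / 2) ^ (2 * (n - k))" .
  thus ?thesis
    using w1 unfolding hurwitz_zeta'_diff_def w_def[symmetric] by (simp add: algebra_simps)
qed

section \<open>Symmetry of the generalized Stirling polynomials\<close>

lemma is_stirling_family_stirlingP: "is_stirling_family m x (\<lambda>k. stirlingP k m x)"
  unfolding stirlingP_def by (rule theI'[OF ex1_stirling_family])

lemma stirlingP_unique:
  assumes "is_stirling_family m x p"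
  shows "stirlingP k m x = p k"
  using ex1_stirling_family[of m x] is_stirling_family_stirlingP[of m x] assms by blast

lemma pochhammer_reflect:
  fixes j :: "'a::comm_ring_1"
  shows "pochhammer (- j - of_nat m) m = (-1) ^ m * pochhammer (j + 1) m"
  using pochhammer_minus[of "j + of_nat m" m] by (simp add: algebra_simps)

text \<open>At the centre \<open>x = (m+1)/2\<close> the reflection \<open>j \<mapsto> -j-m-1\<close> changes \<open>j + x\<close> into its negative and multiplies
the rising factorial \<open>(j+1)\<^sub>m\<close> by \<open>(-1)\<^sup>m\<close>. So the signed family \<open>(-1)\<^sup>k P\<^sub>k\<close> satisfies the defining
identity as well, and uniqueness forces \<open>P\<^sub>k = (-1)\<^sup>k P\<^sub>k\<close>.\<close>

lemma stirlingP_odd_eq_0: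
  assumes x: "2 * x = of_nat m + 1" and k: "odd k"
  shows "stirlingP k m x = 0"
proof -
  let ?P = "\<lambda>k. stirlingP k m x"
  have F: "is_stirling_family m x ?P" by (rule is_stirling_family_stirlingP)
  have "is_stirling_family m x (\<lambda>k. (-1) ^ k * ?P k)"
    unfolding is_stirling_family_def
  proof (intro conjI allI impI)
    show "(-1) ^ i * ?P i = 0" if "m < i" for i
      using F that by (simp add: is_stirling_family_def)
    fix j :: complex
    define i where "i = - j - of_nat m - 1"
    have y: "i + x = - (j + x)"
    proof -
      have "i + x = - j - x + (2 * x - (of_nat m + 1))" by (simp add: i_def algebra_simps)
      thus ?thesis by (simp add: x)
    qed
    have "i + 1 = - j - of_nat m" by (simp add: i_def)
    hence "pochhammer (j + 1) m = (-1) ^ m * pochhammer (i + 1) m"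
      by (simp only: pochhammer_reflect) (simp flip: mult.assoc power_mult_distrib)
    also have "pochhammer (i + 1) m = (\<Sum>k\<le>m. (-1) ^ k * ?P k * (- (j + x)) ^ (m - k))"
      using F unfolding is_stirling_family_def y[symmetric] by blast
    also have "(-1) ^ m * \<dots> = (\<Sum>k\<le>m. (-1) ^ k * ((-1) ^ k * ?P k) * (j + x) ^ (m - k))"
      unfolding sum_distrib_left
    proof (intro sum.cong refl)
      fix k assume "k \<in> {..m}"
      hence "(-1::complex) ^ m = (-1) ^ (m - k) * (-1) ^ k" by (simp flip: power_add)
      moreover have "(- (j + x)) ^ (m - k) = (-1) ^ (m - k) * (j + x) ^ (m - k)" by (rule power_minus)
      moreover have "(-1::complex) ^ (m - k) * (-1) ^ (m - k) = 1" by (simp flip: power_mult_distrib)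
      ultimately show "(-1) ^ m * ((-1) ^ k * ?P k * (- (j + x)) ^ (m - k)) =
          (-1) ^ k * ((-1) ^ k * ?P k) * (j + x) ^ (m - k)"
        by (simp add: mult_ac)
    qed
    finally show "pochhammer (j + 1) m = (\<Sum>k\<le>m. (-1) ^ k * ((-1) ^ k * ?P k) * (j + x) ^ (m - k))" .
  qed
  from stirlingP_unique[OF this, of k] k show ?thesis by simp
qed

text \<open>The rising factorial is monic in \<open>j\<close>. Multiplying a family for \<open>m\<close> by the next factor
\<open>j + m + 1 = (j + x) + (m + 1 - x)\<close> gives a family for \<open>m + 1\<close> with the same leading coefficient.\<close>

lemma stirlingP_0 [simp]: "stirlingP 0 m x = 1"
proof -
  have "\<exists>p. is_stirling_family m x p \<and> p 0 = 1"
  proof (induction m)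
    case 0
    show ?case
      by (intro exI[of _ "\<lambda>k. if k = 0 then 1 else 0"]) (auto simp: is_stirling_family_def)
  next
    case (Suc m)
    then obtain p where p: "is_stirling_family m x p" "p 0 = 1" by blast
    define c where "c = of_nat m + 1 - x"
    define q where "q k = p k - c * (case k of 0 \<Rightarrow> 0 | Suc i \<Rightarrow> p i)" for k
    have "is_stirling_family (Suc m) x q"
      unfolding is_stirling_family_def
    proof (intro conjI allI impI)
      show "q i = 0" if "Suc m < i" for i
        using p that by (cases i) (auto simp: q_def is_stirling_family_def)
      fix j :: complex
      define y where "y = j + x"
      define S where "S = (\<Sum>i\<le>m. (-1) ^ i * p i * y ^ (m - i))"
      have "pochhammer (j + 1) m = S"
        using p(1) unfolding is_stirling_family_def S_def y_def by blast
      moreover have "j + 1 + of_nat m = y + c" by (simp add: y_def c_def)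
      ultimately have "pochhammer (j + 1) (Suc m) = (y + c) * S"
        by (simp only: pochhammer_Suc mult.commute)
      moreover have "(\<Sum>i\<le>Suc m. (-1) ^ i * p i * y ^ (Suc m - i)) = y * S"
      proof -
        have "p (Suc m) = 0" using p by (simp add: is_stirling_family_def)
        hence "(\<Sum>i\<le>Suc m. (-1) ^ i * p i * y ^ (Suc m - i)) = (\<Sum>i\<le>m. (-1) ^ i * p i * y ^ (Suc m - i))" by simp
        also have "\<dots> = (\<Sum>i\<le>m. y * ((-1) ^ i * p i * y ^ (m - i)))"
          by (intro sum.cong refl) (simp add: Suc_diff_le)
        finally show ?thesis by (simp add: S_def sum_distrib_left)
      qed
      moreover have "(\<Sum>i\<le>Suc m. (-1) ^ i * (case i of 0 \<Rightarrow> 0 | Suc i \<Rightarrow> p i) * y ^ (Suc m - i)) = - S"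
        by (subst sum.atMost_Suc_shift) (simp add: S_def sum_negf)
      moreover have "(\<Sum>i\<le>Suc m. (-1) ^ i * q i * y ^ (Suc m - i)) =
          (\<Sum>i\<le>Suc m. (-1) ^ i * p i * y ^ (Suc m - i)) -
          c * (\<Sum>i\<le>Suc m. (-1) ^ i * (case i of 0 \<Rightarrow> 0 | Suc i \<Rightarrow> p i) * y ^ (Suc m - i))"
        unfolding q_def sum_distrib_left sum_subtractf[symmetric]
        by (intro sum.cong refl) (simp add: algebra_simps)
      ultimately show "pochhammer (j + 1) (Suc m) = (\<Sum>i\<le>Suc m. (-1) ^ i * q i * (j + x) ^ (Suc m - i))"
        unfolding y_def[symmetric] by (simp add: distrib_right)
    qed
    moreover have "q 0 = 1" using p by (simp add: q_def)
    ultimately show ?case by blast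
  qed
  thus ?thesis using stirlingP_unique by metis
qed

section \<open>The Mellin transform of powers of the hyperbolic secant\<close>

text \<open>Splitting the alternating series over \<open>j + 2a\<close> into even and odd \<open>j\<close> and taking out the factor 2 gives
the two Hurwitz series with parameters \<open>a\<close> and \<open>a + 1/2\<close>.\<close>

lemma hurwitz_diff_half_sums:
  assumes a: "0 < a" and w: "1 < Re w"
  shows "(\<lambda>j. (-1) ^ j * of_real (real j + 2 * a) powr (- w)) sums (2 powr (- w) * hurwitz_diff a (a + 1/2) w)"
proof -
  define u where "u j = (-1) ^ j * complex_of_real (real j + 2 * a) powr (- w)" for j :: nat
  have "norm (u j) = (real j + 2 * a) powr (- Re w)" for j
    using a norm_powr_real_powr[of "of_real (real j + 2 * a)" "- w"]
    by (simp only: u_def norm_mult norm_power norm_minus_cancel norm_one power_one mult_1_left) simp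
  moreover have "summable (\<lambda>j. (real j + 2 * a) powr (- Re w))"
    using a w by (intro summable_shifted_powr) auto
  ultimately have "summable (\<lambda>j. norm (u j))" by (simp only:)
  hence u: "u sums suminf u" by (rule summable_sums[OF summable_norm_cancel])
  have z: "(\<lambda>n. (of_nat n + complex_of_real b) powr (- w)) sums hurwitz_zeta w (of_real b)" if "0 < b" for b
    using hurwitz_zeta_continuation[OF that] w by (simp add: is_hurwitz_continuation_def)
  have "(\<lambda>n. 2 powr (- w) * ((of_nat n + complex_of_real a) powr (- w) - (of_nat n + complex_of_real (a + 1/2)) powr (- w)))
      sums (2 powr (- w) * (hurwitz_zeta w (of_real a) - hurwitz_zeta w (of_real (a + 1/2))))"
    using a by (intro sums_mult sums_diff z) auto
  also have "(\<lambda>n. 2 powr (- w) * ((of_nat n + complex_of_real a) powr (- w) - (of_nat n + complex_of_real (a + 1/2)) powr (- w)))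
      = (\<lambda>n. sum u {n * 2..<n * 2 + 2})"
  proof
    fix n :: nat
    have scale: "2 powr (- w) * complex_of_real r powr (- w) = complex_of_real (2 * r) powr (- w)" if "0 < r" for r
      using powr_times_real[of 2 "of_real r" "- w"] that by simp
    have "{n * 2..<n * 2 + 2} = {2 * n, Suc (2 * n)}" by auto
    hence "sum u {n * 2..<n * 2 + 2} = u (2 * n) + u (Suc (2 * n))" by simp
    moreover have "u (2 * n) = complex_of_real (2 * (real n + a)) powr (- w)"
      by (simp add: u_def distrib_left)
    moreover have "real (Suc (2 * n)) + 2 * a = 2 * (real n + (a + 1/2))" by simp
    hence "u (Suc (2 * n)) = - (complex_of_real (2 * (real n + (a + 1/2))) powr (- w))"
      unfolding u_def by (simp only: power_Suc power_mult) simp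
    moreover have "complex_of_real (2 * (real n + a)) powr (- w) = 2 powr (- w) * complex_of_real (real n + a) powr (- w)"
      using scale[of "real n + a"] a by simp
    moreover have "complex_of_real (2 * (real n + (a + 1/2))) powr (- w) = 2 powr (- w) * complex_of_real (real n + (a + 1/2)) powr (- w)"
      using scale[of "real n + (a + 1/2)"] a by simp
    ultimately have "sum u {n * 2..<n * 2 + 2} = 2 powr (- w) *
        (complex_of_real (real n + a) powr (- w) - complex_of_real (real n + (a + 1/2)) powr (- w))"
      by (simp only: right_diff_distrib) simp
    thus "2 powr (- w) * ((of_nat n + complex_of_real a) powr (- w) - (of_nat n + complex_of_real (a + 1/2)) powr (- w))
      = sum u {n * 2..<n * 2 + 2}" by simp
  qed
  also have "hurwitz_zeta w (of_real a) - hurwitz_zeta w (of_real (a + 1/2)) = hurwitz_diff a (a + 1/2) w"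
    using a w by (subst hurwitz_diff_eq) auto
  finally have "(\<lambda>n. sum u {n * 2..<n * 2 + 2}) sums (2 powr (- w) * hurwitz_diff a (a + 1/2) w)" .
  moreover have "(\<lambda>n. sum u {n * 2..<n * 2 + 2}) sums suminf u" by (rule sums_group[OF u]) simp
  ultimately have "2 powr (- w) * hurwitz_diff a (a + 1/2) w = suminf u" by (rule sums_unique2)
  thus ?thesis using u by (simp only: u_def[abs_def])
qed

lemma sech_eq_exp: "sech x = 2 * exp (- x) / (1 + exp (- 2 * x))"
proof -
  define e where "e = exp x"
  have e: "0 < e" "exp (- x) = 1 / e" by (auto simp: e_def exp_minus field_simps)
  have "exp (- 2 * x) = exp (- x) * exp (- x)" by (simp flip: exp_add)
  hence e2: "exp (- 2 * x) = 1 / e * (1 / e)" by (simp only: e)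
  have "0 < e + 1 / e" "0 < 1 + 1 / e * (1 / e)" using e by (auto intro!: add_pos_pos)
  hence "1 / ((e + 1 / e) / 2) = 2 * (1 / e) / (1 + 1 / e * (1 / e))"
    using e(1) by (simp add: divide_simps)
  thus ?thesis unfolding sech_def cosh_def e2 e(2) by (simp add: e_def)
qed

lemma sech_bounds: "sech x \<le> 2 * exp (- x)" "0 < sech x" "sech x \<le> 1"
proof -
  show "sech x \<le> 2 * exp (- x)"
    unfolding sech_eq_exp using add_pos_pos[OF zero_less_one exp_gt_zero[of "- 2 * x"]]
    by (subst pos_divide_le_eq) auto
  show "0 < sech x" "sech x \<le> 1"
    using cosh_real_ge_1[of x] by (auto simp: sech_def divide_le_eq)
qed

lemma continuous_on_sech [continuous_intros]:
  "continuous_on A f \<Longrightarrow> continuous_on A (\<lambda>x. sech (f x))"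
  unfolding sech_def by (intro continuous_intros) (auto simp: cosh_real_nonzero)

lemma mellin_class_sech_power:
  assumes "1 \<le> n" "0 \<le> \<beta>"
  shows "mellin_class 0 \<beta> (\<lambda>x. of_real (sech x ^ n))"
proof (rule mellin_class_exp_decay[of _ 1 _ 2])
  fix x :: real assume x: "0 < x"
  have "sech x ^ n \<le> sech x ^ 1"
    using assms sech_bounds[of x] by (intro power_decreasing) auto
  thus "norm (complex_of_real (sech x ^ n)) \<le> 2 * exp (- 1 * x)"
    using sech_bounds[of x] by (simp add: norm_power)
qed (use assms in \<open>auto intro!: continuous_intros\<close>)

text \<open>The binomial series for \<open>(1 + e\<^bsup>-2x\<^esup>)\<^bsup>-(m+1)\<^esup>\<close>, with the binomial coefficient written as a rising
factorial of fixed length \<open>m\<close> so that it becomes a polynomial in the summation index.\<close>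

lemma sech_power_sums:
  assumes x: "0 < x"
  shows "(\<lambda>j. 2 ^ Suc m * (-1) ^ j * (pochhammer (real j + 1) m / fact m) * exp (- (2 * real j + real (Suc m)) * x))
      sums sech x ^ Suc m"
proof -
  define z where "z = exp (- 2 * x)"
  have z: "\<bar>z\<bar> < 1" "0 < z" using x by (auto simp: z_def)
  have "(\<lambda>j. 2 ^ Suc m * exp (- x) ^ Suc m * ((- real (Suc m) gchoose j) * z ^ j))
      sums (2 ^ Suc m * exp (- x) ^ Suc m * (1 + z) powr (- real (Suc m)))"
    by (intro sums_mult gen_binomial_real z)
  also have "2 ^ Suc m * exp (- x) ^ Suc m * (1 + z) powr (- real (Suc m)) = sech x ^ Suc m"
  proof -
    have "(1 + z) powr (- real (Suc m)) = inverse ((1 + z) ^ Suc m)"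
      using z(2) powr_realpow[of "1 + z" "Suc m"] by (simp only: powr_minus)
    moreover have "sech x ^ Suc m = (2 * exp (- x)) ^ Suc m / (1 + z) ^ Suc m"
      by (simp only: sech_eq_exp z_def power_divide)
    ultimately show ?thesis by (simp only: power_mult_distrib divide_inverse)
  qed
  also have "(\<lambda>j. 2 ^ Suc m * exp (- x) ^ Suc m * ((- real (Suc m) gchoose j) * z ^ j)) =
     (\<lambda>j. 2 ^ Suc m * (-1) ^ j * (pochhammer (real j + 1) m / fact m) * exp (- (2 * real j + real (Suc m)) * x))"
  proof
    fix j :: nat
    have "real (Suc m) + real j - 1 = real (m + j)" by simp
    hence "(- real (Suc m) gchoose j) = (-1) ^ j * (real (m + j) gchoose j)"
      by (simp only: gbinomial_minus)
    also have "(real (m + j) gchoose j) = real (m + j choose j)" by (simp only: binomial_gbinomial)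
    also have "(m + j choose j) = (m + j choose m)" by (subst binomial_symmetric) auto
    also have "real (m + j choose m) = pochhammer (real j + 1) m / fact m"
      by (subst binomial_gbinomial) (simp add: gbinomial_pochhammer')
    finally have 1: "(- real (Suc m) gchoose j) = (-1) ^ j * (pochhammer (real j + 1) m / fact m)" .
    have 2: "exp (- x) ^ Suc m * z ^ j = exp (- (2 * real j + real (Suc m)) * x)"
      unfolding z_def exp_of_nat_mult[symmetric] exp_add[symmetric]
      by (rule arg_cong[of _ _ exp]) (simp add: algebra_simps)
    show "2 ^ Suc m * exp (- x) ^ Suc m * ((- real (Suc m) gchoose j) * z ^ j) =
       2 ^ Suc m * (-1) ^ j * (pochhammer (real j + 1) m / fact m) * exp (- (2 * real j + real (Suc m)) * x)"
      unfolding 1 2[symmetric] by (simp only: mult_ac)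
  qed
  finally show ?thesis .
qed

text \<open>The entire function that represents \<open>4\<^sup>s / \<Gamma>(s)\<close> times the Mellin transform of \<open>sech\<^sup>n\<close>, for \<open>n \<ge> 1\<close>.\<close>

definition sech_zeta :: "nat \<Rightarrow> complex \<Rightarrow> complex" where
  "sech_zeta n s = 2 ^ (2 * n - 1) / fact (n - 1) *
     (\<Sum>k\<le>n - 1. (- (1 / 2)) ^ k * stirlingP k (n - 1) (of_nat n / 2) *
        hurwitz_diff (real n / 4) (real n / 4 + 1 / 2) (s + of_nat k - of_nat n + 1))"

lemma sech_zeta_holomorphic:
  assumes "1 \<le> n"
  shows "sech_zeta n holomorphic_on UNIV"
proof -
  have D: "hurwitz_diff (real n / 4) (real n / 4 + 1 / 2) holomorphic_on UNIV"
    using assms by (intro hurwitz_diff_holomorphic) auto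
  have "(\<lambda>s. hurwitz_diff (real n / 4) (real n / 4 + 1 / 2) (s + of_nat k - of_nat n + 1)) holomorphic_on UNIV" for k
    by (rule holomorphic_on_compose_gen[OF _ D, unfolded o_def]) (auto intro!: holomorphic_intros)
  thus ?thesis
    unfolding sech_zeta_def by (intro holomorphic_on_mult holomorphic_on_sum holomorphic_on_const)
qed

lemma pochhammer_le_power:
  assumes "0 \<le> (y::real)"
  shows "pochhammer (y + 1) m \<le> (y + real m) ^ m"
proof -
  have "pochhammer (y + 1) m = (\<Prod>i<m. y + 1 + real i)"
    by (simp add: pochhammer_prod atLeast0LessThan)
  also have "\<dots> \<le> (\<Prod>i<m. y + real m)"
    using assms by (intro prod_mono) auto
  finally show ?thesis by simp
qed

text \<open>With \<open>y = j + n/2\<close> the \<open>j\<close>-th term of the Dirichlet series is, up to constants,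
\<open>(-1)\<^sup>j (j+1)\<^sub>m (2y)\<^sup>-\<^sup>s\<close>. The Stirling expansion of \<open>(j+1)\<^sub>m\<close> about \<open>-n/2\<close> turns it into a
combination of the terms \<open>(-1)\<^sup>j y\<^bsup>-(s+k-m)\<^esup>\<close>, which sum to Hurwitz differences. Absolute convergence
needs \<open>Re s - m > 1\<close>.\<close>

lemma mellin_sech_power_series:
  assumes s: "real (Suc m) < Re s"
  shows "rGamma s * mellin (\<lambda>x. of_real (sech x ^ Suc m)) s = 4 powr (- s) * sech_zeta (Suc m) s"
proof -
  define n where "n = Suc m"
  define c where "c j = complex_of_real (2 ^ n * (-1) ^ j * (pochhammer (real j + 1) m / fact m))" for j
  have "(\<lambda>j. c j * of_real (2 * real j + real n) powr (- s)) sums (rGamma s * mellin (\<lambda>x. of_real (sech x ^ n)) s)"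
  proof (rule mellin_exp_series)
    fix x :: real assume "0 < x"
    from sums_of_real[OF sech_power_sums[OF this, of m], where 'a = complex]
    show "(\<lambda>j. c j * complex_of_real (exp (- (2 * real j + real n) * x))) sums complex_of_real (sech x ^ n)"
      by (simp only: c_def n_def of_real_mult)
  next
    show "summable (\<lambda>j. norm (c j) * (2 * real j + real n) powr (- Re s))"
    proof (rule summable_comparison_test')
      show "summable (\<lambda>j. 2 ^ n / fact m * (real j + real n / 2) powr (- (Re s - real m)))"
        using s by (intro summable_mult summable_shifted_powr) (auto simp: n_def)
      fix j :: nat
      define y where "y = 2 * real j + real n"
      have y: "0 < y" "real j + real n / 2 \<le> y" "real j + real m \<le> y" "0 < real j + real n / 2"
        by (auto simp: y_def n_def intro!: add_nonneg_pos)
      have "pochhammer (real j + 1) m \<le> (real j + real m) ^ m" by (rule pochhammer_le_power) simp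
      also have "\<dots> \<le> y ^ m" using y by (intro power_mono) auto
      finally have p: "pochhammer (real j + 1) m \<le> y ^ m" .
      have p0: "0 \<le> pochhammer (real j + 1) m" by (intro pochhammer_nonneg) auto
      have "norm (c j) * y powr (- Re s) = 2 ^ n / fact m * (pochhammer (real j + 1) m * y powr (- Re s))"
        using p0 by (simp add: c_def abs_mult norm_mult norm_power norm_divide)
      also have "\<dots> \<le> 2 ^ n / fact m * (y ^ m * y powr (- Re s))"
        using p by (intro mult_left_mono mult_right_mono) auto
      also have "y ^ m * y powr (- Re s) = y powr (- (Re s - real m))"
        using y by (simp add: powr_diff powr_minus powr_realpow field_simps)
      also have "2 ^ n / fact m * y powr (- (Re s - real m)) \<le> 2 ^ n / fact m * (real j + real n / 2) powr (- (Re s - real m))"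
        using y s by (intro mult_left_mono powr_mono2') auto
      finally show "norm (norm (c j) * (2 * real j + real n) powr (- Re s))
          \<le> 2 ^ n / fact m * (real j + real n / 2) powr (- (Re s - real m))"
        by (simp add: y_def)
    qed
  qed (use s in \<open>auto simp: n_def\<close>)
  moreover have "(\<lambda>j. c j * of_real (2 * real j + real n) powr (- s)) sums (4 powr (- s) * sech_zeta n s)"
  proof -
    define b where "b k = 2 ^ n / fact m * (-1) ^ k * stirlingP k m (of_nat n / 2) * 2 powr (- s)" for k
    define w where "w k = s + of_nat k - of_nat m" for k :: nat
    have "(\<lambda>j. \<Sum>k\<le>m. b k * ((-1) ^ j * of_real (real j + 2 * (real n / 4)) powr (- w k))) sums
        (\<Sum>k\<le>m. b k * (2 powr (- w k) * hurwitz_diff (real n / 4) (real n / 4 + 1 / 2) (w k)))"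
      by (intro sums_sum sums_mult hurwitz_diff_half_sums) (use s in \<open>auto simp: n_def w_def\<close>)
    also have "(\<lambda>j. \<Sum>k\<le>m. b k * ((-1) ^ j * of_real (real j + 2 * (real n / 4)) powr (- w k))) =
        (\<lambda>j. c j * of_real (2 * real j + real n) powr (- s))"
    proof
      fix j :: nat
      define y where "y = real j + real n / 2"
      have y: "0 < y" by (auto simp: y_def n_def intro!: add_nonneg_pos)
      have "c j = 2 ^ n / fact m * (-1) ^ j * pochhammer (of_nat j + 1) m"
        by (simp add: c_def pochhammer_of_real[symmetric])
      also have "pochhammer (of_nat j + 1) m =
          (\<Sum>k\<le>m. (-1) ^ k * stirlingP k m (of_nat n / 2) * complex_of_real y ^ (m - k))"
        by (subst stirlingP_identity[of _ _ "of_nat n / 2"]) (simp add: y_def)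
      finally have cj: "c j = 2 ^ n / fact m * (-1) ^ j *
          (\<Sum>k\<le>m. (-1) ^ k * stirlingP k m (of_nat n / 2) * complex_of_real y ^ (m - k))" .
      have ys: "complex_of_real (2 * real j + real n) powr (- s) = 2 powr (- s) * of_real y powr (- s)"
        using powr_times_real[of 2 "of_real y" "- s"] y by (simp add: y_def algebra_simps)
      have yk: "of_real y ^ (m - k) * of_real y powr (- s) = of_real y powr (- w k)" if "k \<le> m" for k
      proof -
        have "of_real y powr (- w k) = of_real y powr (of_nat (m - k)) * of_real y powr (- s)"
          using that by (simp add: w_def of_nat_diff algebra_simps flip: powr_add)
        thus ?thesis using y by (simp add: powr_nat')
      qed
      have "c j * of_real (2 * real j + real n) powr (- s) =
         (\<Sum>k\<le>m. b k * ((-1) ^ j * (of_real y ^ (m - k) * of_real y powr (- s))))"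
        unfolding cj ys b_def by (simp add: sum_distrib_left sum_distrib_right mult_ac)
      also have "\<dots> = (\<Sum>k\<le>m. b k * ((-1) ^ j * of_real y powr (- w k)))"
        by (intro sum.cong refl) (simp add: yk)
      finally show "(\<Sum>k\<le>m. b k * ((-1) ^ j * of_real (real j + 2 * (real n / 4)) powr (- w k))) =
        c j * of_real (2 * real j + real n) powr (- s)"
        by (simp add: y_def)
    qed
    also have "(\<Sum>k\<le>m. b k * (2 powr (- w k) * hurwitz_diff (real n / 4) (real n / 4 + 1 / 2) (w k))) =
        4 powr (- s) * sech_zeta n s"
    proof -
      have four: "4 powr (- s) = 2 powr (- s) * 2 powr (- s)"
        using powr_times_real[of 2 2 "- s"] by simp
      have two: "2 powr (- w k) = 2 powr (- s) * (2 ^ m * (1 / 2) ^ k)" for k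
      proof -
        have "2 powr (- w k) = 2 powr (- s + of_nat m - of_nat k)" by (simp add: w_def algebra_simps)
        also have "\<dots> = 2 powr (- s) * 2 ^ m / 2 ^ k"
          by (simp only: powr_add powr_diff powr_nat') simp
        finally show ?thesis by (simp add: power_one_over)
      qed
      have neg: "(- (1 / 2)) ^ k = (-1) ^ k * (1 / 2 :: complex) ^ k" for k
        by (subst power_mult_distrib[symmetric]) simp
      have idx: "2 * n - 1 = n + m" "n - 1 = m" "s + of_nat k - of_nat n + 1 = w k" for k
        by (auto simp: n_def w_def)
      show ?thesis
        unfolding sech_zeta_def sum_distrib_left b_def two neg four idx
        by (intro sum.cong refl) (simp add: power_add)
    qed
    finally show ?thesis .
  qed
  ultimately show ?thesis unfolding n_def by (rule sums_unique2)
qed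

text \<open>Both sides are holomorphic on the right half plane and agree for large real part.\<close>

lemma mellin_sech_power:
  assumes n: "1 \<le> n" and s: "0 < Re s"
  shows "rGamma s * mellin (\<lambda>x. of_real (sech x ^ n)) s = 4 powr (- s) * sech_zeta n s"
proof (rule analytic_continuation_open[where s = "{s. real n < Re s}" and s' = "{s. 0 < Re s}"
      and f = "\<lambda>s. rGamma s * mellin (\<lambda>x. of_real (sech x ^ n)) s" and g = "\<lambda>s. 4 powr (- s) * sech_zeta n s"])
  show "{s. real n < Re s} \<noteq> {}" by (auto intro: exI[of _ "of_nat (Suc n)"])
  show "connected {s::complex. 0 < Re s}" by (intro convex_connected convex_halfspace_Re_gt)
  show "(\<lambda>s. rGamma s * mellin (\<lambda>x. of_real (sech x ^ n)) s) holomorphic_on {s. 0 < Re s}"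
    using n by (intro holomorphic_intros mellin_holomorphic_halfplane mellin_class_sech_power) auto
  show "(\<lambda>s. 4 powr (- s) * sech_zeta n s) holomorphic_on {s. 0 < Re s}"
    using n by (intro holomorphic_intros holomorphic_on_subset[OF sech_zeta_holomorphic]) auto
  show "rGamma z * mellin (\<lambda>x. of_real (sech x ^ n)) z = 4 powr (- z) * sech_zeta n z"
    if "z \<in> {s. real n < Re s}" for z
    using mellin_sech_power_series[of "n - 1" z] that n by simp
qed (use s in \<open>auto intro: open_halfspace_Re_gt\<close>)

section \<open>The moments and the three integral sequences\<close>

text \<open>These moments carry all three integral sequences; up to sign, they are the Mellin transforms of
\<open>sech\<^sup>n - 1\<close> at \<open>-1\<close>.\<close>

definition sech_moment :: "nat \<Rightarrow> real" where
  "sech_moment n = (LBINT x:{0<..}. (1 - sech x ^ n) / x\<^sup>2)"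

lemma has_derivative_sech_power:
  "((\<lambda>x. sech x ^ n) has_field_derivative - (real n * tanh x * sech x ^ n)) (at x)"
proof -
  have c: "cosh x \<noteq> 0" by (rule cosh_real_nonzero)
  have s: "(sech has_field_derivative - (tanh x * sech x)) (at x)"
  proof -
    have "((\<lambda>x. inverse (cosh x)) has_field_derivative - (inverse (cosh x) * sinh x * inverse (cosh x))) (at x)"
      using c by (intro DERIV_inverse' has_field_derivative_cosh[THEN DERIV_cong] DERIV_ident) auto
    thus ?thesis by (simp add: sech_def[abs_def] tanh_def divide_inverse mult_ac)
  qed
  show ?thesis
  proof (cases n)
    case (Suc m)
    have "((\<lambda>x. sech x ^ n) has_field_derivative real n * (- (tanh x * sech x) * sech x ^ (n - Suc 0))) (at x)"
      by (rule DERIV_power[OF s])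
    thus ?thesis using Suc by (simp add: mult_ac)
  qed auto
qed

lemma has_derivative_tanh_sech_power:
  "((\<lambda>x. - (real n * tanh x * sech x ^ n)) has_field_derivative
      (real n)\<^sup>2 * sech x ^ n - real n * (real n + 1) * sech x ^ (n + 2)) (at x)"
proof -
  have c: "cosh x \<noteq> 0" by (rule cosh_real_nonzero)
  have t: "1 - tanh x ^ 2 = sech x ^ 2"
  proof -
    have "1 - tanh x ^ 2 = (cosh x ^ 2 - sinh x ^ 2) / cosh x ^ 2"
      using c by (simp add: tanh_def power_divide diff_divide_distrib del: cosh_square_eq)
    thus ?thesis by (simp add: hyperbolic_pythagoras sech_def power_divide del: cosh_square_eq)
  qed
  have "((\<lambda>x. - (real n * tanh x * sech x ^ n)) has_field_derivative
      - (real n * ((1 - tanh x ^ 2) * sech x ^ n + - (real n * tanh x * sech x ^ n) * tanh x))) (at x)"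
  proof -
    have "(tanh has_field_derivative 1 - tanh x ^ 2) (at x)"
      using has_field_derivative_tanh[OF c DERIV_ident] by simp
    from DERIV_minus[OF DERIV_cmult[OF DERIV_mult[OF this has_derivative_sech_power]], of "real n" n]
    show ?thesis by (simp only: mult.assoc)
  qed
  moreover have "- (real n * ((1 - tanh x ^ 2) * sech x ^ n + - (real n * tanh x * sech x ^ n) * tanh x)) =
      (real n)\<^sup>2 * sech x ^ n - real n * (real n + 1) * ((1 - tanh x ^ 2) * sech x ^ n)"
    by (simp add: algebra_simps power2_eq_square)
  ultimately show ?thesis
    unfolding t by (simp only: power_add mult.commute[of "sech x ^ 2"])
qed

lemma tanh_le_self:
  assumes "0 \<le> (x::real)"
  shows "tanh x \<le> x" "0 \<le> tanh x" "tanh x \<le> 1"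
proof -
  have "(\<lambda>x. x - tanh x) 0 \<le> (\<lambda>x. x - tanh x) x"
  proof (rule DERIV_nonneg_imp_nondecreasing[OF assms])
    fix y :: real
    have "((\<lambda>x. x - tanh x) has_field_derivative tanh y ^ 2) (at y)"
      using DERIV_diff[OF DERIV_ident has_field_derivative_tanh[OF cosh_real_nonzero DERIV_ident], of y] by simp
    thus "\<exists>d. ((\<lambda>x. x - tanh x) has_field_derivative d) (at y) \<and> 0 \<le> d" by (intro exI conjI) auto
  qed
  thus "tanh x \<le> x" by simp
  show "0 \<le> tanh x" using assms by simp
  show "tanh x \<le> 1" using tanh_real_lt_1[of x] by simp
qed

lemma one_minus_sech_power_bound:
  assumes "0 < x"
  shows "0 \<le> 1 - sech x ^ n" "1 - sech x ^ n \<le> real n * x\<^sup>2" "1 - sech x ^ n \<le> 1"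
proof -
  have s: "0 \<le> sech x ^ n" "sech x ^ n \<le> 1"
    using sech_bounds[of x] by (auto intro: power_le_one zero_le_power)
  thus "0 \<le> 1 - sech x ^ n" "1 - sech x ^ n \<le> 1" by auto
  obtain y where y: "0 < y" "y < x" and eq: "sech x ^ n - sech 0 ^ n = (x - 0) * (- (real n * tanh y * sech y ^ n))"
    using MVT2[OF assms, of "\<lambda>x. sech x ^ n" "\<lambda>y. - (real n * tanh y * sech y ^ n)"] has_derivative_sech_power
    by blast
  have "tanh y * sech y ^ n \<le> x * 1"
    using tanh_le_self[of y] y sech_bounds[of y] by (intro mult_mono) (auto intro: power_le_one)
  hence "x * (real n * (tanh y * sech y ^ n)) \<le> x * (real n * (x * 1))"
    using assms by (intro mult_left_mono) auto
  thus "1 - sech x ^ n \<le> real n * x\<^sup>2"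
    using eq by (simp add: sech_def power2_eq_square mult_ac)
qed

text \<open>The quadratic zero of \<open>sech\<^sup>n x - 1\<close> at 0 opens the strip to \<open>-2 < Re s < 0\<close>, which contains \<open>-1\<close>.\<close>

lemma mellin_class_sech_power_minus_one:
  "mellin_class (-2) 0 (\<lambda>x. of_real (sech x ^ n) - 1)"
proof (rule mellin_classI[of _ "real n" _ 1])
  fix x :: real
  have eq: "norm (complex_of_real (sech x ^ n) - 1) = \<bar>sech x ^ n - 1\<bar>"
    by (metis norm_of_real of_real_1 of_real_diff)
  {
    assume x: "0 < x" "x \<le> 1"
    show "norm (complex_of_real (sech x ^ n) - 1) \<le> real n * x powr (- (-2))"
      unfolding eq using one_minus_sech_power_bound[OF x(1), of n] x by (simp add: powr_numeral)
  next
    assume x: "1 \<le> x"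
    show "norm (complex_of_real (sech x ^ n) - 1) \<le> 1 * x powr (- 0)"
      unfolding eq using one_minus_sech_power_bound[of x n] x by simp
  }
qed (intro continuous_intros)

lemma mellin_class_tanh_sech_power:
  assumes "1 \<le> n"
  shows "mellin_class (-1) 1 (\<lambda>x. of_real (- (real n * tanh x * sech x ^ n)))"
proof (rule mellin_classI[of _ "real n" _ "2 * real n"])
  fix x :: real assume x: "0 < x"
  have eq: "norm (complex_of_real (- (real n * tanh x * sech x ^ n))) = real n * (tanh x * sech x ^ n)"
    unfolding norm_of_real using tanh_le_self[of x] x sech_bounds[of x]
    by (simp add: abs_mult)
  have "tanh x * sech x ^ n \<le> x * 1"
    using tanh_le_self[of x] x sech_bounds[of x] by (intro mult_mono) (auto intro: power_le_one)
  thus "norm (complex_of_real (- (real n * tanh x * sech x ^ n))) \<le> real n * x powr (- (-1))"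
    unfolding eq using x by (simp add: mult_left_mono)
next
  fix x :: real assume x: "1 \<le> x"
  have eq: "norm (complex_of_real (- (real n * tanh x * sech x ^ n))) = real n * (tanh x * sech x ^ n)"
    unfolding norm_of_real using tanh_le_self[of x] x sech_bounds[of x]
    by (simp add: abs_mult)
  have "tanh x * sech x ^ n \<le> 1 * sech x ^ 1"
    using assms tanh_le_self[of x] x sech_bounds[of x] by (intro mult_mono power_decreasing) auto
  also have "\<dots> \<le> 2 * exp (- x)" using sech_bounds[of x] by simp
  also have "x \<le> exp x" using exp_ge_add_one_self[of x] by linarith
  hence "2 * exp (- x) \<le> 2 * (1 / x)" using x by (simp add: exp_minus field_simps)
  finally have "tanh x * sech x ^ n \<le> 2 * (1 / x)" by simp
  hence "real n * (tanh x * sech x ^ n) \<le> real n * (2 * (1 / x))" by (intro mult_left_mono) auto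
  thus "norm (complex_of_real (- (real n * tanh x * sech x ^ n))) \<le> 2 * real n * x powr (- 1)"
    unfolding eq using x by (simp add: powr_minus_divide mult_ac)
qed (intro continuous_intros; simp add: cosh_real_nonzero)

lemma mellin_class_sech_power_second_derivative:
  assumes "1 \<le> n" "0 \<le> \<beta>"
  shows "mellin_class 0 \<beta> (\<lambda>x. of_real ((real n)\<^sup>2 * sech x ^ n - real n * (real n + 1) * sech x ^ (n + 2)))"
proof (rule mellin_class_exp_decay[of _ 1 _ "((real n)\<^sup>2 + real n * (real n + 1)) * 2"])
  fix x :: real assume x: "0 < x"
  have p: "sech x ^ m \<le> 2 * exp (- x)" "0 \<le> sech x ^ m" if "1 \<le> m" for m
  proof -
    have "sech x ^ m \<le> sech x ^ 1"
      using that sech_bounds[of x] by (intro power_decreasing) auto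
    thus "sech x ^ m \<le> 2 * exp (- x)" using sech_bounds(1)[of x] by simp
    show "0 \<le> sech x ^ m" using sech_bounds(2)[of x] by simp
  qed
  define A B where "A = (real n)\<^sup>2 * sech x ^ n" and "B = real n * (real n + 1) * sech x ^ (n + 2)"
  have "0 \<le> A" "0 \<le> B" unfolding A_def B_def using p[of n] p[of "n + 2"] assms by auto
  moreover have "A \<le> (real n)\<^sup>2 * (2 * exp (- x))"
    unfolding A_def using p[of n] assms by (intro mult_left_mono) auto
  moreover have "B \<le> real n * (real n + 1) * (2 * exp (- x))"
    unfolding B_def using p[of "n + 2"] by (intro mult_left_mono) auto
  ultimately have "\<bar>A - B\<bar> \<le> (real n)\<^sup>2 * (2 * exp (- x)) + real n * (real n + 1) * (2 * exp (- x))"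
    by linarith
  also have "\<dots> = ((real n)\<^sup>2 + real n * (real n + 1)) * 2 * exp (- 1 * x)"
    by (simp add: algebra_simps)
  finally show "norm (complex_of_real ((real n)\<^sup>2 * sech x ^ n - real n * (real n + 1) * sech x ^ (n + 2)))
      \<le> ((real n)\<^sup>2 + real n * (real n + 1)) * 2 * exp (- 1 * x)"
    unfolding A_def B_def norm_of_real .
qed (use assms in \<open>auto intro!: continuous_intros\<close>)

lemma mellin_sech_power_minus_one_at_minus_one:
  "mellin (\<lambda>x. of_real (sech x ^ n) - 1) (-1) = - of_real (sech_moment n)"
proof -
  have "mellin (\<lambda>x. of_real (sech x ^ n) - 1) (-1) = (LBINT x:{0<..}. - complex_of_real ((1 - sech x ^ n) / x\<^sup>2))"
    unfolding mellin_def
  proof (intro set_lebesgue_integral_cong allI impI)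
    fix x :: real assume x: "x \<in> {0<..}"
    have "complex_of_real x powr (-1 - 1) = of_real (x powr (-2))"
      using x powr_of_real[of x "-2"] by simp
    also have "x powr (-2) = 1 / x\<^sup>2" using x by (simp add: powr_minus_divide powr_numeral)
    finally have "complex_of_real x powr (-1 - 1) = 1 / (of_real x)\<^sup>2" by simp
    thus "complex_of_real x powr (-1 - 1) * (of_real (sech x ^ n) - 1) = - complex_of_real ((1 - sech x ^ n) / x\<^sup>2)"
      by (simp add: diff_divide_distrib)
  qed auto
  also have "\<dots> = - complex_of_real (sech_moment n)"
    unfolding sech_moment_def set_integral_complex_of_real[symmetric]
    by (simp add: set_lebesgue_integral_def)
  finally show ?thesis .
qed

lemma one_minus_sech_power_integrable:
  "set_integrable lborel {0<..} (\<lambda>x. (1 - sech x ^ n) / x\<^sup>2)"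
proof -
  have "set_integrable lborel {0<..} (\<lambda>x. - (of_real x powr (-1 - 1) * (complex_of_real (sech x ^ n) - 1)))"
    using set_integrable_mult_right[of "-1", OF mellin_integrable[OF mellin_class_sech_power_minus_one[of n], of "-1"]]
    by simp
  also have "?this \<longleftrightarrow> set_integrable lborel {0<..} (\<lambda>x. complex_of_real ((1 - sech x ^ n) / x\<^sup>2))"
  proof (rule set_integrable_cong)
    fix x :: real assume x: "x \<in> {0<..}"
    have "complex_of_real x powr (-1 - 1) = of_real (x powr (-2))"
      using x powr_of_real[of x "-2"] by simp
    also have "x powr (-2) = 1 / x\<^sup>2" using x by (simp add: powr_minus_divide powr_numeral)
    finally have "complex_of_real x powr (-1 - 1) = 1 / (of_real x)\<^sup>2" by simp
    thus "- (of_real x powr (-1 - 1) * (complex_of_real (sech x ^ n) - 1)) = complex_of_real ((1 - sech x ^ n) / x\<^sup>2)"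
      by (simp add: diff_divide_distrib)
  qed auto
  also have "\<dots> \<longleftrightarrow> set_integrable lborel {0<..} (\<lambda>x. (1 - sech x ^ n) / x\<^sup>2)"
    unfolding set_integrable_def complex_of_real_integrable_eq[symmetric]
    by (simp add: scaleR_conv_of_real)
  finally show ?thesis .
qed

lemma mellin_derivative_sech_power:
  assumes n: "1 \<le> n" and s: "-2 < Re s" "Re s < 0"
  shows "mellin (\<lambda>x. of_real (- (real n * tanh x * sech x ^ n))) (s + 1) =
    - s * mellin (\<lambda>x. of_real (sech x ^ n) - 1) s"
proof (rule mellin_by_parts[OF mellin_class_sech_power_minus_one])
  show "mellin_class (- 2 + 1) (0 + 1) (\<lambda>x. complex_of_real (- (real n * tanh x * sech x ^ n)))"
    using mellin_class_tanh_sech_power[OF n] by simp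
  fix x :: real
  have "((\<lambda>x. complex_of_real (sech x ^ n)) has_vector_derivative of_real (- (real n * tanh x * sech x ^ n))) (at x)"
    using has_derivative_sech_power by (intro has_vector_derivative_of_real) (simp add: has_real_derivative_iff_has_vector_derivative)
  thus "((\<lambda>x. complex_of_real (sech x ^ n) - 1) has_vector_derivative of_real (- (real n * tanh x * sech x ^ n))) (at x)"
    by (auto intro!: derivative_eq_intros)
qed (use s in auto)

lemma lambda_int_eq_sech_moment:
  assumes n: "1 \<le> n"
  shows "real n * lambda_int n = sech_moment n"
proof -
  have "mellin (\<lambda>x. of_real (- (real n * tanh x * sech x ^ n))) (-1 + 1) =
      (LBINT x:{0<..}. complex_of_real (- real n * (tanh x * sech x ^ n / x)))"
    unfolding mellin_def
  proof (intro set_lebesgue_integral_cong allI impI)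
    fix x :: real assume x: "x \<in> {0<..}"
    have "complex_of_real x powr (-1 + 1 - 1) = 1 / of_real x"
      using x powr_minus_divide[of "complex_of_real x" 1] by simp
    thus "complex_of_real x powr (-1 + 1 - 1) * complex_of_real (- (real n * tanh x * sech x ^ n)) =
        complex_of_real (- real n * (tanh x * sech x ^ n / x))" by simp
  qed auto
  also have "\<dots> = of_real (- real n * lambda_int n)"
    unfolding set_integral_complex_of_real lambda_int_def by (simp only: set_integral_mult_right)
  finally have "of_real (- real n * lambda_int n) = - complex_of_real (sech_moment n)"
    using mellin_derivative_sech_power[OF n, of "-1"] mellin_sech_power_minus_one_at_minus_one[of n] by simp
  hence "complex_of_real (- real n * lambda_int n) = complex_of_real (- sech_moment n)" by simp
  thus ?thesis by (simp only: of_real_eq_iff)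
qed

lemma delta_int_eq_sech_moment: "delta_int n = sech_moment (n + 1) - sech_moment n"
proof -
  have "(\<lambda>x. (1 - sech x) / x\<^sup>2 * sech x ^ n) = (\<lambda>x. (1 - sech x ^ (n + 1)) / x\<^sup>2 - (1 - sech x ^ n) / x\<^sup>2)"
    by (auto simp: algebra_simps simp flip: diff_divide_distrib add_divide_distrib)
  thus ?thesis
    unfolding delta_int_def sech_moment_def
    by (simp only: set_integral_diff(2)[OF one_minus_sech_power_integrable one_minus_sech_power_integrable])
qed

lemma chi_int_eq_sech_moment: "chi_int n = sech_moment n - sech_moment 1"
proof -
  have "(\<lambda>x. (sech x - sech x ^ n) / x\<^sup>2) = (\<lambda>x. (1 - sech x ^ n) / x\<^sup>2 - (1 - sech x ^ 1) / x\<^sup>2)"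
    by (auto simp flip: diff_divide_distrib)
  thus ?thesis
    unfolding chi_int_def sech_moment_def
    by (simp only: set_integral_diff(2)[OF one_minus_sech_power_integrable one_minus_sech_power_integrable])
qed

text \<open>Two integrations by parts, from the second derivative down to \<open>sech\<^sup>n - 1\<close>. Starting from
\<open>sech\<^sup>n - 1\<close> rather than \<open>sech\<^sup>n\<close> is what allows the strip \<open>0 < Re s < 2\<close>, with \<open>s = 1\<close> inside.\<close>

lemma mellin_second_derivative_sech_power:
  assumes n: "1 \<le> n" and s: "0 < Re s" "Re s < 2"
  shows "of_nat n ^ 2 * mellin (\<lambda>x. of_real (sech x ^ n)) s -
      of_nat n * (of_nat n + 1) * mellin (\<lambda>x. of_real (sech x ^ (n + 2))) s =
      (s - 1) * (s - 2) * mellin (\<lambda>x. of_real (sech x ^ n) - 1) (s - 2)"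
proof -
  let ?S2 = "\<lambda>x. complex_of_real ((real n)\<^sup>2 * sech x ^ n - real n * (real n + 1) * sech x ^ (n + 2))"
  let ?I = "\<lambda>m x. complex_of_real x powr (s - 1) * of_real (sech x ^ m)"
  have i: "set_integrable lborel {0<..} (?I m)" if "1 \<le> m" for m
    by (rule mellin_integrable[OF mellin_class_sech_power[OF that, of 2]]) (use s in auto)
  have i1: "set_integrable lborel {0<..} (\<lambda>x. of_nat n ^ 2 * ?I n x)"
    by (intro set_integrable_mult_right i n)
  have i2: "set_integrable lborel {0<..} (\<lambda>x. of_nat n * (of_nat n + 1) * ?I (n + 2) x)"
    by (intro set_integrable_mult_right i) auto
  have "mellin ?S2 s = (LBINT x:{0<..}. of_nat n ^ 2 * ?I n x - of_nat n * (of_nat n + 1) * ?I (n + 2) x)"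
    unfolding mellin_def by (intro set_lebesgue_integral_cong) (auto simp: right_diff_distrib mult_ac)
  also have "\<dots> = of_nat n ^ 2 * mellin (\<lambda>x. of_real (sech x ^ n)) s -
      of_nat n * (of_nat n + 1) * mellin (\<lambda>x. of_real (sech x ^ (n + 2))) s"
    by (subst set_integral_diff(2)[OF i1 i2]) (simp only: set_integral_mult_right mellin_def)
  finally have 1: "mellin ?S2 s = of_nat n ^ 2 * mellin (\<lambda>x. of_real (sech x ^ n)) s -
      of_nat n * (of_nat n + 1) * mellin (\<lambda>x. of_real (sech x ^ (n + 2))) s" .
  have "mellin ?S2 ((s - 1) + 1) = - (s - 1) * mellin (\<lambda>x. of_real (- (real n * tanh x * sech x ^ n))) (s - 1)"
  proof (rule mellin_by_parts[OF mellin_class_tanh_sech_power[OF n]])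
    show "mellin_class (- 1 + 1) (1 + 1) ?S2"
      using mellin_class_sech_power_second_derivative[OF n, of 2] by simp
    show "((\<lambda>x. complex_of_real (- (real n * tanh x * sech x ^ n))) has_vector_derivative ?S2 x) (at x)" for x
      using has_derivative_tanh_sech_power
      by (intro has_vector_derivative_of_real) (simp only: has_real_derivative_iff_has_vector_derivative)
  qed (use s in auto)
  moreover have "mellin (\<lambda>x. of_real (- (real n * tanh x * sech x ^ n))) ((s - 2) + 1) =
      - (s - 2) * mellin (\<lambda>x. of_real (sech x ^ n) - 1) (s - 2)"
    by (rule mellin_derivative_sech_power[OF n]) (use s in auto)
  moreover have "(s - 1) + 1 = s" "(s - 2) + 1 = s - 1" by auto
  ultimately have 2: "mellin ?S2 s = (s - 1) * (s - 2) * mellin (\<lambda>x. of_real (sech x ^ n) - 1) (s - 2)"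
    by (simp only: mult_minus_left mult_minus_right minus_minus mult.assoc)
  show ?thesis using 1 2 by simp
qed

text \<open>Divide the previous identity by \<open>4\<^sup>-\<^sup>s \<Gamma>(s)\<close>: the function \<open>Q = n\<^sup>2 Z\<^sub>n - n(n+1) Z\<^sub>n\<^sub>+\<^sub>2\<close> equals
\<open>(s-1) h(s)\<close> with \<open>h\<close> holomorphic at 1, so \<open>Q'(1) = h(1)\<close>, and \<open>h(1)\<close> is the moment up to the
factor \<open>4 / \<Gamma>(1)\<close>.\<close>

lemma sech_moment_eq_deriv_sech_zeta:
  assumes n: "1 \<le> n"
  shows "4 * of_real (sech_moment n) =
    of_nat n ^ 2 * deriv (sech_zeta n) 1 - of_nat n * (of_nat n + 1) * deriv (sech_zeta (n + 2)) 1"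
proof -
  define Q where "Q s = of_nat n ^ 2 * sech_zeta n s - of_nat n * (of_nat n + 1) * sech_zeta (n + 2) s" for s
  define J where "J = mellin (\<lambda>x. of_real (sech x ^ n) - 1)"
  define h where "h s = 4 powr s * rGamma s * (s - 2) * J (s - 2)" for s
  have "J holomorphic_on {s. -2 < Re s \<and> Re s < 0}"
    unfolding J_def by (rule mellin_holomorphic[OF mellin_class_sech_power_minus_one])
  hence "(\<lambda>s. J (s - 2)) holomorphic_on {s. 0 < Re s \<and> Re s < 2}"
    by (intro holomorphic_on_compose_gen[of "\<lambda>s. s - 2" _ J, unfolded o_def]) (auto intro!: holomorphic_intros)
  hence holh: "h holomorphic_on {s. 0 < Re s \<and> Re s < 2}"
    unfolding h_def by (auto intro!: holomorphic_intros)
  have op: "open {s. 0 < Re s \<and> Re s < 2}"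
    by (intro open_Collect_conj open_halfspace_Re_gt open_halfspace_Re_lt)
  have Q: "Q s = (s - 1) * h s" if s: "0 < Re s" "Re s < 2" for s
  proof -
    have Z: "sech_zeta m s = 4 powr s * (rGamma s * mellin (\<lambda>x. of_real (sech x ^ m)) s)" if "1 \<le> m" for m
      using mellin_sech_power[OF that s(1)] by (simp add: powr_minus field_simps)
    have Zn: "sech_zeta n s = 4 powr s * (rGamma s * mellin (\<lambda>x. of_real (sech x ^ n)) s)"
      and Zn2: "sech_zeta (n + 2) s = 4 powr s * (rGamma s * mellin (\<lambda>x. of_real (sech x ^ (n + 2))) s)"
      using n by (intro Z; simp)+
    have "Q s = 4 powr s * rGamma s * (of_nat n ^ 2 * mellin (\<lambda>x. of_real (sech x ^ n)) s -
      of_nat n * (of_nat n + 1) * mellin (\<lambda>x. of_real (sech x ^ (n + 2))) s)"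
      unfolding Q_def Zn Zn2 by (simp only: right_diff_distrib mult_ac)
    also have "\<dots> = (s - 1) * h s"
      unfolding mellin_second_derivative_sech_power[OF n s] h_def J_def by (simp only: mult_ac)
    finally show ?thesis .
  qed
  \<comment> \<open>Only the first factor contributes to the derivative at its zero.\<close>
  have "((\<lambda>s. (s - 1) * h s) has_field_derivative h 1) (at 1)"
    using DERIV_mult[of "\<lambda>s. s - 1" 1 1 UNIV h "deriv h 1"] holomorphic_derivI[OF holh op, of 1]
    by (auto intro!: derivative_eq_intros)
  moreover have "\<forall>\<^sub>F s in nhds 1. (s - 1) * h s = Q s"
    using Q op by (auto simp: eventually_nhds intro!: exI[of _ "{s. 0 < Re s \<and> Re s < 2}"])
  ultimately have "(Q has_field_derivative h 1) (at 1)"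
    by (subst DERIV_cong_ev[symmetric, OF refl _ refl]) auto
  hence 1: "deriv Q 1 = h 1" by (rule DERIV_imp_deriv)
  have fd: "sech_zeta m field_differentiable (at 1)" if "1 \<le> m" for m
    using sech_zeta_holomorphic[OF that] by (auto intro: holomorphic_on_imp_differentiable_at)
  have der: "(sech_zeta m has_field_derivative deriv (sech_zeta m) 1) (at 1)" if "1 \<le> m" for m
    using fd[OF that] by (simp add: DERIV_deriv_iff_field_differentiable)
  have "(Q has_field_derivative of_nat n ^ 2 * deriv (sech_zeta n) 1 - of_nat n * (of_nat n + 1) * deriv (sech_zeta (n + 2)) 1) (at 1)"
    unfolding Q_def[abs_def] using n by (intro DERIV_diff DERIV_cmult der) auto
  hence 2: "deriv Q 1 = of_nat n ^ 2 * deriv (sech_zeta n) 1 - of_nat n * (of_nat n + 1) * deriv (sech_zeta (n + 2)) 1"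
    by (rule DERIV_imp_deriv)
  have "h 1 = 4 * of_real (sech_moment n)"
    unfolding h_def J_def using mellin_sech_power_minus_one_at_minus_one[of n] by simp
  with 1 2 show ?thesis by simp
qed

lemma deriv_sech_zeta:
  assumes n: "1 \<le> n"
  shows "deriv (sech_zeta n) 1 = 2 ^ (2 * n - 1) / fact (n - 1) *
     (\<Sum>k\<le>n - 1. (- (1 / 2)) ^ k * stirlingP k (n - 1) (of_nat n / 2) *
        hurwitz_zeta'_diff (of_nat k - of_nat n + 2) (of_nat n / 4) ((of_nat n + 2) / 4))"
proof (rule DERIV_imp_deriv)
  define D where "D = hurwitz_diff (real n / 4) (real n / 4 + 1 / 2)"
  have D: "D holomorphic_on UNIV" unfolding D_def using n by (intro hurwitz_diff_holomorphic) auto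
  have derD: "deriv D w = hurwitz_zeta'_diff w (of_nat n / 4) ((of_nat n + 2) / 4)" for w
    using n deriv_hurwitz_diff[of "real n / 4" "real n / 4 + 1 / 2" w] by (simp add: D_def add_divide_distrib)
  have "((\<lambda>s. D (s + of_nat k - of_nat n + 1)) has_field_derivative
      hurwitz_zeta'_diff (of_nat k - of_nat n + 2) (of_nat n / 4) ((of_nat n + 2) / 4)) (at 1)" for k
  proof -
    have "(D has_field_derivative deriv D (1 + of_nat k - of_nat n + 1)) (at (1 + of_nat k - of_nat n + 1))"
      by (rule holomorphic_derivI[OF D]) auto
    moreover have "((\<lambda>s. s + of_nat k - of_nat n + 1) has_field_derivative 1) (at (1::complex))"
      by (auto intro!: derivative_eq_intros)
    ultimately have "((\<lambda>s. D (s + of_nat k - of_nat n + 1)) has_field_derivative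
        deriv D (1 + of_nat k - of_nat n + 1) * 1) (at 1)"
      by (rule DERIV_chain2)
    moreover have "1 + of_nat k - of_nat n + 1 = of_nat k - of_nat n + (2::complex)" by simp
    ultimately show ?thesis by (simp only: derD mult_1_right)
  qed
  thus "(sech_zeta n has_field_derivative 2 ^ (2 * n - 1) / fact (n - 1) *
     (\<Sum>k\<le>n - 1. (- (1 / 2)) ^ k * stirlingP k (n - 1) (of_nat n / 2) *
        hurwitz_zeta'_diff (of_nat k - of_nat n + 2) (of_nat n / 4) ((of_nat n + 2) / 4))) (at 1)"
    unfolding sech_zeta_def[abs_def] D_def[symmetric] by (intro DERIV_cmult DERIV_sum)
qed

section \<open>The first moment and the Catalan constant\<close>

text \<open>The logarithmic derivative of Euler's reflection formula.\<close>

lemma Digamma_reflection_strip: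
  fixes z :: complex
  assumes z: "0 < Re z" "Re z < 1"
  shows "sin (of_real pi * z) \<noteq> 0"
    and "Digamma (1 - z) - Digamma z = of_real pi * cos (of_real pi * z) / sin (of_real pi * z)"
proof -
  have nz: "w \<notin> \<int>\<^sub>\<le>\<^sub>0" if "0 < Re w" for w :: complex
    using that by (auto elim!: nonpos_Ints_cases)
  have G: "Gamma z \<noteq> 0" "Gamma (1 - z) \<noteq> 0"
    using nz[of z] nz[of "1 - z"] z by (auto simp: Gamma_eq_zero_iff)
  show s: "sin (of_real pi * z) \<noteq> 0"
    using Gamma_reflection_complex[of z] G by auto
  have "((\<lambda>w. Gamma w * Gamma (1 - w)) has_field_derivative
      Gamma z * Digamma z * Gamma (1 - z) + Gamma (1 - z) * Digamma (1 - z) * (-1) * Gamma z) (at z)"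
    using nz[of z] nz[of "1 - z"] z
    by (intro DERIV_mult DERIV_chain2[of Gamma] has_field_derivative_Gamma)
       (auto intro!: derivative_eq_intros has_field_derivative_Gamma)
  moreover have "((\<lambda>w. of_real pi / sin (of_real pi * w)) has_field_derivative
      - (of_real pi * (of_real pi * cos (of_real pi * z)) / (sin (of_real pi * z) * sin (of_real pi * z)))) (at z)"
    using s by (auto intro!: derivative_eq_intros simp: mult_ac)
  ultimately have "Gamma z * Digamma z * Gamma (1 - z) + Gamma (1 - z) * Digamma (1 - z) * (-1) * Gamma z =
      - (of_real pi * (of_real pi * cos (of_real pi * z)) / (sin (of_real pi * z) * sin (of_real pi * z)))"
    unfolding Gamma_reflection_complex by (rule DERIV_unique)
  also have "\<dots> = - (Gamma z * Gamma (1 - z)) * (of_real pi * cos (of_real pi * z) / sin (of_real pi * z))"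
    unfolding Gamma_reflection_complex by simp
  finally have "Gamma z * Gamma (1 - z) * (Digamma (1 - z) - Digamma z) =
      Gamma z * Gamma (1 - z) * (of_real pi * cos (of_real pi * z) / sin (of_real pi * z))"
    by (simp add: algebra_simps)
  moreover have "Gamma z * Gamma (1 - z) \<noteq> 0" using G by simp
  ultimately show "Digamma (1 - z) - Digamma z = of_real pi * cos (of_real pi * z) / sin (of_real pi * z)"
    using mult_left_cancel by blast
qed

lemma Digamma_sums:
  fixes z :: complex
  assumes "0 < Re z"
  shows "(\<lambda>k. inverse (of_nat (Suc k)) - inverse (z + of_nat k)) sums (Digamma z + euler_mascheroni)"
proof -
  have "z \<noteq> 0" using assms by auto
  from summable_sums[OF summable_Digamma[OF this]] show ?thesis by (simp add: Digamma_def)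
qed

lemma inverse_plus_inverse_cnj:
  assumes "0 < p"
  shows "inverse (Complex p t) + inverse (Complex p (- t)) = of_real (2 * p / (p\<^sup>2 + t\<^sup>2))"
proof -
  have "0 < p\<^sup>2 + t\<^sup>2" using assms by (intro add_pos_nonneg) auto
  thus ?thesis by (simp add: complex_eq_iff add_divide_distrib[symmetric])
qed

text \<open>From \<open>2 / sin(2\<theta>) = cot \<theta> + cot(\<pi>/2 - \<theta>)\<close> with \<open>2\<theta> = \<pi>/2 + ix\<close>, where \<open>sin(2\<theta>) = cosh x\<close>. Both
cotangents are differences of digamma values by reflection, and the digamma series at the four points
\<open>1/4 \<plusminus> it\<close>, \<open>3/4 \<plusminus> it\<close> with \<open>t = x/(2\<pi>)\<close> combine in conjugate pairs. Each term of
the series groups two neighbouring poles, which makes it absolutely convergent.\<close>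

lemma sech_partial_fractions:
  "(\<lambda>k. 2 * ((2 * real k + 1/2) * pi) / (((2 * real k + 1/2) * pi)\<^sup>2 + x\<^sup>2) -
        2 * ((2 * real k + 3/2) * pi) / (((2 * real k + 3/2) * pi)\<^sup>2 + x\<^sup>2)) sums sech x"
proof -
  define t where "t = x / (2 * pi)"
  define v where "v = Complex (1/4) t"
  let ?D = "\<lambda>z k. inverse (of_nat (Suc k)) - inverse (z + of_nat k :: complex)"
  have points: "0 < Re v" "0 < Re (1 - v)" "0 < Re (1/2 + v)" "0 < Re (1/2 - v)" "Re v < 1" "Re (1/2 - v) < 1"
    by (auto simp: v_def)
  have "(\<lambda>k. (?D (1 - v) k - ?D v k) + (?D (1/2 + v) k - ?D (1/2 - v) k)) sums
      (((Digamma (1 - v) + euler_mascheroni) - (Digamma v + euler_mascheroni)) +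
      ((Digamma (1/2 + v) + euler_mascheroni) - (Digamma (1/2 - v) + euler_mascheroni)))"
    by (intro sums_add sums_diff Digamma_sums points)
  also have "((Digamma (1 - v) + euler_mascheroni) - (Digamma v + euler_mascheroni)) +
      ((Digamma (1/2 + v) + euler_mascheroni) - (Digamma (1/2 - v) + euler_mascheroni)) =
      (Digamma (1 - v) - Digamma v) + (Digamma (1 - (1/2 - v)) - Digamma (1/2 - v))"
    by (simp add: algebra_simps)
  also have "\<dots> = of_real pi * cos (of_real pi * v) / sin (of_real pi * v) +
      of_real pi * cos (of_real pi * (1/2 - v)) / sin (of_real pi * (1/2 - v))"
    using points by (simp only: Digamma_reflection_strip(2))
  also have "\<dots> = of_real (2 * pi * sech x)"
  proof -
    have c: "of_real pi * (1/2 - v) = of_real pi / 2 - of_real pi * v" by (simp add: algebra_simps)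
    define S C where "S = sin (of_real pi * v)" and "C = cos (of_real pi * v)"
    have SC: "cos (of_real pi * (1/2 - v)) = S" "sin (of_real pi * (1/2 - v)) = C"
      unfolding c S_def C_def by (simp_all add: cos_diff sin_diff flip: of_real_divide sin_of_real cos_of_real)
    have ne: "S \<noteq> 0" "C \<noteq> 0"
      using Digamma_reflection_strip(1)[of v] Digamma_reflection_strip(1)[of "1/2 - v"] points
      unfolding SC by (auto simp: S_def)
    have "of_real pi * C / S + of_real pi * S / C = of_real pi * (C\<^sup>2 + S\<^sup>2) / (S * C)"
      using ne by (simp add: divide_simps power2_eq_square) (simp add: algebra_simps)
    also have "C\<^sup>2 + S\<^sup>2 = 1" unfolding S_def C_def by simp
    also have "S * C = sin (2 * (of_real pi * v)) / 2" unfolding S_def C_def by (simp add: sin_double)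
    also have "2 * (of_real pi * v) = of_real (pi / 2) + \<i> * of_real x"
      by (simp add: v_def t_def complex_eq_iff)
    also have "sin (of_real (pi / 2) + \<i> * of_real x) = of_real (cosh x)"
    proof -
      have "sin (of_real (pi / 2) + \<i> * of_real x) = cos (\<i> * of_real x)"
        unfolding sin_add by (simp only: sin_of_real cos_of_real sin_pi_half cos_pi_half) simp
      also have "\<dots> = of_real (cosh x)"
        by (simp add: cosh_def cos_exp_eq scaleR_conv_of_real mult.assoc[symmetric] flip: exp_of_real of_real_minus)
      finally show ?thesis .
    qed
    finally show ?thesis
      unfolding SC S_def[symmetric] C_def[symmetric] by (simp add: sech_def)
  qed
  also have "(\<lambda>k. (?D (1 - v) k - ?D v k) + (?D (1/2 + v) k - ?D (1/2 - v) k)) =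
      (\<lambda>k. of_real (2 * pi * (2 * ((2 * real k + 1/2) * pi) / (((2 * real k + 1/2) * pi)\<^sup>2 + x\<^sup>2) -
        2 * ((2 * real k + 3/2) * pi) / (((2 * real k + 3/2) * pi)\<^sup>2 + x\<^sup>2))))"
  proof
    fix k :: nat
    define p q where "p = real k + 1/4" and "q = real k + 3/4"
    have pq: "0 < p" "0 < q" by (auto simp: p_def q_def)
    have "v + of_nat k = Complex p t" "1/2 - v + of_nat k = Complex p (- t)"
      "1 - v + of_nat k = Complex q (- t)" "1/2 + v + of_nat k = Complex q t"
      by (auto simp: v_def p_def q_def complex_eq_iff)
    hence "(?D (1 - v) k - ?D v k) + (?D (1/2 + v) k - ?D (1/2 - v) k) =
        (inverse (Complex p t) + inverse (Complex p (- t))) - (inverse (Complex q t) + inverse (Complex q (- t)))"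
      by simp
    also have "\<dots> = of_real (2 * p / (p\<^sup>2 + t\<^sup>2) - 2 * q / (q\<^sup>2 + t\<^sup>2))"
      using pq by (simp only: inverse_plus_inverse_cnj of_real_diff)
    also have scale: "2 * r / (r\<^sup>2 + t\<^sup>2) = 2 * pi * (2 * (2 * r * pi) / ((2 * r * pi)\<^sup>2 + x\<^sup>2))" if "0 < r" for r
    proof -
      have x: "x = 2 * pi * t" by (simp add: t_def)
      have "(2 * r * pi)\<^sup>2 + x\<^sup>2 = (2 * pi)\<^sup>2 * (r\<^sup>2 + t\<^sup>2)" unfolding x by (simp add: algebra_simps power2_eq_square)
      thus ?thesis by (simp add: power2_eq_square)
    qed
    have "2 * p / (p\<^sup>2 + t\<^sup>2) - 2 * q / (q\<^sup>2 + t\<^sup>2) =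
        2 * pi * (2 * (2 * p * pi) / ((2 * p * pi)\<^sup>2 + x\<^sup>2) - 2 * (2 * q * pi) / ((2 * q * pi)\<^sup>2 + x\<^sup>2))"
      unfolding scale[OF pq(1)] scale[OF pq(2)] by (simp only: right_diff_distrib)
    also have "2 * p = 2 * real k + 1/2" by (simp add: p_def)
    also have "2 * q = 2 * real k + 3/2" by (simp add: q_def)
    finally show "(?D (1 - v) k - ?D v k) + (?D (1/2 + v) k - ?D (1/2 - v) k) =
      of_real (2 * pi * (2 * ((2 * real k + 1/2) * pi) / (((2 * real k + 1/2) * pi)\<^sup>2 + x\<^sup>2) -
        2 * ((2 * real k + 3/2) * pi) / (((2 * real k + 3/2) * pi)\<^sup>2 + x\<^sup>2)))" by (simp only:)
  qed
  finally have "(\<lambda>k. 2 * pi * (2 * ((2 * real k + 1/2) * pi) / (((2 * real k + 1/2) * pi)\<^sup>2 + x\<^sup>2) -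
        2 * ((2 * real k + 3/2) * pi) / (((2 * real k + 3/2) * pi)\<^sup>2 + x\<^sup>2))) sums (2 * pi * sech x)"
    by (simp only: sums_of_real_iff)
  from sums_mult[OF this, of "1 / (2 * pi)"] show ?thesis by simp
qed

lemma lorentzian_integral:
  assumes a: "0 < a"
  shows "set_integrable lborel {0<..} (\<lambda>x. 2 / (a * (a\<^sup>2 + x\<^sup>2)))"
    and "(LBINT x:{0<..}. 2 / (a * (a\<^sup>2 + x\<^sup>2))) = pi / a\<^sup>2"
proof -
  let ?f = "\<lambda>x. 2 / (a * (a\<^sup>2 + x\<^sup>2))" and ?F = "\<lambda>x. 2 / a\<^sup>2 * arctan (x / a)"
  have pos: "0 < a\<^sup>2 + x\<^sup>2" for x using a by (intro add_pos_nonneg) auto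
  have ne: "a \<noteq> 0" "a\<^sup>2 + x\<^sup>2 \<noteq> 0" for x using a pos[of x] by auto
  have 1: "(?F has_real_derivative ?f x) (at x)" for x
  proof -
    have "((\<lambda>x. arctan (x / a)) has_real_derivative inverse (1 + (x / a)\<^sup>2) * (1 / a)) (at x)"
      using ne(1) by (auto intro!: derivative_eq_intros)
    from DERIV_cmult[OF this, of "2 / a\<^sup>2"]
    have "(?F has_real_derivative 2 / a\<^sup>2 * (inverse (1 + (x / a)\<^sup>2) * (1 / a))) (at x)" .
    also have "1 + (x / a)\<^sup>2 = (a\<^sup>2 + x\<^sup>2) / a\<^sup>2" using a by (simp add: power_divide add_divide_distrib)
    also have "2 / a\<^sup>2 * (inverse ((a\<^sup>2 + x\<^sup>2) / a\<^sup>2) * (1 / a)) = ?f x"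
      using ne(1) ne(2)[of x] by (simp add: divide_simps power2_eq_square)
    finally show ?thesis .
  qed
  have "a * (a\<^sup>2 + x\<^sup>2) \<noteq> 0" for x using ne(1) ne(2)[of x] by (rule no_zero_divisors)
  hence 2: "isCont ?f x" for x by (intro continuous_intros)
  have 3: "((?F \<circ> real_of_ereal) \<longlongrightarrow> 0) (at_right 0)"
  proof -
    have "isCont ?F 0" using 1 DERIV_isCont by blast
    hence "(?F \<longlongrightarrow> ?F 0) (at 0)" by (simp only: isCont_def)
    hence "(?F \<longlongrightarrow> 0) (at_right 0)" by (simp add: filterlim_at_split)
    thus ?thesis by (simp add: zero_ereal_def ereal_tendsto_simps)
  qed
  have 4: "((?F \<circ> real_of_ereal) \<longlongrightarrow> 2 / a\<^sup>2 * (pi / 2)) (at_left \<infinity>)"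
  proof -
    have "filterlim (\<lambda>x. x / a) at_top at_top"
      using a filterlim_tendsto_pos_mult_at_top[OF tendsto_const[of "1 / a"] _ filterlim_ident] by simp
    hence "((\<lambda>x. arctan (x / a)) \<longlongrightarrow> pi / 2) at_top"
      by (rule filterlim_compose[OF tendsto_arctan_at_top])
    hence "(?F \<longlongrightarrow> 2 / a\<^sup>2 * (pi / 2)) at_top" by (intro tendsto_mult_left)
    thus ?thesis by (simp add: ereal_tendsto_simps)
  qed
  have 5: "AE x in lborel. 0 < ereal x \<longrightarrow> ereal x < \<infinity> \<longrightarrow> 0 \<le> ?f x"
    using a pos by (intro AE_I2) (auto intro!: divide_nonneg_pos mult_pos_pos)
  note FTC = interval_integral_FTC_nonneg[of 0 \<infinity> ?F ?f, OF _ 1 2 5 3 4]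
  show "set_integrable lborel {0<..} ?f" using FTC(1) by (simp add: zero_ereal_def)
  show "(LBINT x:{0<..}. ?f x) = pi / a\<^sup>2"
    using FTC(2) by (simp add: interval_lebesgue_integral_def zero_ereal_def)
qed

lemma summable_inverse_odd_squares: "summable (\<lambda>k. 1 / (2 * real k + 1)\<^sup>2)"
proof (rule summable_comparison_test')
  show "summable (\<lambda>k. inverse (real k ^ 2))" by (rule inverse_power_summable) auto
  fix k :: nat assume k: "1 \<le> k"
  have "(real k)\<^sup>2 \<le> (2 * real k + 1)\<^sup>2" by (intro power_mono) auto
  hence "1 / (2 * real k + 1)\<^sup>2 \<le> 1 / (real k)\<^sup>2"
    using k by (intro divide_left_mono) auto
  thus "norm (1 / (2 * real k + 1)\<^sup>2) \<le> inverse (real k ^ 2)"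
    by (simp add: inverse_eq_divide)
qed

lemma catalan_const_sums:
  "(\<lambda>k. 1 / (4 * real k + 1)\<^sup>2 - 1 / (4 * real k + 3)\<^sup>2) sums catalan_const"
proof -
  define u where "u k = (-1) ^ k / (2 * real k + 1)\<^sup>2" for k
  have "norm (u k) = 1 / (2 * real k + 1)\<^sup>2" for k
    unfolding u_def norm_divide norm_power norm_minus_cancel norm_one power_one by simp
  hence "summable (\<lambda>k. norm (u k))" using summable_inverse_odd_squares by (simp only:)
  hence "u sums suminf u" by (rule summable_sums[OF summable_norm_cancel])
  hence "u sums catalan_const" by (simp only: catalan_const_def u_def[abs_def])
  from sums_group[OF this, of 2]
  have "(\<lambda>n. sum u {n * 2..<n * 2 + 2}) sums catalan_const" by simp
  also have "(\<lambda>n. sum u {n * 2..<n * 2 + 2}) = (\<lambda>k. 1 / (4 * real k + 1)\<^sup>2 - 1 / (4 * real k + 3)\<^sup>2)"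
  proof
    fix n :: nat
    have "{n * 2..<n * 2 + 2} = {2 * n, Suc (2 * n)}" by auto
    hence "sum u {n * 2..<n * 2 + 2} = u (2 * n) + u (Suc (2 * n))" by simp
    thus "sum u {n * 2..<n * 2 + 2} = 1 / (4 * real n + 1)\<^sup>2 - 1 / (4 * real n + 3)\<^sup>2"
      by (simp add: u_def add_ac)
  qed
  finally show ?thesis .
qed

text \<open>Subtracting the partial fractions at \<open>x\<close> from those at 0 and dividing by \<open>x\<^sup>2\<close> leaves
\<open>2 / (c (c\<^sup>2 + x\<^sup>2))\<close> for each pole \<open>ic\<close>, with alternating signs. Grouped in pairs the terms are
nonnegative, so the series may be integrated term by term; each pole contributes \<open>\<pi> / c\<^sup>2\<close>, and the
sum over \<open>c = (j + 1/2) \<pi>\<close> is \<open>4/\<pi>\<close> times the Catalan series.\<close>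

lemma sech_moment_1: "sech_moment 1 = 4 * catalan_const / pi"
proof -
  define a b where "a k = (2 * real k + 1/2) * pi" and "b k = (2 * real k + 3/2) * pi" for k :: nat
  define L where "L c x = 2 / (c * (c\<^sup>2 + x\<^sup>2))" for c x :: real
  have ab: "0 < a k" "a k < b k" "0 < b k" for k
  proof -
    show 1: "0 < a k" unfolding a_def by (intro mult_pos_pos add_nonneg_pos) auto
    show 2: "a k < b k" unfolding a_def b_def by (intro mult_strict_right_mono) auto
    show "0 < b k" using 1 2 by linarith
  qed
  define u where "u k x = L (a k) x - L (b k) x" for k x
  have L_mono: "L (b k) x \<le> L (a k) x" for k x
  proof -
    have "0 < (a k)\<^sup>2 + x\<^sup>2" using ab(1)[of k] by (intro add_pos_nonneg) auto
    moreover have "(a k)\<^sup>2 + x\<^sup>2 \<le> (b k)\<^sup>2 + x\<^sup>2"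
      using ab[of k] by (intro add_right_mono power_mono) auto
    ultimately have "0 < a k * ((a k)\<^sup>2 + x\<^sup>2)" "a k * ((a k)\<^sup>2 + x\<^sup>2) \<le> b k * ((b k)\<^sup>2 + x\<^sup>2)"
      using ab[of k] by (simp, intro mult_mono) auto
    thus ?thesis unfolding L_def by (intro frac_le) auto
  qed
  have u_nonneg: "0 \<le> u k x" for k x using L_mono by (simp add: u_def)
  have int: "set_integrable lborel {0<..} (L c)" "(LBINT x:{0<..}. L c x) = pi / c\<^sup>2" if "0 < c" for c
    using lorentzian_integral[OF that] by (simp_all add: L_def[abs_def])
  have u_int: "set_integrable lborel {0<..} (u k)"
    and u_val: "(LBINT x:{0<..}. u k x) = pi / (a k)\<^sup>2 - pi / (b k)\<^sup>2" for k
    using set_integral_diff[OF int(1) int(1), of "a k" "b k"] int(2)[of "a k"] int(2)[of "b k"] ab[of k]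
    by (simp_all add: u_def[abs_def])
  have u_sums: "(\<lambda>k. u k x) sums ((1 - sech x) / x\<^sup>2)" if x: "0 < x" for x
  proof -
    have "(\<lambda>k. ((2 * a k / ((a k)\<^sup>2 + 0\<^sup>2) - 2 * b k / ((b k)\<^sup>2 + 0\<^sup>2)) -
          (2 * a k / ((a k)\<^sup>2 + x\<^sup>2) - 2 * b k / ((b k)\<^sup>2 + x\<^sup>2))) / x\<^sup>2) sums ((sech 0 - sech x) / x\<^sup>2)"
      unfolding a_def b_def by (intro sums_divide sums_diff sech_partial_fractions)
    moreover have "((2 * a k / ((a k)\<^sup>2 + 0\<^sup>2) - 2 * b k / ((b k)\<^sup>2 + 0\<^sup>2)) -
          (2 * a k / ((a k)\<^sup>2 + x\<^sup>2) - 2 * b k / ((b k)\<^sup>2 + x\<^sup>2))) / x\<^sup>2 = u k x" for k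
    proof -
      have *: "(2 * c / (c\<^sup>2 + 0\<^sup>2) - 2 * c / (c\<^sup>2 + x\<^sup>2)) / x\<^sup>2 = L c x" if c: "0 < c" for c
      proof -
        have "0 < c\<^sup>2 + x\<^sup>2" using c by (intro add_pos_nonneg) auto
        hence "2 * c / c\<^sup>2 - 2 * c / (c\<^sup>2 + x\<^sup>2) = x\<^sup>2 * L c x"
          using c unfolding L_def by (simp add: divide_simps) (simp add: algebra_simps power2_eq_square)
        thus ?thesis using x by simp
      qed
      show ?thesis
        unfolding u_def *[OF ab(1), symmetric] *[OF ab(3), symmetric]
        by (simp add: diff_divide_distrib)
    qed
    ultimately show ?thesis by (simp add: sech_def)
  qed
  define U where "U k x = indicator {0<..} x *\<^sub>R u k x" for k and x :: real
  have val: "pi / (a k)\<^sup>2 - pi / (b k)\<^sup>2 = 4 / pi * (1 / (4 * real k + 1)\<^sup>2 - 1 / (4 * real k + 3)\<^sup>2)" for k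
  proof -
    have "a k = (4 * real k + 1) * pi / 2" "b k = (4 * real k + 3) * pi / 2"
      by (auto simp: a_def b_def field_simps)
    moreover have "pi / (c * pi / 2)\<^sup>2 = 4 / pi * (1 / c\<^sup>2)" for c :: real
      by (simp add: power2_eq_square)
    ultimately show ?thesis by (simp only: right_diff_distrib)
  qed
  have vals: "(\<lambda>k. pi / (a k)\<^sup>2 - pi / (b k)\<^sup>2) sums (4 / pi * catalan_const)"
    unfolding val by (intro sums_mult catalan_const_sums)
  have nonneg: "norm (U k x) = U k x" for k x
    using u_nonneg by (auto simp: U_def)
  have intU: "integrable lborel (U k)" and valU: "integral\<^sup>L lborel (U k) = pi / (a k)\<^sup>2 - pi / (b k)\<^sup>2" for k
    using u_int[of k] u_val[of k] unfolding U_def[abs_def] set_integrable_def set_lebesgue_integral_def by auto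
  have sumsU: "(\<lambda>k. U k x) sums (indicator {0<..} x *\<^sub>R ((1 - sech x ^ 1) / x\<^sup>2))" for x
    using u_sums[of x] by (auto simp: U_def indicator_def)
  have "(\<lambda>k. integral\<^sup>L lborel (U k)) sums (\<integral>x. (\<Sum>k. U k x) \<partial>lborel)"
  proof (rule sums_integral[OF intU])
    show "AE x in lborel. summable (\<lambda>k. norm (U k x))"
      unfolding nonneg using sumsU by (intro AE_I2) (auto simp: sums_iff)
    show "summable (\<lambda>k. \<integral>x. norm (U k x) \<partial>lborel)"
      unfolding nonneg valU using vals by (rule sums_summable)
  qed
  also have "(\<lambda>x. \<Sum>k. U k x) = (\<lambda>x. indicator {0<..} x *\<^sub>R ((1 - sech x ^ 1) / x\<^sup>2))"
    using sumsU by (auto simp: sums_iff)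
  finally have "(\<lambda>k. pi / (a k)\<^sup>2 - pi / (b k)\<^sup>2) sums sech_moment 1"
    unfolding valU sech_moment_def set_lebesgue_integral_def .
  from sums_unique2[OF this vals] show ?thesis by simp
qed

section \<open>Closed forms\<close>

lemma sum_atMost_even:
  fixes g :: "nat \<Rightarrow> complex"
  assumes "\<And>k. odd k \<Longrightarrow> g k = 0"
  shows "(\<Sum>k\<le>2 * n. g k) = (\<Sum>k\<le>n. g (2 * k))"
    and "(\<Sum>k\<le>2 * n + 1. g k) = (\<Sum>k\<le>n. g (2 * k))"
proof -
  show *: "(\<Sum>k\<le>2 * n. g k) = (\<Sum>k\<le>n. g (2 * k))"
    by (induction n) (auto simp: assms)
  show "(\<Sum>k\<le>2 * n + 1. g k) = (\<Sum>k\<le>n. g (2 * k))" using assms[of "2 * n + 1"] * by simp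
qed

text \<open>The derivative identity for the moments, written out with the definition of \<open>sech_zeta\<close>; the
factorial of \<open>n + 1\<close> absorbs the factor \<open>n(n+1)\<close>.\<close>

lemma sech_moment_formula:
  assumes n: "1 \<le> n"
  shows "complex_of_real (sech_moment n) =
      of_nat n ^ 2 * 2 ^ (2 * n - 1) / (4 * fact (n - 1)) *
        (\<Sum>k\<le>n - 1. (- (1 / 2)) ^ k * stirlingP k (n - 1) (of_nat n / 2) *
          hurwitz_zeta'_diff (of_nat k - of_nat n + 2) (of_nat n / 4) ((of_nat n + 2) / 4))
      - 2 ^ (2 * n + 1) / fact (n - 1) *
        (\<Sum>k\<le>n + 1. (- (1 / 2)) ^ k * stirlingP k (n + 1) ((of_nat n + 2) / 2) *
          hurwitz_zeta'_diff (of_nat k - of_nat n) ((of_nat n + 2) / 4) ((of_nat n + 4) / 4))"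
    (is "_ = ?c1 * ?S1 - ?c2 * ?S2")
proof -
  have d1: "deriv (sech_zeta n) 1 = 2 ^ (2 * n - 1) / fact (n - 1) * ?S1"
    by (rule deriv_sech_zeta[OF n])
  have d2: "deriv (sech_zeta (n + 2)) 1 = 2 ^ (2 * n + 3) / fact (n + 1) * ?S2"
  proof -
    have idx: "2 * (n + 2) - 1 = 2 * n + 3" "n + 2 - 1 = n + 1"
      "of_nat (n + 2) = (of_nat n + 2 :: complex)"
      "of_nat k - (of_nat n + 2) + 2 = of_nat k - (of_nat n :: complex)" "of_nat n + 2 + 2 = (of_nat n + 4 :: complex)" for k
      by auto
    have "1 \<le> n + 2" by simp
    from deriv_sech_zeta[OF this] show ?thesis unfolding idx .
  qed
  have f: "fact (n + 1) = (of_nat n + 1) * of_nat n * (fact (n - 1) :: complex)"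
    using n by (cases n) (simp_all add: algebra_simps)
  have nz: "of_nat n \<noteq> (0::complex)" "of_nat n + 1 \<noteq> (0::complex)"
    using n by (auto simp flip: of_nat_Suc simp del: of_nat_Suc simp: add.commute)
  have "4 * complex_of_real (sech_moment n) = of_nat n ^ 2 * (2 ^ (2 * n - 1) / fact (n - 1) * ?S1)
      - of_nat n * (of_nat n + 1) * (2 ^ (2 * n + 3) / fact (n + 1) * ?S2)"
    using sech_moment_eq_deriv_sech_zeta[OF n] unfolding d1 d2 .
  also have "of_nat n * (of_nat n + 1) * (2 ^ (2 * n + 3) / fact (n + 1) * ?S2) = 4 * (?c2 * ?S2)"
    unfolding f using nz by (simp add: power_add divide_simps)
  also have "of_nat n ^ 2 * (2 ^ (2 * n - 1) / fact (n - 1) * ?S1) = 4 * (?c1 * ?S1)"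
    by simp
  finally have "4 * complex_of_real (sech_moment n) = 4 * (?c1 * ?S1 - ?c2 * ?S2)"
    by (simp only: right_diff_distrib)
  thus ?thesis by (simp only: mult_cancel_left) simp
qed

lemma two_powi_diff: "(2::complex) powi (int a - int b) = 2 ^ a / 2 ^ b"
  by (simp add: power_int_diff)

lemma delta_int_formula:
  assumes n: "1 \<le> n"
  shows "complex_of_real (delta_int n) =
      2 powi (2 * int n - 1) * (of_nat n + 1)\<^sup>2 / fact n
        * (\<Sum>k=0..n. (- (1 / 2)) ^ k * stirlingP k n ((of_nat n + 1) / 2)
            * hurwitz_zeta'_diff (of_nat k - of_nat n + 1) ((of_nat n + 1) / 4) ((of_nat n + 3) / 4))
      - 2 ^ (2 * n + 3) / fact n
        * (\<Sum>k=0..n + 2. (- (1 / 2)) ^ k * stirlingP k (n + 2) ((of_nat n + 3) / 2)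
            * hurwitz_zeta'_diff (of_nat k - of_nat n - 1) ((of_nat n + 3) / 4) ((of_nat n + 5) / 4))
      - 2 powi (2 * int n - 3) * (of_nat n)\<^sup>2 / fact (n - 1)
        * (\<Sum>k=0..n - 1. (- (1 / 2)) ^ k * stirlingP k (n - 1) (of_nat n / 2)
            * hurwitz_zeta'_diff (of_nat k - of_nat n + 2) (of_nat n / 4) ((of_nat n + 2) / 4))
      + 2 ^ (2 * n + 1) / fact (n - 1)
        * (\<Sum>k=0..n + 1. (- (1 / 2)) ^ k * stirlingP k (n + 1) ((of_nat n + 2) / 2)
            * hurwitz_zeta'_diff (of_nat k - of_nat n) ((of_nat n + 2) / 4) ((of_nat n + 4) / 4))"
    (is "_ = ?a * ?S1 - ?b * ?S2 - ?c * ?S3 + ?d * ?S4")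
proof -
  have idx: "n + 1 - 1 = n" "n + 1 + 1 = n + 2" "2 * (n + 1) - 1 = 2 * n + 1" "2 * (n + 1) + 1 = 2 * n + 3"
    "of_nat (n + 1) = (of_nat n + 1 :: complex)"
    "of_nat n + 1 + 2 = (of_nat n + 3 :: complex)" "of_nat n + 1 + 4 = (of_nat n + 5 :: complex)"
    "of_nat k - (of_nat n + 1) = (of_nat k - of_nat n - 1 :: complex)"
    "of_nat k - of_nat n - 1 + 2 = (of_nat k - of_nat n + 1 :: complex)" for k
    by auto
  have p1: "(2::complex) powi (2 * int n - 1) = 2 ^ (2 * n + 1) / 4"
    using two_powi_diff[of "2 * n" 1] by simp
  have p3: "(2::complex) powi (2 * int n - 3) = 2 ^ (2 * n - 1) / 4"
    using two_powi_diff[of "2 * n" 3] n by (simp add: power_diff)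
  have a: "(of_nat n + 1)\<^sup>2 * 2 ^ (2 * n + 1) / (4 * fact n) = ?a"
    unfolding p1 by simp
  have c: "(of_nat n)\<^sup>2 * 2 ^ (2 * n - 1) / (4 * fact (n - 1)) = ?c"
    unfolding p3 by simp
  have "1 \<le> n + 1" by simp
  note M1 = sech_moment_formula[OF this, unfolded idx a]
  note M0 = sech_moment_formula[OF n, unfolded c]
  have alg: "A - B - (C - D) = A - B - C + D" for A B C D :: complex by simp
  show ?thesis
    unfolding delta_int_eq_sech_moment of_real_diff M1 M0 atLeast0AtMost by (rule alg)
qed

lemma half_power_even: "(1 / 2) ^ (2 * k) = 1 / (4 ^ k :: complex)"
  by (simp add: power_mult power_divide)

lemma sech_moment_odd:
  "complex_of_real (sech_moment (2 * n + 1)) =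
      2 powi (4 * int n - 1) * (2 * of_nat n + 1)\<^sup>2 / fact (2 * n)
        * (\<Sum>k=0..n. 1 / 4 ^ k * stirlingP (2 * k) (2 * n) ((2 * of_nat n + 1) / 2)
            * hurwitz_zeta'_diff (- 2 * of_nat n + 2 * of_nat k + 1)
                ((2 * of_nat n + 1) / 4) ((2 * of_nat n + 3) / 4))
      - 2 ^ (4 * n + 3) / fact (2 * n)
        * (\<Sum>k=0..n + 1. 1 / 4 ^ k * stirlingP (2 * k) (2 * n + 2) ((2 * of_nat n + 3) / 2)
            * hurwitz_zeta'_diff (- 2 * of_nat n + 2 * of_nat k - 1)
                ((2 * of_nat n + 3) / 4) ((2 * of_nat n + 5) / 4))"
proof -
  have idx: "2 * n + 1 - 1 = 2 * n" "2 * n + 1 + 1 = 2 * n + 2" "2 * (2 * n + 1) - 1 = 4 * n + 1"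
    "2 * (2 * n + 1) + 1 = 4 * n + 3"
    "of_nat (2 * n + 1) = (2 * of_nat n + 1 :: complex)"
    "2 * of_nat n + 1 + 2 = (2 * of_nat n + 3 :: complex)" "2 * of_nat n + 1 + 4 = (2 * of_nat n + 5 :: complex)"
    by auto
  have p: "(2::complex) powi (4 * int n - 1) = 2 ^ (4 * n + 1) / 4"
    using two_powi_diff[of "4 * n" 1] by (simp add: field_simps)
  have a: "(2 * of_nat n + 1 :: complex)\<^sup>2 * 2 ^ (4 * n + 1) / (4 * fact (2 * n)) = 2 powi (4 * int n - 1) * (2 * of_nat n + 1)\<^sup>2 / fact (2 * n)"
    unfolding p by simp
  have S1: "(\<Sum>k\<le>2 * n. (- (1 / 2)) ^ k * stirlingP k (2 * n) ((2 * of_nat n + 1) / 2) * f k) =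
      (\<Sum>k=0..n. 1 / 4 ^ k * stirlingP (2 * k) (2 * n) ((2 * of_nat n + 1) / 2) * f (2 * k))" for f
    unfolding atLeast0AtMost
    by (subst sum_atMost_even(1)) (auto simp: stirlingP_odd_eq_0 half_power_even)
  have S2: "(\<Sum>k\<le>2 * n + 2. (- (1 / 2)) ^ k * stirlingP k (2 * n + 2) ((2 * of_nat n + 3) / 2) * f k) =
      (\<Sum>k=0..n + 1. 1 / 4 ^ k * stirlingP (2 * k) (2 * n + 2) ((2 * of_nat n + 3) / 2) * f (2 * k))" for f
  proof -
    have "2 * n + 2 = 2 * (n + 1)" by simp
    thus ?thesis
      unfolding atLeast0AtMost
      by (simp only:, subst sum_atMost_even(1)) (auto simp: stirlingP_odd_eq_0 half_power_even)
  qed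
  have arg: "of_nat (2 * k) - (2 * of_nat n + 1) = (- 2 * of_nat n + 2 * of_nat k - 1 :: complex)"
    "- 2 * of_nat n + 2 * of_nat k - 1 + 2 = (- 2 * of_nat n + 2 * of_nat k + 1 :: complex)" for k
    by auto
  have "1 \<le> 2 * n + 1" by simp
  note M = sech_moment_formula[OF this, unfolded idx S1 S2 arg a]
  show ?thesis by (rule M)
qed

text \<open>After the odd indices have dropped out, the first sum runs over \<open>\<zeta>'\<close> differences with parameters
\<open>n/2\<close> and \<open>(n+1)/2\<close> once its index is raised by 1, and the second one over \<open>(n+1)/2\<close> and \<open>(n+2)/2\<close>.
The shift identity brings the terms with \<open>k \<ge> 1\<close> of the second sum to the parameters of the first,
at the price of the logarithmic sum; the term \<open>k = 0\<close> has no counterpart and stays separate.\<close>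

lemma sech_moment_even:
  assumes n: "1 \<le> n"
  shows "complex_of_real (sech_moment (2 * n)) =
      2 ^ (4 * n + 1) / fact (2 * n - 1)
        * (\<Sum>k=1..n. 1 / 4 ^ k
            * ((of_nat n)\<^sup>2 * stirlingP (2 * k - 2) (2 * n - 1) (of_nat n)
               + stirlingP (2 * k) (2 * n + 1) (of_nat n + 1))
            * hurwitz_zeta'_diff (- 2 * of_nat n + 2 * of_nat k) (of_nat n / 2) ((of_nat n + 1) / 2))
      + 2 ^ (4 * n + 1) * of_nat n ^ (2 * n) * of_real (ln (real n / 2)) / (4 ^ n * fact (2 * n - 1))
        * (\<Sum>k=1..n. 1 / of_nat n ^ (2 * k) * stirlingP (2 * k) (2 * n + 1) (of_nat n + 1))
      - 2 ^ (4 * n + 1) / fact (2 * n - 1)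
        * hurwitz_zeta'_diff (- 2 * of_nat n) ((of_nat n + 1) / 2) ((of_nat n + 2) / 2)"
proof -
  define F :: complex where "F = fact (2 * n - 1)"
  define l :: complex where "l = of_real (ln (real n / 2))"
  define N :: complex where "N = of_nat n"
  define Z where "Z k = hurwitz_zeta'_diff (- 2 * N + 2 * of_nat k) (N / 2) ((N + 1) / 2)" for k
  define Y where "Y k = hurwitz_zeta'_diff (- 2 * N + 2 * of_nat k) ((N + 1) / 2) ((N + 2) / 2)" for k
  define P where "P k = stirlingP (2 * k) (2 * n + 1) (N + 1)" for k
  define P' where "P' k = stirlingP (2 * k - 2) (2 * n - 1) N" for k
  have F: "F \<noteq> 0" and N: "N \<noteq> 0" using n by (auto simp: F_def N_def)
  have idx: "2 * (2 * n) - 1 = 4 * n - 1" "2 * (2 * n) + 1 = 4 * n + 1"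
    "of_nat (2 * n) = 2 * N" "2 * N / 2 = N" "2 * N / 4 = N / 2" "(2 * N + 2) / 4 = (N + 1) / 2"
    "(2 * N + 2) / 2 = N + 1" "(2 * N + 4) / 4 = (N + 2) / 2"
    by (auto simp: N_def add_divide_distrib)
  have S1: "(\<Sum>k\<le>2 * n - 1. (- (1 / 2)) ^ k * stirlingP k (2 * n - 1) N *
      hurwitz_zeta'_diff (of_nat k - 2 * N + 2) (N / 2) ((N + 1) / 2)) = 4 * (\<Sum>k=1..n. 1 / 4 ^ k * P' k * Z k)"
  proof -
    obtain m where m: "n = Suc m" using n by (cases n) auto
    have "(\<Sum>k\<le>2 * m + 1. (- (1 / 2)) ^ k * stirlingP k (2 * n - 1) N *
      hurwitz_zeta'_diff (of_nat k - 2 * N + 2) (N / 2) ((N + 1) / 2)) =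
      (\<Sum>k\<le>m. 1 / 4 ^ k * stirlingP (2 * k) (2 * n - 1) N * hurwitz_zeta'_diff (of_nat (2 * k) - 2 * N + 2) (N / 2) ((N + 1) / 2))"
      by (subst sum_atMost_even(2)) (auto simp: stirlingP_odd_eq_0 half_power_even N_def m)
    also have "\<dots> = (\<Sum>k\<le>m. 4 * (1 / 4 ^ Suc k * P' (Suc k) * Z (Suc k)))"
      by (intro sum.cong refl) (simp add: P'_def Z_def algebra_simps)
    also have "\<dots> = 4 * (\<Sum>k=1..n. 1 / 4 ^ k * P' k * Z k)"
      unfolding sum_distrib_left[symmetric] m
      by (intro arg_cong[of _ _ "\<lambda>x. 4 * x"], rule sum.reindex_bij_witness[of _ "\<lambda>k. k - 1" Suc]) auto
    finally show ?thesis using m by simp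
  qed
  have S2: "(\<Sum>k\<le>2 * n + 1. (- (1 / 2)) ^ k * stirlingP k (2 * n + 1) (N + 1) *
      hurwitz_zeta'_diff (of_nat k - 2 * N) ((N + 1) / 2) ((N + 2) / 2)) =
      Y 0 - (\<Sum>k=1..n. 1 / 4 ^ k * P k * Z k) - l * N ^ (2 * n) / 4 ^ n * (\<Sum>k=1..n. 1 / N ^ (2 * k) * P k)"
  proof -
    have "(\<Sum>k\<le>2 * n + 1. (- (1 / 2)) ^ k * stirlingP k (2 * n + 1) (N + 1) *
      hurwitz_zeta'_diff (of_nat k - 2 * N) ((N + 1) / 2) ((N + 2) / 2)) =
      (\<Sum>k\<le>n. 1 / 4 ^ k * stirlingP (2 * k) (2 * n + 1) (N + 1) *
      hurwitz_zeta'_diff (of_nat (2 * k) - 2 * N) ((N + 1) / 2) ((N + 2) / 2))"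
      by (subst sum_atMost_even(2)) (auto simp: stirlingP_odd_eq_0 half_power_even N_def)
    also have "\<dots> = (\<Sum>k\<le>n. 1 / 4 ^ k * P k * Y k)"
      by (intro sum.cong refl) (simp add: P_def Y_def)
    also have "\<dots> = Y 0 + (\<Sum>k=1..n. 1 / 4 ^ k * P k * Y k)"
      by (simp add: atMost_atLeast0 sum.atLeast_Suc_atMost P_def)
    also have "(\<Sum>k=1..n. 1 / 4 ^ k * P k * Y k) =
        (\<Sum>k=1..n. - (1 / 4 ^ k * P k * Z k) - l * N ^ (2 * n) / 4 ^ n * (1 / N ^ (2 * k) * P k))"
    proof (intro sum.cong refl)
      fix k assume "k \<in> {1..n}"
      hence k: "k \<le> n" by simp
      have Y: "Y k = - Z k - l * (N / 2) ^ (2 * (n - k))"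
        using hurwitz_zeta'_diff_shift[OF n k] unfolding Y_def Z_def l_def N_def .
      have e: "N ^ (2 * n) = N ^ (2 * (n - k)) * N ^ (2 * k)" "(4::complex) ^ n = 4 ^ (n - k) * 4 ^ k"
        using k by (simp_all flip: power_add add: algebra_simps)
      have "l * N ^ (2 * n) / 4 ^ n * (1 / N ^ (2 * k) * P k) = 1 / 4 ^ k * P k * (l * (N / 2) ^ (2 * (n - k)))"
      proof -
        have "(N / 2) ^ (2 * (n - k)) = N ^ (2 * (n - k)) / 4 ^ (n - k)"
          by (simp add: power_divide power_mult[of 2])
        thus ?thesis unfolding e using N by (simp add: mult_ac)
      qed
      thus "1 / 4 ^ k * P k * Y k = - (1 / 4 ^ k * P k * Z k) - l * N ^ (2 * n) / 4 ^ n * (1 / N ^ (2 * k) * P k)"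
        unfolding Y by (simp only: right_diff_distrib mult_minus_right)
    qed
    also have "\<dots> = - (\<Sum>k=1..n. 1 / 4 ^ k * P k * Z k) - l * N ^ (2 * n) / 4 ^ n * (\<Sum>k=1..n. 1 / N ^ (2 * k) * P k)"
      by (simp only: sum_subtractf sum_negf sum_distrib_left)
    finally show ?thesis by simp
  qed
  have c: "2 ^ (4 * n - 1) = (2::complex) ^ (4 * n + 1) / 4"
    using n by (simp add: power_diff power_add)
  have "1 \<le> 2 * n" using n by simp
  note M = sech_moment_formula[OF this, unfolded idx F_def[symmetric] S1 S2 c]
  have "(\<Sum>k=1..n. 1 / 4 ^ k * (N\<^sup>2 * P' k + P k) * Z k) =
      N\<^sup>2 * (\<Sum>k=1..n. 1 / 4 ^ k * P' k * Z k) + (\<Sum>k=1..n. 1 / 4 ^ k * P k * Z k)"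
    unfolding sum_distrib_left sum.distrib[symmetric] by (intro sum.cong refl) (simp add: algebra_simps)
  hence "complex_of_real (sech_moment (2 * n)) =
      2 ^ (4 * n + 1) / F * (\<Sum>k=1..n. 1 / 4 ^ k * (N\<^sup>2 * P' k + P k) * Z k)
      + 2 ^ (4 * n + 1) * N ^ (2 * n) * l / (4 ^ n * F) * (\<Sum>k=1..n. 1 / N ^ (2 * k) * P k)
      - 2 ^ (4 * n + 1) / F * Y 0"
    unfolding M using F by (simp add: divide_simps) (simp add: algebra_simps power2_eq_square)
  thus ?thesis
    unfolding P_def P'_def Z_def Y_def F_def l_def N_def by simp
qed

lemma lambda_int_eq:
  assumes "1 \<le> n"
  shows "complex_of_real (lambda_int n) = of_real (sech_moment n) / of_nat n"
  using assms arg_cong[OF lambda_int_eq_sech_moment[OF assms], of complex_of_real]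
  by (simp add: field_simps)

text \<open>Division of the moment formulas by \<open>2n\<close> and \<open>2n+1\<close>, with variables in place of the sums so that
simplification cannot rearrange the summands.\<close>

lemma rescale_even:
  fixes N F L S T Z :: complex
  assumes "1 \<le> n" "N \<noteq> 0" "F \<noteq> 0"
  shows "(2 ^ (4 * n + 1) / F * S + 2 ^ (4 * n + 1) * N ^ (2 * n) * L / (4 ^ n * F) * T -
      2 ^ (4 * n + 1) / F * Z) / (2 * N) =
    2 ^ (4 * n) / (N * F) * S + 2 ^ (2 * n) * N ^ (2 * n - 1) * L / F * T - 2 ^ (4 * n) / (N * F) * Z"
proof -
  have "2 * n = Suc (2 * n - 1)" using assms(1) by simp
  hence "N ^ (2 * n) = N * N ^ (2 * n - 1)" by (metis power_Suc)
  moreover have "(2::complex) ^ (4 * n) = 2 ^ (2 * n) * 4 ^ n"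
    by (simp add: power_mult flip: power_mult_distrib)
  ultimately have "2 ^ (4 * n + 1) * N ^ (2 * n) * L / (4 ^ n * F) * T / (2 * N) =
      2 ^ (2 * n) * N ^ (2 * n - 1) * L / F * T"
    using assms by (simp add: field_simps)
  thus ?thesis using assms by (simp add: add_divide_distrib diff_divide_distrib mult_ac)
qed

lemma rescale_odd:
  fixes p M F c S T :: complex
  assumes "M \<noteq> 0"
  shows "(p * M\<^sup>2 / F * S - c / F * T) / M = p * M / F * S - c / (M * F) * T"
  using assms by (simp add: diff_divide_distrib power2_eq_square mult_ac)

theorem theorem2:
  shows
  "(\<forall>n\<ge>1. complex_of_real (chi_int (2 * n)) =
      - (4 * of_real catalan_const / of_real pi)
      + 2 ^ (4 * n + 1) / fact (2 * n - 1)
        * (\<Sum>k=1..n. 1 / 4 ^ k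
            * ((of_nat n)\<^sup>2 * stirlingP (2 * k - 2) (2 * n - 1) (of_nat n)
               + stirlingP (2 * k) (2 * n + 1) (of_nat n + 1))
            * hurwitz_zeta'_diff (- 2 * of_nat n + 2 * of_nat k) (of_nat n / 2) ((of_nat n + 1) / 2))
      + 2 ^ (4 * n + 1) * of_nat n ^ (2 * n) * of_real (ln (real n / 2)) / (4 ^ n * fact (2 * n - 1))
        * (\<Sum>k=1..n. 1 / of_nat n ^ (2 * k) * stirlingP (2 * k) (2 * n + 1) (of_nat n + 1))
      - 2 ^ (4 * n + 1) / fact (2 * n - 1)
        * hurwitz_zeta'_diff (- 2 * of_nat n) ((of_nat n + 1) / 2) ((of_nat n + 2) / 2))
 \<and> (\<forall>n\<ge>0. complex_of_real (chi_int (2 * n + 1)) =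
      - (4 * of_real catalan_const / of_real pi)
      + 2 powi (4 * int n - 1) * (2 * of_nat n + 1)\<^sup>2 / fact (2 * n)
        * (\<Sum>k=0..n. 1 / 4 ^ k * stirlingP (2 * k) (2 * n) ((2 * of_nat n + 1) / 2)
            * hurwitz_zeta'_diff (- 2 * of_nat n + 2 * of_nat k + 1)
                ((2 * of_nat n + 1) / 4) ((2 * of_nat n + 3) / 4))
      - 2 ^ (4 * n + 3) / fact (2 * n)
        * (\<Sum>k=0..n + 1. 1 / 4 ^ k * stirlingP (2 * k) (2 * n + 2) ((2 * of_nat n + 3) / 2)
            * hurwitz_zeta'_diff (- 2 * of_nat n + 2 * of_nat k - 1)
                ((2 * of_nat n + 3) / 4) ((2 * of_nat n + 5) / 4)))
 \<and> (\<forall>n\<ge>1. complex_of_real (lambda_int (2 * n)) =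
      2 ^ (4 * n) / (of_nat n * fact (2 * n - 1))
        * (\<Sum>k=1..n. 1 / 4 ^ k
            * ((of_nat n)\<^sup>2 * stirlingP (2 * k - 2) (2 * n - 1) (of_nat n)
               + stirlingP (2 * k) (2 * n + 1) (of_nat n + 1))
            * hurwitz_zeta'_diff (- 2 * of_nat n + 2 * of_nat k) (of_nat n / 2) ((of_nat n + 1) / 2))
      + 2 ^ (2 * n) * of_nat n ^ (2 * n - 1) * of_real (ln (real n / 2)) / fact (2 * n - 1)
        * (\<Sum>k=1..n. 1 / of_nat n ^ (2 * k) * stirlingP (2 * k) (2 * n + 1) (of_nat n + 1))
      - 2 ^ (4 * n) / (of_nat n * fact (2 * n - 1))
        * hurwitz_zeta'_diff (- 2 * of_nat n) ((of_nat n + 1) / 2) ((of_nat n + 2) / 2))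
 \<and> (\<forall>n\<ge>0. complex_of_real (lambda_int (2 * n + 1)) =
      2 powi (4 * int n - 1) * (2 * of_nat n + 1) / fact (2 * n)
        * (\<Sum>k=0..n. 1 / 4 ^ k * stirlingP (2 * k) (2 * n) ((2 * of_nat n + 1) / 2)
            * hurwitz_zeta'_diff (- 2 * of_nat n + 2 * of_nat k + 1)
                ((2 * of_nat n + 1) / 4) ((2 * of_nat n + 3) / 4))
      - 2 ^ (4 * n + 3) / fact (2 * n + 1)
        * (\<Sum>k=0..n + 1. 1 / 4 ^ k * stirlingP (2 * k) (2 * n + 2) ((2 * of_nat n + 3) / 2)
            * hurwitz_zeta'_diff (- 2 * of_nat n + 2 * of_nat k - 1)
                ((2 * of_nat n + 3) / 4) ((2 * of_nat n + 5) / 4)))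
 \<and> (\<forall>n\<ge>1. complex_of_real (delta_int n) =
      2 powi (2 * int n - 1) * (of_nat n + 1)\<^sup>2 / fact n
        * (\<Sum>k=0..n. (- (1 / 2)) ^ k * stirlingP k n ((of_nat n + 1) / 2)
            * hurwitz_zeta'_diff (of_nat k - of_nat n + 1) ((of_nat n + 1) / 4) ((of_nat n + 3) / 4))
      - 2 ^ (2 * n + 3) / fact n
        * (\<Sum>k=0..n + 2. (- (1 / 2)) ^ k * stirlingP k (n + 2) ((of_nat n + 3) / 2)
            * hurwitz_zeta'_diff (of_nat k - of_nat n - 1) ((of_nat n + 3) / 4) ((of_nat n + 5) / 4))
      - 2 powi (2 * int n - 3) * (of_nat n)\<^sup>2 / fact (n - 1)
        * (\<Sum>k=0..n - 1. (- (1 / 2)) ^ k * stirlingP k (n - 1) (of_nat n / 2)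
            * hurwitz_zeta'_diff (of_nat k - of_nat n + 2) (of_nat n / 4) ((of_nat n + 2) / 4))
      + 2 ^ (2 * n + 1) / fact (n - 1)
        * (\<Sum>k=0..n + 1. (- (1 / 2)) ^ k * stirlingP k (n + 1) ((of_nat n + 2) / 2)
            * hurwitz_zeta'_diff (of_nat k - of_nat n) ((of_nat n + 2) / 4) ((of_nat n + 4) / 4)))"
proof (intro conjI allI impI, goal_cases)
  case (1 n)
  have rearrange: "A + B - C - Y = - Y + A + B - C" for A B C Y :: complex by simp
  have M1: "complex_of_real (sech_moment 1) = 4 * of_real catalan_const / of_real pi"
    by (simp only: sech_moment_1 of_real_mult of_real_divide of_real_numeral)
  show ?case
    unfolding chi_int_eq_sech_moment of_real_diff sech_moment_even[OF 1] M1 by (rule rearrange)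
next
  case (2 n)
  have rearrange: "A - B - Y = - Y + A - B" for A B Y :: complex by simp
  have M1: "complex_of_real (sech_moment 1) = 4 * of_real catalan_const / of_real pi"
    by (simp only: sech_moment_1 of_real_mult of_real_divide of_real_numeral)
  show ?case
    unfolding chi_int_eq_sech_moment of_real_diff sech_moment_odd M1 by (rule rearrange)
next
  case (3 n)
  have n: "1 \<le> 2 * n" "of_nat n \<noteq> (0::complex)" "fact (2 * n - 1) \<noteq> (0::complex)"
    using 3 by auto
  have "complex_of_real (lambda_int (2 * n)) = of_real (sech_moment (2 * n)) / (2 * of_nat n)"
    using lambda_int_eq[OF n(1)] by simp
  also note sech_moment_even[OF 3]
  also note rescale_even[OF 3 n(2,3)]
  finally show ?case .
next
  case (4 n)
  have n: "1 \<le> 2 * n + 1" by simp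
  have M: "of_nat (2 * n + 1) = (2 * of_nat n + 1 :: complex)" by simp
  have "2 * of_nat n + 1 \<noteq> (0::complex)"
    unfolding M[symmetric] by (simp only: of_nat_eq_0_iff)
  note rescale = rescale_odd[OF this]
  have f: "fact (2 * n + 1) = (2 * of_nat n + 1) * (fact (2 * n) :: complex)" by simp
  show ?case
    unfolding lambda_int_eq[OF n] M sech_moment_odd f by (rule rescale)
next
  case (5 n)
  show ?case by (rule delta_int_formula[OF 5])
qed

end
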